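(* Assume $s>2c$. Let $f^*=f^{(s-c)}$ be the voting rule with parameter $r=s-c$ and let $g^*$ be the flip attack. Then for every admissible detection strategy $f$ and every admissible attack $g$, $$\gamma(f,g^* )\le\gamma(f^*,g^* )=(s-2c)\,I\le\gamma(f^*,g),$$ where $I=\min\{I_0,I_1\}$; i.e. $(f^*,g^* )$ is a Nash equilibrium of the game with payoff $\gamma$ to the detector and $-\gamma$ to the attacker.
   Context: A binary state $\theta\in\{0,1\}$ is observed by $s$ sensors indexed by $\mathcal{S}=\{1,\dots,s\}$; at each time $k\in\mathbb{Z}^+$ sensor $i$ produces a real observation $x_i(k)$. Let $\mu,\nu$ be mutually absolutely continuous Borel probability measures on $\mathbb{R}$. Under $\mathbb{P}_\theta$ all $x_i(k)$ are independent, with law $\nu$ if $\theta=0$ and $\mu$ if $\theta=1$. Let $I_1=\int\log\frac{d\mu}{d\nu}\,d\mu$, $I_0=-\int\log\frac{d\mu}{d\nu}\,d\nu$, assumed $0<I_0,I_1<\infty$, and $I=\min\{I_0,I_1\}$. Attack model: an attacker compromises a fixed set $\mathcal{C}\subseteq\mathcal{S}$ with $|\mathcal{C}|=c$ (the detector knows $c$ but not $\mathcal{C}$). The fusion center receives $x'(k)=x(k)+x^a(k)$, where $x^a(k)\in\mathbb{R}^s$, the union over $k$ of the supports of $x^a(k)$ equals $\mathcal{C}$, and $x^a(k)=g(X_{\mathcal{C}}(k),X^a(k-1),\theta,k)$ is a measurable (possibly randomized) function of the true observations of the compromised sensors up to time $k$, the previously injected vectors, the true state $\theta$, and $k$. Such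 $g$ is an admissible attack; $\mathbb{P}^g_\theta,\mathbb{E}^g_\theta$ denote probability and expectation of the manipulated observations. A detection strategy is $f=(f_1,f_2,\dots)$ with $f_k$ mapping $x'(1),\dots,x'(k)$ to $\{\text{continue},0,1\}$; stopping time $T$ is the first $k$ with $f_k\neq\text{continue}$, decision $f_T$. With $\alpha=\mathbb{P}^g_0[f_T=1]$, $\beta=\mathbb{P}^g_1[f_T=0]$, $D(T)=\max_\theta\mathbb{E}^g_\theta[T]$, the performance is $\gamma(f,g)=\lim_{\alpha=\beta\to0^+}\frac{\log(1/\alpha)}{D(T)}$, the limit taken along the family of tests for which $\alpha=\beta\to0$. Voting rule $f^{(r)}$ ($s/2<r\le s$): with $S_i(n)=\sum_{k=1}^n\log\frac{d\mu}{d\nu}(x'_i(k))$, thresholds $a=b>0$ (tending to $\infty$), $\tau^+_i(b)=\inf\{k:S_i(k)\ge b\}$, $\tau^-_i(a)=\inf\{k:S_i(k)\le -a\}$, and $\tau^\pm_{(j)}$ the $j$-th smallest of these over $i$; the rule stops at $\min\{\tau^-_{(r)}(a),\tau^+_{(r)}(b)\}$, deciding $0$ if $\tau^-_{(r)}(a)<\tau^+_{(r)}(b)$, $1$ if $\tau^+_{(r)}(b)<\tau^-_{(r)}(a)$, and $0$ or $1$ with probability $1/2$ each if equal. Flip attack $g^*$: let $\mathcal{O}_1=\{1,\dots,c\}$, $\mathcal{O}_2=\{s-c+1,\dots,s\}$. If $\theta=0$, for each $k$ and $i\in\mathcal{O}_1$ the attacker draws an independent $\tilde x_i(k)$ with law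 $\mu$ and sets $x^a_i(k)=\tilde x_i(k)-x_i(k)$; if $\theta=1$, for each $k$ and $i\in\mathcal{O}_2$ it draws an independent $\tilde x_i(k)$ with law $\nu$ and sets $x^a_i(k)=\tilde x_i(k)-x_i(k)$; all other entries of $x^a(k)$ are $0$. *)

theory Defs
  imports "HOL-Probability.Probability"
begin

text \<open>Conventions.  Sensors are indexed 0,...,s-1 (paper: 1,...,s) and time is indexed
  0,1,2,... where index k stands for the paper's time k+1.  An observation path is
  x :: obs with x k i = observation of sensor i at (0-based) time k.
  The state theta is a bool (True = state 1, False = state 0).\<close>

type_synonym obs = "nat \<Rightarrow> nat \<Rightarrow> real"

definition obs_space :: "nat \<Rightarrow> obs measure" where
  "obs_space s = PiM UNIV (\<lambda>k. PiM {..<s} (\<lambda>i. borel))"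

definition obs_law :: "nat \<Rightarrow> real measure \<Rightarrow> real measure \<Rightarrow> bool \<Rightarrow> obs measure" where
  "obs_law s \<mu> \<nu> \<theta> = PiM UNIV (\<lambda>k. PiM {..<s} (\<lambda>i. if \<theta> then \<mu> else \<nu>))"

definition LLR :: "real measure \<Rightarrow> real measure \<Rightarrow> real \<Rightarrow> real" where
  "LLR \<mu> \<nu> y = ln (enn2real (RN_deriv \<nu> \<mu> y))"

definition I1 :: "real measure \<Rightarrow> real measure \<Rightarrow> real" where
  "I1 \<mu> \<nu> = (LINT y|\<mu>. LLR \<mu> \<nu> y)"

definition I0 :: "real measure \<Rightarrow> real measure \<Rightarrow> real" where
  "I0 \<mu> \<nu> = - (LINT y|\<nu>. LLR \<mu> \<nu> y)"

text \<open>Admissible attack: for each state theta a compromised set C theta of c sensors,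
  a probability space R for the attacker's randomness, and the injection
  A theta x \<omega> k i = x^a_i(k) (0-based time k).  The injection at time k is a measurable
  function of the true observations of the compromised sensors up to time k (previously
  injected vectors are themselves such functions), of theta, k, and the attacker's randomness;
  it vanishes outside C theta, and almost surely the union of its supports is C theta.\<close>
definition admissible_attack ::
  "nat \<Rightarrow> nat \<Rightarrow> real measure \<Rightarrow> real measure \<Rightarrow> (bool \<Rightarrow> nat set) \<Rightarrow> 'r measure
    \<Rightarrow> (bool \<Rightarrow> obs \<Rightarrow> 'r \<Rightarrow> nat \<Rightarrow> nat \<Rightarrow> real) \<Rightarrow> bool" where
  "admissible_attack s c \<mu> \<nu> C R A \<longleftrightarrow> prob_space R \<and>
     (\<forall>\<theta>. C \<theta> \<subseteq> {..<s} \<and> card (C \<theta>) = c \<and>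
       (\<forall>k i. (\<lambda>(x, \<omega>). A \<theta> x \<omega> k i) \<in> borel_measurable (obs_space s \<Otimes>\<^sub>M R)) \<and>
       (\<forall>k x y \<omega>. (\<forall>j\<le>k. \<forall>i\<in>C \<theta>. x j i = y j i) \<longrightarrow> A \<theta> x \<omega> k = A \<theta> y \<omega> k) \<and>
       (\<forall>k x \<omega> i. i \<notin> C \<theta> \<longrightarrow> A \<theta> x \<omega> k i = 0) \<and>
       (AE p in obs_law s \<mu> \<nu> \<theta> \<Otimes>\<^sub>M R. \<forall>i\<in>C \<theta>. \<exists>k. A \<theta> (fst p) (snd p) k i \<noteq> 0))"

definition manip :: "nat \<Rightarrow> (bool \<Rightarrow> obs \<Rightarrow> 'r \<Rightarrow> nat \<Rightarrow> nat \<Rightarrow> real) \<Rightarrow> bool \<Rightarrow> obs \<Rightarrow> 'r \<Rightarrow> obs" where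
  "manip s A \<theta> x \<omega> = (\<lambda>k. restrict (\<lambda>i. x k i + A \<theta> x \<omega> k i) {..<s})"

text \<open>Admissible (possibly randomized) test: randomness space Rd, and
  d k x' v \<in> {None = continue, Some False = decide 0, Some True = decide 1},
  measurable and depending only on x'(0..k) (and the detector's randomness v).\<close>
definition admissible_test :: "nat \<Rightarrow> 'd measure \<Rightarrow> (nat \<Rightarrow> obs \<Rightarrow> 'd \<Rightarrow> bool option) \<Rightarrow> bool" where
  "admissible_test s Rd d \<longleftrightarrow> prob_space Rd \<and>
     (\<forall>k. (\<lambda>(x, v). d k x v) \<in> measurable (obs_space s \<Otimes>\<^sub>M Rd) (count_space UNIV)) \<and>
     (\<forall>k x y v. (\<forall>j\<le>k. x j = y j) \<longrightarrow> d k x v = d k y v)"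

definition decides :: "(nat \<Rightarrow> obs \<Rightarrow> 'd \<Rightarrow> bool option) \<Rightarrow> obs \<Rightarrow> 'd \<Rightarrow> bool \<Rightarrow> bool" where
  "decides d x v b \<longleftrightarrow> (\<exists>k. (\<forall>j<k. d j x v = None) \<and> d k x v = Some b)"

text \<open>Stopping time T (paper's 1-based time), infinite if the test never stops.\<close>
definition run_time :: "(nat \<Rightarrow> obs \<Rightarrow> 'd \<Rightarrow> bool option) \<Rightarrow> obs \<Rightarrow> 'd \<Rightarrow> ennreal" where
  "run_time d x v = (if \<exists>k. d k x v \<noteq> None then of_nat (Suc (LEAST k. d k x v \<noteq> None)) else \<infinity>)"

definition base_measure ::
  "nat \<Rightarrow> real measure \<Rightarrow> real measure \<Rightarrow> 'r measure \<Rightarrow> 'd measure \<Rightarrow> bool \<Rightarrow> ((obs \<times> 'r) \<times> 'd) measure" where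
  "base_measure s \<mu> \<nu> R Rd \<theta> = (obs_law s \<mu> \<nu> \<theta> \<Otimes>\<^sub>M R) \<Otimes>\<^sub>M Rd"

definition err_prob ::
  "nat \<Rightarrow> real measure \<Rightarrow> real measure \<Rightarrow> 'd measure \<Rightarrow> (nat \<Rightarrow> obs \<Rightarrow> 'd \<Rightarrow> bool option)
    \<Rightarrow> 'r measure \<Rightarrow> (bool \<Rightarrow> obs \<Rightarrow> 'r \<Rightarrow> nat \<Rightarrow> nat \<Rightarrow> real) \<Rightarrow> bool \<Rightarrow> real" where
  "err_prob s \<mu> \<nu> Rd d R A \<theta> = measure (base_measure s \<mu> \<nu> R Rd \<theta>)
     {p \<in> space (base_measure s \<mu> \<nu> R Rd \<theta>).
        decides d (manip s A \<theta> (fst (fst p)) (snd (fst p))) (snd p) (\<not> \<theta>)}"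

definition exp_time ::
  "nat \<Rightarrow> real measure \<Rightarrow> real measure \<Rightarrow> 'd measure \<Rightarrow> (nat \<Rightarrow> obs \<Rightarrow> 'd \<Rightarrow> bool option)
    \<Rightarrow> 'r measure \<Rightarrow> (bool \<Rightarrow> obs \<Rightarrow> 'r \<Rightarrow> nat \<Rightarrow> nat \<Rightarrow> real) \<Rightarrow> bool \<Rightarrow> ennreal" where
  "exp_time s \<mu> \<nu> Rd d R A \<theta> = (\<integral>\<^sup>+ p. run_time d (manip s A \<theta> (fst (fst p)) (snd (fst p))) (snd p)
      \<partial>base_measure s \<mu> \<nu> R Rd \<theta>)"

definition max_err where
  "max_err s \<mu> \<nu> Rd d R A = max (err_prob s \<mu> \<nu> Rd d R A False) (err_prob s \<mu> \<nu> Rd d R A True)"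

definition delay where
  "delay s \<mu> \<nu> Rd d R A = max (exp_time s \<mu> \<nu> Rd d R A False) (exp_time s \<mu> \<nu> Rd d R A True)"

text \<open>The quantity log(1/error)/D(T) whose limit (as the error tends to 0) is gamma(f,g).
  Here error = max(alpha, beta) (= alpha = beta on the paper's family).\<close>
definition perf_ratio ::
  "nat \<Rightarrow> real measure \<Rightarrow> real measure \<Rightarrow> 'd measure \<Rightarrow> (nat \<Rightarrow> obs \<Rightarrow> 'd \<Rightarrow> bool option)
    \<Rightarrow> 'r measure \<Rightarrow> (bool \<Rightarrow> obs \<Rightarrow> 'r \<Rightarrow> nat \<Rightarrow> nat \<Rightarrow> real) \<Rightarrow> ereal" where
  "perf_ratio s \<mu> \<nu> Rd d R A =
     (let e = max_err s \<mu> \<nu> Rd d R A in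
      (if e = 0 then \<infinity> else ereal (- ln e)) / enn2ereal (delay s \<mu> \<nu> Rd d R A))"

text \<open>S_i at (0-based) time n, i.e. paper's S_i(n+1).\<close>
definition cumLLR :: "real measure \<Rightarrow> real measure \<Rightarrow> obs \<Rightarrow> nat \<Rightarrow> nat \<Rightarrow> real" where
  "cumLLR \<mu> \<nu> x i n = (\<Sum>j\<le>n. LLR \<mu> \<nu> (x j i))"

definition tau_plus :: "real measure \<Rightarrow> real measure \<Rightarrow> real \<Rightarrow> obs \<Rightarrow> nat \<Rightarrow> enat" where
  "tau_plus \<mu> \<nu> b x i = (if \<exists>n. cumLLR \<mu> \<nu> x i n \<ge> b then enat (LEAST n. cumLLR \<mu> \<nu> x i n \<ge> b) else \<infinity>)"

definition tau_minus :: "real measure \<Rightarrow> real measure \<Rightarrow> real \<Rightarrow> obs \<Rightarrow> nat \<Rightarrow> enat" where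
  "tau_minus \<mu> \<nu> a x i = (if \<exists>n. cumLLR \<mu> \<nu> x i n \<le> - a then enat (LEAST n. cumLLR \<mu> \<nu> x i n \<le> - a) else \<infinity>)"

definition order_stat :: "nat \<Rightarrow> nat \<Rightarrow> (nat \<Rightarrow> enat) \<Rightarrow> enat" where
  "order_stat s r \<tau> = (if \<exists>k. r \<le> card {i. i < s \<and> \<tau> i \<le> enat k}
      then enat (LEAST k. r \<le> card {i. i < s \<and> \<tau> i \<le> enat k}) else \<infinity>)"

text \<open>Voting rule f^(r) with thresholds a = b = t; randomness v is a fair coin used on ties.\<close>
definition voting_rule :: "nat \<Rightarrow> nat \<Rightarrow> real measure \<Rightarrow> real measure \<Rightarrow> real \<Rightarrow> nat \<Rightarrow> obs \<Rightarrow> bool \<Rightarrow> bool option" where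
  "voting_rule s r \<mu> \<nu> t k x v =
     (let m = order_stat s r (tau_minus \<mu> \<nu> t x); p = order_stat s r (tau_plus \<mu> \<nu> t x) in
      if min m p = enat k then (if m < p then Some False else if p < m then Some True else Some v)
      else None)"

definition fair_coin :: "bool measure" where
  "fair_coin = measure_pmf (bernoulli_pmf (1/2))"

text \<open>O_1 = {0..<c}, O_2 = {s-c..<s} (0-based).  The attacker's randomness supplies, for every
  time k and sensor i, an independent pair (sample of mu, sample of nu).\<close>
definition flip_C :: "nat \<Rightarrow> nat \<Rightarrow> bool \<Rightarrow> nat set" where
  "flip_C s c \<theta> = (if \<theta> then {s - c..<s} else {..<c})"

definition flip_rand :: "nat \<Rightarrow> real measure \<Rightarrow> real measure \<Rightarrow> (nat \<Rightarrow> nat \<Rightarrow> real \<times> real) measure" where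
  "flip_rand s \<mu> \<nu> = PiM UNIV (\<lambda>k. PiM {..<s} (\<lambda>i. \<mu> \<Otimes>\<^sub>M \<nu>))"

definition flip_attack :: "nat \<Rightarrow> nat \<Rightarrow> bool \<Rightarrow> obs \<Rightarrow> (nat \<Rightarrow> nat \<Rightarrow> real \<times> real) \<Rightarrow> nat \<Rightarrow> nat \<Rightarrow> real" where
  "flip_attack s c \<theta> x \<omega> k i =
     (if \<theta> then (if s - c \<le> i \<and> i < s then snd (\<omega> k i) - x k i else 0)
      else (if i < c then fst (\<omega> k i) - x k i else 0))"

end

theory Submission
  imports Defs
begin

text \<open>
  Under the flip attack only the \<open>s - 2c\<close> middle sensors have different laws in the two states, each
  contributing the information \<open>I\<^sub>1\<close> or \<open>I\<^sub>0\<close> per time step.  For a stopping time \<open>T\<close>, Wald's identity at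
  horizon \<open>n\<close> gives \<open>E\<^sub>\<theta>[L] = (s - 2c) I\<^sub>\<theta> E\<^sub>\<theta>[min T n]\<close> for the log-likelihood ratio \<open>L\<close> at \<open>min T n\<close>, while
  a change of measure bounds it below by \<open>l P\<^sub>\<theta>(A) + 1 - ln 2 - (1 + (exp l - 1) P'(A)) / 2\<close>, where \<open>A\<close> is
  the correct decision and \<open>P'\<close> the law in the other state.  Taking \<open>l = - ln e\<close> for the error \<open>e\<close> yields
  the upper bound on the performance of any test.

  Conversely, a wrong vote needs \<open>s - 2c\<close> honest sensors to cross the threshold \<open>t\<close> against their drift,
  which has probability at most \<open>2\<^sup>s exp (- (s - 2c) t)\<close> by a joint Ville inequality.  The rule stops as soon
  as all honest sensors have crossed in the correct direction.  The score \<open>Z\<close> satisfies \<open>E[exp (- Z)] = 1\<close>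
  under the true law, so it has exponential lower tails, and Chernoff's bound with a small
  exponent gives an expected delay of at most \<open>t / \<kappa> + O(1)\<close> for every \<open>\<kappa> < I\<^sub>\<theta>\<close>.
\<close>

section \<open>Product measures\<close>

text \<open>The compromised set may differ between the states, and the flip exploits this: forging
  the first \<open>c\<close> sensors in state 0 and the last \<open>c\<close> in state 1 gives these
  \<open>2c\<close> sensors the same law in both states, so they carry no information. The quorum
  \<open>s - c\<close> is the largest one that the honest sensors reach on their own; at most
  \<open>c\<close> votes are forged, which leaves \<open>s - 2c\<close> honest ones behind any
  decision. Only the means of the log-likelihood ratio are assumed finite, so the converse avoids
  variances and applies \<open>ln y \<le> y - 1\<close> under the integral. The factor 1/2 there is
  chosen because at \<open>l = - ln e\<close> the exponential moment is at most 2. Infinite products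
  of distinct laws are mutually singular, so a likelihood ratio is available on finite prefixes
  only; this forces the horizon \<open>n\<close>. Waiting for the slowest honest sensor costs only a
  constant in the delay, since the tails beyond the typical crossing time are geometric.\<close>

lemma nn_integral_PiM_resample:
  assumes M: "\<And>i. i \<in> I \<Longrightarrow> prob_space (M i)" and j: "j \<in> I"
    and [measurable]: "H \<in> borel_measurable (PiM I M)"
  shows "(\<integral>\<^sup>+x. H x \<partial>PiM I M) = (\<integral>\<^sup>+y. \<integral>\<^sup>+x. H (x(j := y)) \<partial>PiM I M \<partial>M j)"
proof -
  interpret P: prob_space "PiM I M" by (rule prob_space_PiM[OF M])
  have ins: "insert j I = I" using j by auto
  have upd[measurable]: "(\<lambda>(y, x). x(j := y)) \<in> measurable (M j \<Otimes>\<^sub>M PiM I M) (PiM I M)"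
    using j by (auto simp: split_beta' intro!: measurable_fun_upd[where J=I])
  have "(\<integral>\<^sup>+x. H x \<partial>PiM I M) = (\<integral>\<^sup>+x. H x \<partial>distr (M j \<Otimes>\<^sub>M PiM I M) (PiM I M) (\<lambda>(y, x). x(j := y)))"
    using distr_pair_PiM_eq_PiM[of I M j] M j by (simp add: ins)
  also have "\<dots> = (\<integral>\<^sup>+p. H ((snd p)(j := fst p)) \<partial>(M j \<Otimes>\<^sub>M PiM I M))"
    by (subst nn_integral_distr) (auto simp: split_beta')
  also have "\<dots> = (\<integral>\<^sup>+y. \<integral>\<^sup>+x. H (x(j := y)) \<partial>PiM I M \<partial>M j)"
  proof -
    have "(\<lambda>p. H ((snd p)(j := fst p))) \<in> borel_measurable (M j \<Otimes>\<^sub>M PiM I M)"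
      using measurable_compose[OF upd, of H borel] by (simp add: split_beta')
    from P.nn_integral_fst[OF this] show ?thesis by simp
  qed
  finally show ?thesis .
qed

text \<open>Resampling coordinate \<open>j\<close> isolates its factor, so induction on the finite
  set \<open>J\<close> works inside an infinite product.\<close>

lemma nn_integral_PiM_prod:
  assumes M: "\<And>i. i \<in> I \<Longrightarrow> prob_space (M i)" and "finite J" "J \<subseteq> I"
    and u: "\<And>j. j \<in> J \<Longrightarrow> u j \<in> borel_measurable (M j)"
  shows "(\<integral>\<^sup>+x. (\<Prod>j\<in>J. u j (x j)) \<partial>PiM I M) = (\<Prod>j\<in>J. \<integral>\<^sup>+y. u j y \<partial>M j)"
  using assms(2-)
proof (induction J rule: finite_induct)
  case empty
  interpret P: prob_space "PiM I M" by (rule prob_space_PiM[OF M])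
  show ?case by (simp add: P.emeasure_space_1)
next
  case (insert j J)
  have [measurable]: "\<And>i. i \<in> J \<Longrightarrow> (\<lambda>x. u i (x i)) \<in> borel_measurable (PiM I M)"
    using insert.prems by (auto intro!: measurable_compose[OF measurable_component_singleton])
  have [measurable]: "u j \<in> borel_measurable (M j)" "(\<lambda>x. u j (x j)) \<in> borel_measurable (PiM I M)"
    using insert.prems by (auto intro!: measurable_compose[OF measurable_component_singleton])
  have "(\<integral>\<^sup>+x. (\<Prod>i\<in>insert j J. u i (x i)) \<partial>PiM I M) =
      (\<integral>\<^sup>+y. \<integral>\<^sup>+x. (\<Prod>i\<in>insert j J. u i ((x(j := y)) i)) \<partial>PiM I M \<partial>M j)"
  proof (rule nn_integral_PiM_resample)
    have "(\<lambda>x. u j (x j) * (\<Prod>i\<in>J. u i (x i))) \<in> borel_measurable (PiM I M)"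
      by measurable
    then show "(\<lambda>x. \<Prod>i\<in>insert j J. u i (x i)) \<in> borel_measurable (PiM I M)"
      using insert.hyps by simp
  qed (use M insert.prems in auto)
  also have "\<dots> = (\<integral>\<^sup>+y. \<integral>\<^sup>+x. u j y * (\<Prod>i\<in>J. u i (x i)) \<partial>PiM I M \<partial>M j)"
  proof -
    have "(\<Prod>i\<in>J. u i ((x(j := y)) i)) = (\<Prod>i\<in>J. u i (x i))" for x y
      using insert.hyps by (intro prod.cong) auto
    then show ?thesis using insert.hyps by simp
  qed
  also have "\<dots> = (\<integral>\<^sup>+y. u j y \<partial>M j) * (\<integral>\<^sup>+x. (\<Prod>i\<in>J. u i (x i)) \<partial>PiM I M)"
    by (simp add: nn_integral_cmult nn_integral_multc)
  finally show ?case using insert by simp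
qed

text \<open>After resampling coordinate \<open>j\<close> the integrand is \<open>F x * Z y\<close>,
  and Fubini splits it. With \<open>F\<close> the indicator that a test is still running before time
  \<open>j\<close>, this is one summand of Wald's identity.\<close>

lemma integral_PiM_indep_mult:
  fixes F :: "('i \<Rightarrow> 'a) \<Rightarrow> real" and Z :: "'a \<Rightarrow> real"
  assumes M: "\<And>i. i \<in> I \<Longrightarrow> prob_space (M i)" and j: "j \<in> I"
    and [measurable]: "F \<in> borel_measurable (PiM I M)"
    and dep: "\<And>x y. F (x(j := y)) = F x" and bnd: "\<And>x. \<bar>F x\<bar> \<le> B"
    and Z: "integrable (M j) Z"
  shows "integrable (PiM I M) (\<lambda>x. F x * Z (x j))"
    and "(\<integral>x. F x * Z (x j) \<partial>PiM I M) = (\<integral>x. F x \<partial>PiM I M) * (\<integral>y. Z y \<partial>M j)"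
proof -
  interpret PI: prob_space "PiM I M" by (rule prob_space_PiM[OF M])
  interpret Mj: prob_space "M j" using M j by simp
  interpret PP: pair_prob_space "M j" "PiM I M" ..
  have [measurable]: "Z \<in> borel_measurable (M j)" using Z by simp
  have [measurable]: "(\<lambda>x. Z (x j)) \<in> borel_measurable (PiM I M)"
    using j by (auto intro!: measurable_compose[OF measurable_component_singleton])
  have B: "0 \<le> B" using bnd[of undefined] by linarith
  have Zj: "integrable (PiM I M) (\<lambda>x. Z (x j))"
  proof -
    have "distr (PiM I M) (M j) (\<lambda>x. x j) = M j" by (rule distr_PiM_component) (use M j in auto)
    then show ?thesis using Z j by (intro integrable_distr[of "\<lambda>x. x j" _ "M j"]) simp_all
  qed
  show int: "integrable (PiM I M) (\<lambda>x. F x * Z (x j))"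
  proof (rule Bochner_Integration.integrable_bound[of _ "\<lambda>x. B * Z (x j)", OF _ _ AE_I2])
    show "norm (F x * Z (x j)) \<le> norm (B * Z (x j))" for x
      using mult_right_mono[OF bnd[of x], of "\<bar>Z (x j)\<bar>"] B by (simp add: abs_mult)
  qed (use Zj in auto)
  have ins: "insert j I = I" using j by auto
  have upd[measurable]: "(\<lambda>(y, x). x(j := y)) \<in> measurable (M j \<Otimes>\<^sub>M PiM I M) (PiM I M)"
    using j by (auto simp: split_beta' intro!: measurable_fun_upd[where J=I])
  have D: "PiM I M = distr (M j \<Otimes>\<^sub>M PiM I M) (PiM I M) (\<lambda>(y, x). x(j := y))"
    using distr_pair_PiM_eq_PiM[of I M j] M j by (simp add: ins)
  have int2: "integrable (M j \<Otimes>\<^sub>M PiM I M) (\<lambda>(y, x). F x * Z y)"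
  proof -
    have "integrable (distr (M j \<Otimes>\<^sub>M PiM I M) (PiM I M) (\<lambda>(y, x). x(j := y))) (\<lambda>x. F x * Z (x j))"
      using int D by simp
    then show ?thesis
      by (subst (asm) integrable_distr_eq) (auto simp: split_beta' dep)
  qed
  have "(\<integral>x. F x * Z (x j) \<partial>PiM I M) = (\<integral>(y, x). F x * Z y \<partial>(M j \<Otimes>\<^sub>M PiM I M))"
    by (subst D, subst integral_distr) (auto simp: split_beta' dep)
  also have "\<dots> = (\<integral>y. \<integral>x. F x * Z y \<partial>PiM I M \<partial>M j)"
    using PP.integral_fst'[OF int2] by (simp add: split_beta')
  finally show "(\<integral>x. F x * Z (x j) \<partial>PiM I M) = (\<integral>x. F x \<partial>PiM I M) * (\<integral>y. Z y \<partial>M j)"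
    by (simp add: mult.commute)
qed

text \<open>Time homogeneity: the observations after the first one again have the law of the whole
  sequence. This drives the inductions on the horizon.\<close>

lemma nn_integral_PiM_case_nat:
  assumes M: "prob_space M" and [measurable]: "F \<in> borel_measurable (PiM UNIV (\<lambda>_::nat. M))"
  shows "(\<integral>\<^sup>+x. F x \<partial>PiM UNIV (\<lambda>_. M)) =
    (\<integral>\<^sup>+y. \<integral>\<^sup>+x. F (case_nat y x) \<partial>PiM UNIV (\<lambda>_. M) \<partial>M)"
proof -
  interpret M: prob_space M by fact
  interpret sequence_space M ..
  have "(\<integral>\<^sup>+x. F x \<partial>S) = (\<integral>\<^sup>+x. F x \<partial>distr (M \<Otimes>\<^sub>M S) S (\<lambda>(y, x). case_nat y x))"
    by (simp add: PiM_iter)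
  also have "\<dots> = (\<integral>\<^sup>+p. F (case_nat (fst p) (snd p)) \<partial>(M \<Otimes>\<^sub>M S))"
    by (subst nn_integral_distr) (auto simp: split_beta')
  also have "\<dots> = (\<integral>\<^sup>+y. \<integral>\<^sup>+x. F (case_nat y x) \<partial>S \<partial>M)"
    by (subst P.nn_integral_fst[symmetric]) auto
  finally show ?thesis .
qed

text \<open>Each induction step peels off the first observation and changes its law by one factor
  \<open>f\<close>; the remaining function depends on one observation less.\<close>

lemma nn_integral_PiM_density_prefix:
  assumes M1: "prob_space M1" and M0: "prob_space M0" and M0_eq: "M0 = density M1 f"
    and [measurable]: "f \<in> borel_measurable M1"
    and "F \<in> borel_measurable (PiM UNIV (\<lambda>_::nat. M1))"
    and "\<And>x y. (\<And>k. k < n \<Longrightarrow> x k = y k) \<Longrightarrow> F x = F y"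
  shows "(\<integral>\<^sup>+x. F x \<partial>PiM UNIV (\<lambda>_. M0)) = (\<integral>\<^sup>+x. F x * (\<Prod>k<n. f (x k)) \<partial>PiM UNIV (\<lambda>_. M1))"
  using assms(5-)
proof (induction n arbitrary: F)
  case 0
  interpret P0: prob_space "PiM UNIV (\<lambda>_::nat. M0)" by (rule prob_space_PiM) (use M0 M1 in auto)
  interpret P1: prob_space "PiM UNIV (\<lambda>_::nat. M1)" by (rule prob_space_PiM) (use M0 M1 in auto)
  have "F = (\<lambda>_. F undefined)" by (rule ext, rule 0(2)) simp
  then obtain c where "F = (\<lambda>_. c)" ..
  then show ?case by (simp add: P0.emeasure_space_1 P1.emeasure_space_1)
next
  case (Suc n)
  note [measurable] = Suc.prems(1)
  interpret P1: prob_space "PiM UNIV (\<lambda>_::nat. M1)" by (rule prob_space_PiM) (use M0 M1 in auto)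
  have s[measurable_cong]: "sets M0 = sets M1" by (simp add: M0_eq)
  have [measurable_cong]: "sets (PiM UNIV (\<lambda>_::nat. M0)) = sets (PiM UNIV (\<lambda>_::nat. M1))"
    by (intro sets_PiM_cong) (auto simp: s)
  have F0: "F \<in> borel_measurable (PiM UNIV (\<lambda>_::nat. M0))" by measurable
  have "(\<integral>\<^sup>+x. F x \<partial>PiM UNIV (\<lambda>_. M0)) = (\<integral>\<^sup>+y. \<integral>\<^sup>+x. F (case_nat y x) \<partial>PiM UNIV (\<lambda>_. M0) \<partial>M0)"
    by (rule nn_integral_PiM_case_nat[OF M0 F0])
  also have "\<dots> = (\<integral>\<^sup>+y. \<integral>\<^sup>+x. F (case_nat y x) * (\<Prod>k<n. f (x k)) \<partial>PiM UNIV (\<lambda>_. M1) \<partial>M0)"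
  proof (rule nn_integral_cong, rule Suc.IH)
    fix y assume "y \<in> space M0"
    then have [measurable]: "y \<in> space M1" by (simp add: M0_eq)
    show "(\<lambda>x. F (case_nat y x)) \<in> borel_measurable (PiM UNIV (\<lambda>_. M1))"
      by measurable
    show "F (case_nat y x) = F (case_nat y x')" if "\<And>k. k < n \<Longrightarrow> x k = x' k" for x x'
      using that by (intro Suc.prems(2)) (auto split: nat.split)
  qed
  also have "\<dots> = (\<integral>\<^sup>+y. f y * (\<integral>\<^sup>+x. F (case_nat y x) * (\<Prod>k<n. f (x k)) \<partial>PiM UNIV (\<lambda>_. M1)) \<partial>M1)"
    unfolding M0_eq by (rule nn_integral_density) measurable
  also have "\<dots> = (\<integral>\<^sup>+y. \<integral>\<^sup>+x. F (case_nat y x) * (\<Prod>k<Suc n. f (case_nat y x k)) \<partial>PiM UNIV (\<lambda>_. M1) \<partial>M1)"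
  proof (rule nn_integral_cong)
    fix y assume [measurable]: "y \<in> space M1"
    have "f y * (\<integral>\<^sup>+x. F (case_nat y x) * (\<Prod>k<n. f (x k)) \<partial>PiM UNIV (\<lambda>_. M1)) =
      (\<integral>\<^sup>+x. f y * (F (case_nat y x) * (\<Prod>k<n. f (x k))) \<partial>PiM UNIV (\<lambda>_. M1))"
      by (rule nn_integral_cmult[symmetric]) measurable
    then show "f y * (\<integral>\<^sup>+x. F (case_nat y x) * (\<Prod>k<n. f (x k)) \<partial>PiM UNIV (\<lambda>_. M1)) =
      (\<integral>\<^sup>+x. F (case_nat y x) * (\<Prod>k<Suc n. f (case_nat y x k)) \<partial>PiM UNIV (\<lambda>_. M1))"
      by (simp only: prod.lessThan_Suc_shift nat.case mult.left_commute)
  qed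
  also have "\<dots> = (\<integral>\<^sup>+x. F x * (\<Prod>k<Suc n. f (x k)) \<partial>PiM UNIV (\<lambda>_. M1))"
    by (rule nn_integral_PiM_case_nat[OF M1, symmetric]) measurable
  finally show ?case .
qed

text \<open>Tonelli reduces this to independence inside each product, over \<open>B\<close> with
  \<open>x\<close> frozen and then over \<open>A\<close>. In the applications \<open>A\<close>
  carries the true observations and \<open>B\<close> the attacker's draws.\<close>

lemma nn_integral_PiM_pair_prod:
  assumes A: "\<And>i. i \<in> I \<Longrightarrow> prob_space (A i)" and B: "\<And>i. i \<in> I \<Longrightarrow> prob_space (B i)"
    and J: "finite J" "J \<subseteq> I"
    and h: "\<And>j. j \<in> J \<Longrightarrow> (\<lambda>(x, w). h j x w) \<in> borel_measurable (A j \<Otimes>\<^sub>M B j)"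
  shows "(\<integral>\<^sup>+p. (\<Prod>j\<in>J. h j (fst p j) (snd p j)) \<partial>(PiM I A \<Otimes>\<^sub>M PiM I B)) =
    (\<Prod>j\<in>J. \<integral>\<^sup>+q. h j (fst q) (snd q) \<partial>(A j \<Otimes>\<^sub>M B j))"
proof -
  interpret PB: prob_space "PiM I B" by (rule prob_space_PiM[OF B])
  have m: "(\<lambda>p. h j (fst p j) (snd p j)) \<in> borel_measurable (PiM I A \<Otimes>\<^sub>M PiM I B)" if j: "j \<in> J" for j
  proof -
    have jI: "j \<in> I" using j J by auto
    have "(\<lambda>p. (fst p j, snd p j)) \<in> measurable (PiM I A \<Otimes>\<^sub>M PiM I B) (A j \<Otimes>\<^sub>M B j)"
      using jI by (intro measurable_Pair measurable_compose[OF measurable_fst] measurable_compose[OF measurable_snd]) auto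
    from measurable_compose[OF this h[OF j]] show ?thesis by simp
  qed
  have hx: "h j y \<in> borel_measurable (B j)" if "j \<in> J" "y \<in> space (A j)" for j y
    using measurable_compose[OF measurable_Pair1' h] that by auto
  have hint: "(\<lambda>y. \<integral>\<^sup>+w. h j y w \<partial>B j) \<in> borel_measurable (A j)" if "j \<in> J" for j
  proof -
    interpret prob_space "B j" using that J B by auto
    show ?thesis by (rule borel_measurable_nn_integral) (use h[OF that] in simp)
  qed
  have "(\<integral>\<^sup>+p. (\<Prod>j\<in>J. h j (fst p j) (snd p j)) \<partial>(PiM I A \<Otimes>\<^sub>M PiM I B)) =
      (\<integral>\<^sup>+x. \<integral>\<^sup>+w. (\<Prod>j\<in>J. h j (x j) (w j)) \<partial>PiM I B \<partial>PiM I A)"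
    by (subst PB.nn_integral_fst[symmetric]) (auto intro!: borel_measurable_prod_ennreal m)
  also have "\<dots> = (\<integral>\<^sup>+x. (\<Prod>j\<in>J. \<integral>\<^sup>+w. h j (x j) w \<partial>B j) \<partial>PiM I A)"
  proof (rule nn_integral_cong)
    fix x assume x: "x \<in> space (PiM I A)"
    show "(\<integral>\<^sup>+w. (\<Prod>j\<in>J. h j (x j) (w j)) \<partial>PiM I B) = (\<Prod>j\<in>J. \<integral>\<^sup>+w. h j (x j) w \<partial>B j)"
      using x J by (intro nn_integral_PiM_prod[OF B J] hx) (auto simp: space_PiM)
  qed
  also have "\<dots> = (\<Prod>j\<in>J. \<integral>\<^sup>+y. \<integral>\<^sup>+w. h j y w \<partial>B j \<partial>A j)"
    by (rule nn_integral_PiM_prod[OF A J hint])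
  also have "\<dots> = (\<Prod>j\<in>J. \<integral>\<^sup>+q. h j (fst q) (snd q) \<partial>(A j \<Otimes>\<^sub>M B j))"
  proof (rule prod.cong[OF refl])
    fix j assume j: "j \<in> J"
    interpret prob_space "B j" using j J B by auto
    show "(\<integral>\<^sup>+y. \<integral>\<^sup>+w. h j y w \<partial>B j \<partial>A j) = (\<integral>\<^sup>+q. h j (fst q) (snd q) \<partial>(A j \<Otimes>\<^sub>M B j))"
      using nn_integral_fst[OF h[OF j]] by (simp add: split_beta')
  qed
  finally show ?thesis .
qed

text \<open>Both sides are compared on cylinder sets, where each is a finite product of
  one-coordinate probabilities. It serves at two levels, over the sensors at one time and over all
  times, hence the arbitrary index set.\<close>

lemma distr_PiM_pair_coordinatewise:
  assumes A: "\<And>i. i \<in> I \<Longrightarrow> prob_space (A i)" and B: "\<And>i. i \<in> I \<Longrightarrow> prob_space (B i)"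
    and g: "\<And>i. i \<in> I \<Longrightarrow> (\<lambda>(x, w). g i x w) \<in> measurable (A i \<Otimes>\<^sub>M B i) (Q i)"
  shows "distr (PiM I A \<Otimes>\<^sub>M PiM I B) (PiM I Q) (\<lambda>p. \<lambda>i\<in>I. g i (fst p i) (snd p i)) =
    PiM I (\<lambda>i. distr (A i \<Otimes>\<^sub>M B i) (Q i) (\<lambda>(x, w). g i x w))"
proof (rule measure_eqI_PiM_infinite)
  let ?P = "PiM I A \<Otimes>\<^sub>M PiM I B"
  let ?G = "\<lambda>p. \<lambda>i\<in>I. g i (fst p i) (snd p i)"
  let ?D = "\<lambda>i. distr (A i \<Otimes>\<^sub>M B i) (Q i) (\<lambda>(x, w). g i x w)"
  have PA: "prob_space (PiM I A)" and PB: "prob_space (PiM I B)" using A B by (auto intro: prob_space_PiM)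
  interpret P: pair_prob_space "PiM I A" "PiM I B"
    using PA PB by (simp add: pair_prob_space_def pair_sigma_finite_def prob_space_imp_sigma_finite)
  have comp: "(\<lambda>p. (fst p i, snd p i)) \<in> measurable ?P (A i \<Otimes>\<^sub>M B i)" if "i \<in> I" for i
    using that by (intro measurable_Pair measurable_compose[OF measurable_fst] measurable_compose[OF measurable_snd]) auto
  have gi: "(\<lambda>p. g i (fst p i) (snd p i)) \<in> measurable ?P (Q i)" if "i \<in> I" for i
    using measurable_compose[OF comp[OF that] g[OF that]] by simp
  have G: "?G \<in> measurable ?P (PiM I Q)" by (rule measurable_restrict) (rule gi)
  have D: "prob_space (?D i)" if "i \<in> I" for i
  proof -
    interpret a: prob_space "A i" using A that by auto
    interpret b: prob_space "B i" using B that by auto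
    interpret ab: pair_prob_space "A i" "B i" ..
    show ?thesis by (rule ab.prob_space_distr[OF g[OF that]])
  qed
  show "sets (distr ?P (PiM I Q) ?G) = sets (PiM I Q)" by simp
  show "sets (PiM I ?D) = sets (PiM I Q)" by (intro sets_PiM_cong) auto
  show "finite_measure (distr ?P (PiM I Q) ?G)"
    using P.prob_space_distr[OF G] by (simp add: prob_space.finite_measure)
  fix E J assume J: "finite J" "J \<subseteq> I" and E: "\<And>i. i \<in> J \<Longrightarrow> E i \<in> sets (Q i)"
  have box: "prod_emb I Q J (Pi\<^sub>E J E) \<in> sets (PiM I Q)" using J E by (intro sets_PiM_I) auto
  have emb: "prod_emb I Q J (Pi\<^sub>E J E) = prod_emb I ?D J (Pi\<^sub>E J E)" by (simp add: prod_emb_def)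
  have "emeasure (distr ?P (PiM I Q) ?G) (prod_emb I Q J (Pi\<^sub>E J E)) = (\<integral>\<^sup>+y. indicator (prod_emb I Q J (Pi\<^sub>E J E)) y \<partial>distr ?P (PiM I Q) ?G)"
    using box by simp
  also have "\<dots> = (\<integral>\<^sup>+p. indicator (prod_emb I Q J (Pi\<^sub>E J E)) (?G p) \<partial>?P)"
    using box by (intro nn_integral_distr G) auto
  also have "\<dots> = (\<integral>\<^sup>+p. (\<Prod>j\<in>J. indicator (E j) (g j (fst p j) (snd p j))) \<partial>?P)"
  proof (rule nn_integral_cong)
    fix p assume p: "p \<in> space ?P"
    have "?G p \<in> space (PiM I Q)" using measurable_space[OF G p] .
    then have iff: "?G p \<in> prod_emb I Q J (Pi\<^sub>E J E) \<longleftrightarrow> (\<forall>j\<in>J. g j (fst p j) (snd p j) \<in> E j)"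
      using J by (auto simp: prod_emb_def space_PiM PiE_iff Int_absorb1)
    have "(\<Prod>j\<in>J. indicator (E j) (g j (fst p j) (snd p j)) :: ennreal) =
        (if \<forall>j\<in>J. g j (fst p j) (snd p j) \<in> E j then 1 else 0)"
      using J(1) by (auto simp: indicator_def intro!: prod.neutral)
    then show "indicator (prod_emb I Q J (Pi\<^sub>E J E)) (?G p) = (\<Prod>j\<in>J. indicator (E j) (g j (fst p j) (snd p j)) :: ennreal)"
      using iff by (simp add: indicator_def)
  qed
  also have "\<dots> = (\<Prod>j\<in>J. \<integral>\<^sup>+q. indicator (E j) (g j (fst q) (snd q)) \<partial>(A j \<Otimes>\<^sub>M B j))"
  proof (rule nn_integral_PiM_pair_prod[OF A B J])
    fix j assume j: "j \<in> J"
    have gj: "(\<lambda>(x, w). g j x w) \<in> measurable (A j \<Otimes>\<^sub>M B j) (Q j)" using j J g by auto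
    have "(\<lambda>z. indicator (E j) z :: ennreal) \<in> borel_measurable (Q j)" using E[OF j] by auto
    from measurable_compose[OF gj this]
    show "(\<lambda>(x, w). indicator (E j) (g j x w) :: ennreal) \<in> borel_measurable (A j \<Otimes>\<^sub>M B j)"
      by (simp add: split_beta')
  qed
  also have "\<dots> = (\<Prod>j\<in>J. emeasure (?D j) (E j))"
  proof (rule prod.cong[OF refl])
    fix j assume j: "j \<in> J"
    have gj: "(\<lambda>(x, w). g j x w) \<in> measurable (A j \<Otimes>\<^sub>M B j) (Q j)" using j J g by auto
    have "emeasure (?D j) (E j) = (\<integral>\<^sup>+z. indicator (E j) z \<partial>?D j)" using E[OF j] by simp
    also have "\<dots> = (\<integral>\<^sup>+q. indicator (E j) (g j (fst q) (snd q)) \<partial>(A j \<Otimes>\<^sub>M B j))"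
      using E[OF j] by (subst nn_integral_distr[OF gj]) (auto simp: split_beta')
    finally show "(\<integral>\<^sup>+q. indicator (E j) (g j (fst q) (snd q)) \<partial>(A j \<Otimes>\<^sub>M B j)) = emeasure (?D j) (E j)" ..
  qed
  also have "\<dots> = emeasure (PiM I ?D) (prod_emb I ?D J (Pi\<^sub>E J E))"
    using D J E by (intro emeasure_PiM_emb[symmetric]) auto
  finally show "emeasure (distr ?P (PiM I Q) ?G) (prod_emb I Q J (Pi\<^sub>E J E)) =
      emeasure (PiM I ?D) (prod_emb I Q J (Pi\<^sub>E J E))" unfolding emb .
qed

text \<open>Boxes determine a finite product measure, and on a box the integral of the product
  density factorizes. This merges the sensors at one time into a single likelihood ratio.\<close>

lemma PiM_density:
  fixes f :: "'i \<Rightarrow> 'a \<Rightarrow> ennreal"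
  assumes I: "finite I" and M: "\<And>i. i \<in> I \<Longrightarrow> prob_space (M i)" and N: "\<And>i. prob_space (N i)"
    and f[measurable]: "\<And>i. i \<in> I \<Longrightarrow> f i \<in> borel_measurable (M i)"
    and eq: "\<And>i. i \<in> I \<Longrightarrow> N i = density (M i) (f i)"
  shows "density (PiM I M) (\<lambda>x. \<Prod>i\<in>I. f i (x i)) = PiM I N"
proof -
  interpret product_prob_space N using N by (rule product_prob_spaceI)
  show ?thesis
  proof (rule PiM_eqI[OF I])
    show "sets (density (PiM I M) (\<lambda>x. \<Prod>i\<in>I. f i (x i))) = sets (PiM I N)"
      by (simp, intro sets_PiM_cong) (auto simp: eq)
    fix A assume "\<And>i. i \<in> I \<Longrightarrow> A i \<in> sets (N i)"
    then have A[measurable]: "\<And>i. i \<in> I \<Longrightarrow> A i \<in> sets (M i)" by (auto simp: eq)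
    have fi: "(\<lambda>x. f i (x i)) \<in> borel_measurable (PiM I M)" if "i \<in> I" for i
      using that by (intro measurable_PiM_component_rev f)
    have box: "Pi\<^sub>E I A \<in> sets (PiM I M)" using I A by (rule sets_PiM_I_finite)
    have "emeasure (density (PiM I M) (\<lambda>x. \<Prod>i\<in>I. f i (x i))) (Pi\<^sub>E I A) =
        (\<integral>\<^sup>+x. (\<Prod>i\<in>I. f i (x i)) * indicator (Pi\<^sub>E I A) x \<partial>PiM I M)"
      using box fi by (intro emeasure_density) (auto intro: borel_measurable_prod_ennreal)
    also have "\<dots> = (\<integral>\<^sup>+x. (\<Prod>i\<in>I. f i (x i) * indicator (A i) (x i)) \<partial>PiM I M)"
    proof (rule nn_integral_cong)
      fix x assume "x \<in> space (PiM I M)"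
      then have x: "x \<in> Pi\<^sub>E I A \<longleftrightarrow> (\<forall>i\<in>I. x i \<in> A i)" by (auto simp: space_PiM PiE_iff)
      have "(\<Prod>i\<in>I. indicator (A i) (x i) :: ennreal) = indicator (Pi\<^sub>E I A) x"
        using I x by (auto simp: indicator_def intro!: prod.neutral)
      then show "(\<Prod>i\<in>I. f i (x i)) * indicator (Pi\<^sub>E I A) x = (\<Prod>i\<in>I. f i (x i) * indicator (A i) (x i))"
        by (simp add: prod.distrib)
    qed
    also have "\<dots> = (\<Prod>i\<in>I. \<integral>\<^sup>+y. f i y * indicator (A i) y \<partial>M i)"
      by (rule nn_integral_PiM_prod[OF M I order_refl]) measurable
    also have "\<dots> = (\<Prod>i\<in>I. emeasure (N i) (A i))"
      using A by (intro prod.cong refl) (simp add: eq emeasure_density)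
    finally show "emeasure (density (PiM I M) (\<lambda>x. \<Prod>i\<in>I. f i (x i))) (Pi\<^sub>E I A) = (\<Prod>i\<in>I. emeasure (N i) (A i))" .
  qed
qed

section \<open>Information acquired up to a stopping time\<close>

text \<open>A variational bound for the information at \<open>min T n\<close>: the mean
  log-likelihood ratio is computed by Wald's identity and bounded below with the test function
  \<open>l * indicator A\<close>. The sum of indicators on the right is \<open>min T n\<close>, as
  the test is running at \<open>k\<close> iff no decision was made before \<open>k\<close>.\<close>

lemma stopped_information_bound:
  fixes d :: "nat \<Rightarrow> (nat \<Rightarrow> 'a) \<Rightarrow> bool option" and Z :: "'a \<Rightarrow> real" and l :: real and n :: nat and b :: bool
  assumes M1: "prob_space M1" and M0: "prob_space M0"
    and M0_eq: "M0 = density M1 (\<lambda>y. ennreal (exp (- Z y)))"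
    and Z: "integrable M1 Z"
    and d[measurable]: "\<And>k. d k \<in> measurable (PiM UNIV (\<lambda>_. M1)) (count_space UNIV)"
    and dep: "\<And>k x y. (\<And>j. j \<le> k \<Longrightarrow> x j = y j) \<Longrightarrow> d k x = d k y"
  defines "S1 \<equiv> PiM UNIV (\<lambda>_. M1)" and "S0 \<equiv> PiM UNIV (\<lambda>_. M0)"
  defines "A \<equiv> {x \<in> space S1. \<exists>k<n. (\<forall>j<k. d j x = None) \<and> d k x = Some b}"
  shows "l * measure S1 A + 1 - ln 2 - (1 + measure S0 A * (exp l - 1)) / 2
     \<le> (\<integral>y. Z y \<partial>M1) * (\<integral>x. (\<Sum>k<n. of_bool (\<forall>j<k. d j x = None)) \<partial>S1)"
proof -
  interpret S1: prob_space S1 unfolding S1_def by (rule prob_space_PiM) (use M1 in auto)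
  interpret S0: prob_space S0 unfolding S0_def by (rule prob_space_PiM) (use M0 in auto)
  have s[measurable_cong]: "sets M0 = sets M1" by (simp add: M0_eq)
  have s01[measurable_cong]: "sets S0 = sets S1"
    unfolding S0_def S1_def by (intro sets_PiM_cong) (auto simp: s)
  have sp: "space S0 = space S1" using s01 by (rule sets_eq_imp_space_eq)
  have d'[measurable]: "\<And>k. d k \<in> measurable S1 (count_space UNIV)" unfolding S1_def by (rule d)
  have [measurable]: "Z \<in> borel_measurable M1" using Z by simp
  have [measurable]: "\<And>k. (\<lambda>x. x k) \<in> measurable S1 M1" unfolding S1_def by measurable
  have [measurable]: "A \<in> sets S1" unfolding A_def by measurable
  have [measurable]: "A \<in> sets S0" by (simp add: s01)
  \<comment> \<open>\<open>a k\<close> says that observation \<open>k\<close> is still taken. It is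
    determined by the observations before \<open>k\<close>, hence independent of
    \<open>Z (x k)\<close>.\<close>
  define a :: "nat \<Rightarrow> (nat \<Rightarrow> 'a) \<Rightarrow> real" where "a k x = of_bool (\<forall>j<k. d j x = None)" for k x
  have a_meas[measurable]: "a k \<in> borel_measurable S1" for k unfolding a_def by measurable
  have a_dep: "a k (x(k := y)) = a k x" for k x y
  proof -
    have "d j (x(k := y)) = d j x" if "j < k" for j using that by (intro dep) auto
    then show ?thesis unfolding a_def by simp
  qed
  define L where "L x = (\<Sum>k<n. a k x * Z (x k))" for x
  define h where "h x = l * indicator A x" for x
  have aZ: "integrable S1 (\<lambda>x. a k x * Z (x k))"
    "(\<integral>x. a k x * Z (x k) \<partial>S1) = (\<integral>x. a k x \<partial>S1) * (\<integral>y. Z y \<partial>M1)" for k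
    using integral_PiM_indep_mult[of UNIV "\<lambda>_. M1" k "a k" 1 Z] M1 Z a_meas[of k] a_dep
    by (auto simp: S1_def a_def)
  have a_int: "integrable S1 (a k)" for k
    by (rule S1.integrable_const_bound[of _ 1]) (auto simp: a_def)
  have L_int: "integrable S1 L" unfolding L_def by (intro Bochner_Integration.integrable_sum aZ)
  have L_val: "(\<integral>x. L x \<partial>S1) = (\<integral>y. Z y \<partial>M1) * (\<integral>x. (\<Sum>k<n. a k x) \<partial>S1)"
    unfolding L_def
    by (subst Bochner_Integration.integral_sum, rule aZ, subst Bochner_Integration.integral_sum, rule a_int)
       (unfold aZ, simp add: sum_distrib_left mult.commute)
  define f where "f y = ennreal (exp (- Z y))" for y
  have [measurable]: "f \<in> borel_measurable M1" unfolding f_def by measurable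
  have prodf: "(\<Prod>j<k. f (x j)) = ennreal (exp (- (\<Sum>j<k. Z (x j))))" for k :: nat and x
    unfolding f_def by (induction k) (simp_all add: ennreal_mult[symmetric] mult_exp_exp)
  \<comment> \<open>Splitting by the stopping time: \<open>G k\<close> is \<open>exp h\<close> on
    stopping at \<open>k\<close>, and \<open>G'\<close> covers the runs that reach the horizon
    undecided, where \<open>h\<close> is 0. Each piece has its own prefix length, so the change of
    measure is applied piece by piece.\<close>
  define G where "G k x = (if (\<forall>j<k. d j x = None) \<and> d k x \<noteq> None
    then ennreal (exp (l * of_bool (d k x = Some b))) else 0)" for k x
  define G' where "G' x = (if \<forall>j<n. d j x = None then 1 else 0::ennreal)" for x
  have [measurable]: "G k \<in> borel_measurable S1" "G' \<in> borel_measurable S1" for k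
    unfolding G_def[abs_def] G'_def[abs_def] by measurable
  have decomp: "ennreal (exp (h x)) = (\<Sum>k<n. G k x) + G' x \<and>
      ennreal (exp (h x - L x)) = (\<Sum>k<n. G k x * (\<Prod>j<Suc k. f (x j))) + G' x * (\<Prod>j<n. f (x j))"
    if x: "x \<in> space S1" for x
  proof (cases "\<forall>j<n. d j x = None")
    case True
    then have "h x = 0" unfolding h_def A_def by auto
    moreover have "L x = (\<Sum>k<n. Z (x k))" unfolding L_def a_def using True by (intro sum.cong) auto
    moreover have "G k x = 0" if "k < n" for k unfolding G_def using True that by auto
    moreover have "G' x = 1" unfolding G'_def using True by auto
    ultimately show ?thesis by (simp add: prodf)
  next
    case False
    define k where "k = (LEAST j. d j x \<noteq> None)"
    from False obtain j0 where j0: "j0 < n" "d j0 x \<noteq> None" by auto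
    have k: "d k x \<noteq> None" unfolding k_def using j0(2) by (rule LeastI)
    have kn: "k < n" using Least_le[of "\<lambda>j. d j x \<noteq> None", OF j0(2)] j0(1) unfolding k_def by simp
    have before: "d j x = None" if "j < k" for j
      using not_less_Least[of j "\<lambda>j. d j x \<noteq> None"] that unfolding k_def by auto
    have uniq: "(\<forall>j<i. d j x = None) \<and> d i x \<noteq> None \<longleftrightarrow> i = k" for i
      using k before by (metis linorder_neqE_nat)
    have al: "(\<forall>j<i. d j x = None) \<longleftrightarrow> i \<le> k" for i
      using k before by (meson leI less_le_trans)
    have memA: "x \<in> A \<longleftrightarrow> d k x = Some b"
    proof
      assume "x \<in> A"
      then obtain i where "(\<forall>j<i. d j x = None) \<and> d i x = Some b" unfolding A_def by auto
      then show "d k x = Some b" using uniq[of i] by auto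
    qed (use x kn before in \<open>auto simp: A_def\<close>)
    have hx: "h x = l * of_bool (d k x = Some b)" unfolding h_def using memA by (simp add: indicator_def)
    have Lx: "L x = (\<Sum>j<Suc k. Z (x j))"
    proof -
      have "L x = (\<Sum>j<n. if j < Suc k then Z (x j) else 0)"
        unfolding L_def a_def al by (intro sum.cong) auto
      also have "\<dots> = (\<Sum>j\<in>{..<n} \<inter> {j. j < Suc k}. Z (x j))" by (simp add: sum.inter_restrict)
      also have "{..<n} \<inter> {j. j < Suc k} = {..<Suc k}" using kn by auto
      finally show ?thesis .
    qed
    have Gi: "G i x = (if i = k then ennreal (exp (h x)) else 0)" for i
      unfolding G_def uniq hx by auto
    have "G' x = 0" unfolding G'_def al using kn by auto
    then show ?thesis using kn
      by (simp add: Gi prodf Lx if_distrib[of "\<lambda>t. t * _"] sum.delta ennreal_mult[symmetric] exp_add[symmetric]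
          cong: if_cong del: sum.lessThan_Suc prod.lessThan_Suc)
  qed
  have G_change: "(\<integral>\<^sup>+x. G k x * (\<Prod>j<Suc k. f (x j)) \<partial>S1) = (\<integral>\<^sup>+x. G k x \<partial>S0)" for k
  proof -
    have "G k x = G k y" if "\<And>i. i < Suc k \<Longrightarrow> x i = y i" for x y
    proof -
      have "d j x = d j y" if "j \<le> k" for j using \<open>\<And>i. i < Suc k \<Longrightarrow> x i = y i\<close> that by (intro dep) auto
      then show ?thesis unfolding G_def by auto
    qed
    note G_dep = this
    show ?thesis unfolding S0_def S1_def
      by (rule nn_integral_PiM_density_prefix[OF M1 M0 M0_eq[folded f_def], symmetric])
         (unfold S1_def[symmetric], measurable, rule G_dep)
  qed
  have G'_change: "(\<integral>\<^sup>+x. G' x * (\<Prod>j<n. f (x j)) \<partial>S1) = (\<integral>\<^sup>+x. G' x \<partial>S0)"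
  proof -
    have "G' x = G' y" if "\<And>i. i < n \<Longrightarrow> x i = y i" for x y
    proof -
      have "d j x = d j y" if "j < n" for j using \<open>\<And>i. i < n \<Longrightarrow> x i = y i\<close> that by (intro dep) auto
      then show ?thesis unfolding G'_def by auto
    qed
    note G'_dep = this
    show ?thesis unfolding S0_def S1_def
      by (rule nn_integral_PiM_density_prefix[OF M1 M0 M0_eq[folded f_def], symmetric])
         (unfold S1_def[symmetric], measurable, rule G'_dep)
  qed
  have [measurable]: "(\<lambda>x. \<Prod>j<k. f (x j)) \<in> borel_measurable S1" for k by measurable
  have [measurable]: "h \<in> borel_measurable S1" "L \<in> borel_measurable S1"
    unfolding h_def[abs_def] L_def[abs_def] by measurable
  \<comment> \<open>The change of measure absorbs \<open>exp (- L)\<close>: what remains is the mean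
    of \<open>exp h\<close> under \<open>S0\<close>, and \<open>exp h\<close> takes only the values
    1 and \<open>exp l\<close>.\<close>
  have "(\<integral>\<^sup>+x. ennreal (exp (h x - L x)) \<partial>S1) =
      (\<integral>\<^sup>+x. (\<Sum>k<n. G k x * (\<Prod>j<Suc k. f (x j))) + G' x * (\<Prod>j<n. f (x j)) \<partial>S1)"
    using decomp by (intro nn_integral_cong) blast
  also have "\<dots> = (\<Sum>k<n. \<integral>\<^sup>+x. G k x * (\<Prod>j<Suc k. f (x j)) \<partial>S1) + (\<integral>\<^sup>+x. G' x * (\<Prod>j<n. f (x j)) \<partial>S1)"
    by (subst nn_integral_add) (measurable, simp add: nn_integral_sum del: prod.lessThan_Suc)
  also have "\<dots> = (\<integral>\<^sup>+x. (\<Sum>k<n. G k x) + G' x \<partial>S0)"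
    unfolding G_change G'_change by (subst nn_integral_add) (measurable, simp add: nn_integral_sum)
  also have "\<dots> = (\<integral>\<^sup>+x. ennreal (exp (h x)) \<partial>S0)"
    using decomp by (intro nn_integral_cong) (simp add: sp)
  also have "\<dots> = ennreal (\<integral>x. exp (h x) \<partial>S0)"
    by (rule nn_integral_eq_integral, rule S0.integrable_const_bound[of _ "exp \<bar>l\<bar>"])
       (auto simp: h_def indicator_def)
  also have "(\<integral>x. exp (h x) \<partial>S0) = (\<integral>x. 1 + indicator A x * (exp l - 1) \<partial>S0)"
    by (intro Bochner_Integration.integral_cong) (auto simp: h_def indicator_def)
  also have "\<dots> = 1 + measure S0 A * (exp l - 1)"
    by (subst Bochner_Integration.integral_add) (auto simp: S0.prob_space less_top[symmetric])
  finally have W: "(\<integral>\<^sup>+x. ennreal (exp (h x - L x)) \<partial>S1) = ennreal (1 + measure S0 A * (exp l - 1))" .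
  have nonneg: "0 \<le> 1 + measure S0 A * (exp l - 1)"
  proof -
    have "0 \<le> measure S0 A * exp l" by simp
    then show ?thesis using S0.prob_le_1[of A] by (simp only: right_diff_distrib mult_1_right)
  qed
  have W_int: "integrable S1 (\<lambda>x. exp (h x - L x))"
    by (rule integrableI_nn_integral_finite[OF _ _ W]) auto
  have W_val: "(\<integral>x. exp (h x - L x) \<partial>S1) = 1 + measure S0 A * (exp l - 1)"
    using nn_integral_eq_integral[OF W_int] W nonneg by (simp add: ennreal_inj)
  have h_int: "integrable S1 h"
    by (rule S1.integrable_const_bound[of _ "\<bar>l\<bar>"]) (auto simp: h_def indicator_def)
  have h_val: "(\<integral>x. h x \<partial>S1) = l * measure S1 A" unfolding h_def by simp
  \<comment> \<open>Variational lower bound on the information, from \<open>ln y \<le> y - 1\<close> at \<open>y = exp (h - L) / 2\<close>.\<close>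
  have "h x + (1 - ln 2) - exp (h x - L x) / 2 \<le> L x" for x
    using ln_le_minus_one[of "exp (h x - L x) / 2"] by (simp add: ln_div)
  then have "(\<integral>x. h x + (1 - ln 2) - exp (h x - L x) / 2 \<partial>S1) \<le> (\<integral>x. L x \<partial>S1)"
    using h_int W_int L_int by (intro integral_mono) auto
  also have "(\<integral>x. h x + (1 - ln 2) - exp (h x - L x) / 2 \<partial>S1) =
      l * measure S1 A + (1 - ln 2) - (1 + measure S0 A * (exp l - 1)) / 2"
    using h_int W_int by (simp add: h_val W_val S1.prob_space)
  finally show ?thesis unfolding L_val a_def by simp
qed

section \<open>Boundary crossing of random walks\<close>

text \<open>The quotients \<open>(1 - exp (- r * Z)) / r\<close> tend to \<open>Z\<close> as
  \<open>r\<close> tends to 0 and are dominated by \<open>\<bar>Z\<bar> + exp (- Z)\<close>, so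
  their means eventually exceed \<open>\<kappa>\<close>. No second moment enters.\<close>

lemma chernoff_rate:
  fixes Z :: "'a \<Rightarrow> real" and \<kappa> :: real
  assumes "prob_space N" and Z: "integrable N Z" and E: "integrable N (\<lambda>y. exp (- Z y))"
    and \<kappa>: "\<kappa> < (\<integral>y. Z y \<partial>N)"
  obtains r where "0 < r" "integrable N (\<lambda>y. exp (- r * Z y))" "r * \<kappa> < 1 - (\<integral>y. exp (- r * Z y) \<partial>N)"
proof -
  interpret prob_space N by fact
  have [measurable]: "Z \<in> borel_measurable N" using Z by simp
  define g where "g n y = real (Suc n) * (1 - exp (- (1 / real (Suc n)) * Z y))" for n y
  have lim: "(\<lambda>n. g n y) \<longlonglongrightarrow> Z y" for y
  proof -
    have "((\<lambda>h. 1 - exp (- h * Z y)) has_real_derivative Z y) (at 0)"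
      by (auto intro!: derivative_eq_intros)
    then have "(\<lambda>h. (1 - exp (- h * Z y)) / h) \<midarrow>0\<rightarrow> Z y"
      by (simp add: DERIV_def)
    moreover have "filterlim (\<lambda>n. 1 / real (Suc n)) (at 0) sequentially"
      unfolding filterlim_at using LIMSEQ_inverse_real_of_nat by (auto simp: inverse_eq_divide)
    ultimately have "(\<lambda>n. (1 - exp (- (1 / real (Suc n)) * Z y)) / (1 / real (Suc n))) \<longlonglongrightarrow> Z y"
      by (rule filterlim_compose)
    then show ?thesis by (simp add: g_def mult.commute)
  qed
  have bound: "\<bar>g n y\<bar> \<le> \<bar>Z y\<bar> + exp (- Z y)" and upper: "exp (- (1 / real (Suc n)) * Z y) \<le> 1 + exp (- Z y)" for n y
  proof -
    define w where "w = exp (- (1 / real (Suc n)) * Z y)"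
    have w: "w > 0" unfolding w_def by simp
    \<comment> \<open>With the exponents \<open>1 / Suc n\<close>, \<open>w\<close> is a root of
      \<open>exp (- Z y)\<close> and Bernoulli's inequality bounds \<open>- g n y\<close>. The bound
      \<open>g n y \<le> Z y\<close> is \<open>1 + u \<le> exp u\<close>.\<close>
    have "w ^ Suc n = exp (- Z y)"
      unfolding w_def by (subst exp_of_nat_mult[symmetric]) (simp add: field_simps)
    then have b: "1 + real (Suc n) * (w - 1) \<le> exp (- Z y)"
      using Bernoulli_inequality[of "w - 1" "Suc n"] w by simp
    have "1 + - (1 / real (Suc n)) * Z y \<le> w" unfolding w_def by (rule exp_ge_add_one_self)
    then have "real (Suc n) * (1 - w) \<le> real (Suc n) * ((1 / real (Suc n)) * Z y)"
      by (intro mult_left_mono) auto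
    then have u: "real (Suc n) * (1 - w) \<le> Z y" by simp
    have g: "g n y = real (Suc n) * (1 - w)" unfolding g_def w_def by simp
    have "- g n y \<le> exp (- Z y)" using b unfolding g by (simp add: algebra_simps)
    then show "\<bar>g n y\<bar> \<le> \<bar>Z y\<bar> + exp (- Z y)"
      using u unfolding g[symmetric] by (smt (verit) exp_ge_zero)
    have "w - 1 \<le> exp (- Z y)"
    proof (cases "w \<ge> 1")
      case True
      then have "w - 1 \<le> real (Suc n) * (w - 1)" by (simp add: mult_le_cancel_right1)
      then show ?thesis using b by linarith
    next
      case False then show ?thesis by (smt (verit) exp_ge_zero)
    qed
    then show "exp (- (1 / real (Suc n)) * Z y) \<le> 1 + exp (- Z y)" unfolding w_def by simp
  qed
  have int: "integrable N (\<lambda>y. exp (- (1 / real (Suc n)) * Z y))" for n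
    by (rule Bochner_Integration.integrable_bound[of _ "\<lambda>y. 1 + exp (- Z y)"])
       (use E upper in \<open>auto simp: abs_of_nonneg add_nonneg_nonneg\<close>)
  have "(\<lambda>n. \<integral>y. g n y \<partial>N) \<longlonglongrightarrow> (\<integral>y. Z y \<partial>N)"
    by (rule integral_dominated_convergence[where w="\<lambda>y. \<bar>Z y\<bar> + exp (- Z y)"])
       (use Z E lim bound in \<open>auto simp: g_def\<close>)
  then have "eventually (\<lambda>n. \<kappa> < (\<integral>y. g n y \<partial>N)) sequentially"
    using \<kappa> by (rule order_tendstoD)
  then obtain n where "\<kappa> < (\<integral>y. g n y \<partial>N)" by (auto simp: eventually_sequentially)
  also have "(\<integral>y. g n y \<partial>N) = real (Suc n) * (1 - (\<integral>y. exp (- (1 / real (Suc n)) * Z y) \<partial>N))"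
    unfolding g_def using int[of n] by (simp add: prob_space)
  finally have "1 / real (Suc n) * \<kappa> < 1 - (\<integral>y. exp (- (1 / real (Suc n)) * Z y) \<partial>N)"
    by (simp add: field_simps)
  then show ?thesis using int[of n] by (intro that[of "1 / real (Suc n)"]) auto
qed

lemma measurable_PiM_PiM_component:
  assumes "i \<in> I" and "f \<in> measurable N L"
  shows "(\<lambda>x. f (x j i)) \<in> measurable (PiM UNIV (\<lambda>_::nat. PiM I (\<lambda>_. N))) L"
  using assms
  by (intro measurable_compose[OF measurable_component_singleton[OF UNIV_I]]
      measurable_compose[OF measurable_component_singleton])

lemma joint_crossing_bound_finite:
  fixes \<phi> :: "'a \<Rightarrow> real" and b :: "'i \<Rightarrow> real"
  assumes N: "prob_space N" and "finite I" and [measurable]: "\<phi> \<in> borel_measurable N"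
    and \<phi>: "(\<integral>\<^sup>+y. ennreal (exp (\<phi> y)) \<partial>N) \<le> 1" and "J \<subseteq> I"
  defines "S \<equiv> PiM UNIV (\<lambda>_::nat. PiM I (\<lambda>_. N))"
  shows "emeasure S {x \<in> space S. \<forall>i\<in>J. \<exists>k<n. b i \<le> (\<Sum>j\<le>k. \<phi> (x j i))}
    \<le> (\<Prod>i\<in>J. ennreal (min 1 (exp (- b i))))"
  \<comment> \<open>Conditioning on the first step shifts each threshold by \<open>\<phi> (y i)\<close>; the factor of a sensor that
    crosses at that step is 1, so the bound is preserved with the remaining sensors.\<close>
  using \<open>J \<subseteq> I\<close>
proof (induction n arbitrary: J b)
  case 0
  interpret S: prob_space S unfolding S_def by (intro prob_space_PiM N)
  show ?case
  proof (cases "J = {}")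
    case False
    then have "{x \<in> space S. \<forall>i\<in>J. \<exists>k<0. b i \<le> (\<Sum>j\<le>k. \<phi> (x j i))} = {}" by auto
    then show ?thesis by (simp only: emeasure_empty zero_le)
  next
    case True
    then show ?thesis by (simp add: S.emeasure_space_1)
  qed
next
  case (Suc n)
  interpret S: prob_space S unfolding S_def by (intro prob_space_PiM N)
  interpret N: prob_space N by (rule N)
  have fin: "finite J" using Suc.prems \<open>finite I\<close> by (rule finite_subset)
  let ?M = "PiM I (\<lambda>_. N)"
  let ?w = "\<lambda>i z. ennreal (min 1 (exp (\<phi> z - b i)))"
  have M: "prob_space ?M" by (intro prob_space_PiM N)
  have [measurable]: "(\<lambda>x. \<phi> (x j i)) \<in> borel_measurable S" if "i \<in> J" for i j
    unfolding S_def using that Suc.prems by (intro measurable_PiM_PiM_component) auto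
  let ?U = "{x \<in> space S. \<forall>i\<in>J. \<exists>k<Suc n. b i \<le> (\<Sum>j\<le>k. \<phi> (x j i))}"
  have meas: "?U \<in> sets S" using fin by measurable
  have "emeasure S ?U = (\<integral>\<^sup>+x. indicator ?U x \<partial>S)" using meas by simp
  also have "\<dots> = (\<integral>\<^sup>+y. \<integral>\<^sup>+x. indicator ?U (case_nat y x) \<partial>S \<partial>?M)"
    unfolding S_def by (rule nn_integral_PiM_case_nat[OF M]) (use meas in \<open>simp add: S_def\<close>)
  also have "\<dots> \<le> (\<integral>\<^sup>+y. (\<Prod>i\<in>J. ?w i (y i)) \<partial>?M)"
  proof (rule nn_integral_mono)
    fix y assume y: "y \<in> space ?M"
    \<comment> \<open>The sensors that have not crossed with their first observation; only these
      must still cross within \<open>n\<close> further steps.\<close>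
    define K where "K = {i\<in>J. \<phi> (y i) < b i}"
    let ?V = "{x \<in> space S. \<forall>i\<in>K. \<exists>k<n. b i - \<phi> (y i) \<le> (\<Sum>j\<le>k. \<phi> (x j i))}"
    have K: "K \<subseteq> J" unfolding K_def by auto
    have finK: "finite K" using K fin finite_subset by auto
    have [measurable]: "(\<lambda>x. \<phi> (x j i)) \<in> borel_measurable S" if "i \<in> K" for i j
      unfolding S_def using that K Suc.prems by (intro measurable_PiM_PiM_component) auto
    have measV: "?V \<in> sets S" using finK by measurable
    have "indicator ?U (case_nat y x) \<le> (indicator ?V x :: ennreal)" if x: "x \<in> space S" for x
    proof -
      have "x \<in> ?V" if U: "case_nat y x \<in> ?U"
      proof -
        have "\<exists>k<n. b i - \<phi> (y i) \<le> (\<Sum>j\<le>k. \<phi> (x j i))" if i: "i \<in> K" for i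
        proof -
          obtain k where k: "k < Suc n" "b i \<le> (\<Sum>j\<le>k. \<phi> (case_nat y x j i))" using U i K by auto
          have "k \<noteq> 0"
          proof
            assume "k = 0"
            then show False using k(2) i unfolding K_def by simp
          qed
          then obtain k' where k': "k = Suc k'" by (cases k) auto
          show ?thesis using k unfolding k' by (intro exI[of _ k']) (auto simp: sum.atMost_Suc_shift simp del: sum.atMost_Suc)
        qed
        then show ?thesis using x by auto
      qed
      then show ?thesis by (auto simp: indicator_def)
    qed
    then have "(\<integral>\<^sup>+x. indicator ?U (case_nat y x) \<partial>S) \<le> (\<integral>\<^sup>+x. indicator ?V x \<partial>S)"
      by (intro nn_integral_mono)
    also have "\<dots> = emeasure S ?V" using measV by simp
    also have "\<dots> \<le> (\<Prod>i\<in>K. ennreal (min 1 (exp (- (b i - \<phi> (y i))))))"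
      by (rule Suc.IH) (use K Suc.prems in auto)
    also have "\<dots> = (\<Prod>i\<in>K. ?w i (y i))" by simp
    also have "\<dots> = (\<Prod>i\<in>J. ?w i (y i))"
      using fin K by (intro prod.mono_neutral_left) (auto simp: K_def min_def)
    finally show "(\<integral>\<^sup>+x. indicator ?U (case_nat y x) \<partial>S) \<le> (\<Prod>i\<in>J. ?w i (y i))" .
  qed
  also have "\<dots> = (\<Prod>i\<in>J. \<integral>\<^sup>+z. ?w i z \<partial>N)"
    by (rule nn_integral_PiM_prod[OF N fin Suc.prems]) measurable
  \<comment> \<open>The supermartingale step: the mean of
    \<open>min 1 (exp (\<phi> z - b i))\<close> is at most 1 trivially, and at most
    \<open>exp (- b i)\<close> because \<open>exp \<phi>\<close> has mean at most 1.\<close>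
  also have "\<dots> \<le> (\<Prod>i\<in>J. ennreal (min 1 (exp (- b i))))"
  proof (rule prod_mono_ennreal)
    fix i
    have "(\<integral>\<^sup>+z. ?w i z \<partial>N) \<le> (\<integral>\<^sup>+z. 1 \<partial>N)" by (intro nn_integral_mono) (auto simp: ennreal_le_1)
    then have 1: "(\<integral>\<^sup>+z. ?w i z \<partial>N) \<le> 1" by (simp add: N.emeasure_space_1)
    have "(\<integral>\<^sup>+z. ?w i z \<partial>N) \<le> (\<integral>\<^sup>+z. ennreal (exp (- b i)) * ennreal (exp (\<phi> z)) \<partial>N)"
      by (intro nn_integral_mono) (auto simp: ennreal_mult[symmetric] mult_exp_exp intro!: ennreal_leI)
    also have "\<dots> = ennreal (exp (- b i)) * (\<integral>\<^sup>+z. ennreal (exp (\<phi> z)) \<partial>N)"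
      by (rule nn_integral_cmult) measurable
    also have "\<dots> \<le> ennreal (exp (- b i)) * 1" by (rule mult_left_mono[OF \<phi>]) simp
    finally show "(\<integral>\<^sup>+z. ?w i z \<partial>N) \<le> ennreal (min 1 (exp (- b i)))"
      using 1 by (auto simp: min_def)
  qed
  finally show ?case .
qed

text \<open>Continuity from below in the horizon. The sensors may cross at different times, and
  finiteness of \<open>J\<close> provides a common horizon for each path.\<close>

lemma joint_crossing_bound:
  fixes \<phi> :: "'a \<Rightarrow> real" and t :: real
  assumes N: "prob_space N" and "finite I" and [measurable]: "\<phi> \<in> borel_measurable N"
    and \<phi>: "(\<integral>\<^sup>+y. ennreal (exp (\<phi> y)) \<partial>N) \<le> 1" and J: "J \<subseteq> I"
  defines "S \<equiv> PiM UNIV (\<lambda>_::nat. PiM I (\<lambda>_. N))"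
  shows "{x \<in> space S. \<forall>i\<in>J. \<exists>k. t \<le> (\<Sum>j\<le>k. \<phi> (x j i))} \<in> sets S"
    and "emeasure S {x \<in> space S. \<forall>i\<in>J. \<exists>k. t \<le> (\<Sum>j\<le>k. \<phi> (x j i))} \<le> ennreal (exp (- t) ^ card J)"
proof -
  have fin: "finite J" using J \<open>finite I\<close> by (rule finite_subset)
  have [measurable]: "(\<lambda>x. \<phi> (x j i)) \<in> borel_measurable S" if "i \<in> J" for i j
    unfolding S_def using that J by (intro measurable_PiM_PiM_component) auto
  let ?U = "\<lambda>n. {x \<in> space S. \<forall>i\<in>J. \<exists>k<n. t \<le> (\<Sum>j\<le>k. \<phi> (x j i))}"
  show "{x \<in> space S. \<forall>i\<in>J. \<exists>k. t \<le> (\<Sum>j\<le>k. \<phi> (x j i))} \<in> sets S" using fin by measurable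
  have meas: "?U n \<in> sets S" for n using fin by measurable
  have "{x \<in> space S. \<forall>i\<in>J. \<exists>k. t \<le> (\<Sum>j\<le>k. \<phi> (x j i))} \<subseteq> (\<Union>n. ?U n)"
  proof
    fix x assume x: "x \<in> {x \<in> space S. \<forall>i\<in>J. \<exists>k. t \<le> (\<Sum>j\<le>k. \<phi> (x j i))}"
    then obtain k where k: "\<And>i. i \<in> J \<Longrightarrow> t \<le> (\<Sum>j\<le>k i. \<phi> (x j i))" by (auto simp: bchoice_iff)
    have "k i < Suc (Max (k ` J))" if "i \<in> J" for i using that fin by (simp add: less_Suc_eq_le)
    then show "x \<in> (\<Union>n. ?U n)" using x k by blast
  qed
  then have "emeasure S {x \<in> space S. \<forall>i\<in>J. \<exists>k. t \<le> (\<Sum>j\<le>k. \<phi> (x j i))} \<le> emeasure S (\<Union>n. ?U n)"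
    using meas by (intro emeasure_mono) auto
  also have "\<dots> = (SUP n. emeasure S (?U n))"
    by (rule SUP_emeasure_incseq[symmetric]) (use meas in \<open>auto simp: incseq_def, meson less_le_trans\<close>)
  also have "\<dots> \<le> ennreal (exp (- t) ^ card J)"
  proof (rule SUP_least)
    fix n
    have "emeasure S (?U n) \<le> (\<Prod>i\<in>J. ennreal (min 1 (exp (- t))))"
      unfolding S_def by (rule joint_crossing_bound_finite[OF N \<open>finite I\<close> _ \<phi> J, where b="\<lambda>_. t"]) simp
    also have "\<dots> \<le> (\<Prod>i\<in>J. ennreal (exp (- t)))"
      by (intro prod_mono_ennreal ennreal_leI) auto
    finally show "emeasure S (?U n) \<le> ennreal (exp (- t) ^ card J)" by (simp add: ennreal_power)
  qed
  finally show "emeasure S {x \<in> space S. \<forall>i\<in>J. \<exists>k. t \<le> (\<Sum>j\<le>k. \<phi> (x j i))} \<le> ennreal (exp (- t) ^ card J)" .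
qed

text \<open>Markov's inequality for \<open>exp (- r * S)\<close>, with \<open>S\<close> the sum of
  the first \<open>n\<close> scores; its mean factorizes over time.\<close>

lemma random_walk_lower_tail:
  fixes Z :: "'a \<Rightarrow> real" and r t :: real
  assumes N: "prob_space N" and i: "i \<in> I" and [measurable]: "Z \<in> borel_measurable N"
    and r: "0 < r" and int: "integrable N (\<lambda>y. exp (- r * Z y))"
  defines "S \<equiv> PiM UNIV (\<lambda>_::nat. PiM I (\<lambda>_. N))"
  shows "emeasure S {x \<in> space S. (\<Sum>j<n. Z (x j i)) < t} \<le> ennreal (exp (r * t) * (\<integral>y. exp (- r * Z y) \<partial>N) ^ n)"
proof -
  let ?M = "PiM I (\<lambda>_. N)"
  let ?\<rho> = "\<integral>y. exp (- r * Z y) \<partial>N"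
  have M: "prob_space ?M" by (intro prob_space_PiM N)
  have Zi[measurable]: "(\<lambda>y. Z (y i)) \<in> borel_measurable ?M"
    using i by measurable
  have [measurable]: "(\<lambda>x. Z (x j i)) \<in> borel_measurable S" for j
    unfolding S_def using i by (intro measurable_PiM_PiM_component) auto
  have "emeasure S {x \<in> space S. (\<Sum>j<n. Z (x j i)) < t} = (\<integral>\<^sup>+x. indicator {x \<in> space S. (\<Sum>j<n. Z (x j i)) < t} x \<partial>S)"
    by simp
  also have "\<dots> \<le> (\<integral>\<^sup>+x. ennreal (exp (r * t)) * (\<Prod>j<n. ennreal (exp (- r * Z (x j i)))) \<partial>S)"
  proof (intro nn_integral_mono)
    fix x
    have "(\<Prod>j<n. ennreal (exp (- r * Z (x j i)))) = ennreal (exp (- r * (\<Sum>j<n. Z (x j i))))"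
      by (simp add: prod_ennreal exp_sum sum_distrib_left sum_negf[symmetric])
    then have "ennreal (exp (r * t)) * (\<Prod>j<n. ennreal (exp (- r * Z (x j i)))) = ennreal (exp (r * (t - (\<Sum>j<n. Z (x j i)))))"
      by (simp add: ennreal_mult[symmetric] mult_exp_exp right_diff_distrib)
    then show "indicator {x \<in> space S. (\<Sum>j<n. Z (x j i)) < t} x \<le> ennreal (exp (r * t)) * (\<Prod>j<n. ennreal (exp (- r * Z (x j i))))"
      using r by (auto simp: indicator_def)
  qed
  also have "\<dots> = ennreal (exp (r * t)) * (\<integral>\<^sup>+x. (\<Prod>j<n. ennreal (exp (- r * Z (x j i)))) \<partial>S)"
    by (rule nn_integral_cmult) measurable
  also have "(\<integral>\<^sup>+x. (\<Prod>j<n. ennreal (exp (- r * Z (x j i)))) \<partial>S) = (\<Prod>j<n. \<integral>\<^sup>+y. ennreal (exp (- r * Z (y i))) \<partial>?M)"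
    unfolding S_def by (rule nn_integral_PiM_prod[of UNIV "\<lambda>_. ?M" "{..<n}" "\<lambda>_ y. ennreal (exp (- r * Z (y i)))"]) (use M in auto)
  also have "(\<integral>\<^sup>+y. ennreal (exp (- r * Z (y i))) \<partial>?M) = (\<integral>\<^sup>+z. ennreal (exp (- r * Z z)) \<partial>N)"
    using nn_integral_PiM_prod[of I "\<lambda>_. N" "{i}" "\<lambda>_ z. ennreal (exp (- r * Z z))"] N i by simp
  also have "\<dots> = ennreal ?\<rho>" using int by (rule nn_integral_eq_integral) auto
  finally show ?thesis by (simp add: ennreal_power ennreal_mult)
qed

text \<open>The event in the sum says that after \<open>n\<close> observations some sensor of
  \<open>H\<close> has not yet reached \<open>t\<close>. Summed over \<open>n\<close>, the
  indicators count the observations until all sensors of \<open>H\<close> have crossed, and the sum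
  is infinite if that never happens (for nonempty \<open>H\<close>).\<close>

lemma expected_passage_bound:
  fixes Z :: "'a \<Rightarrow> real" and r t :: real
  assumes N: "prob_space N" and H: "H \<subseteq> I" "finite H" and [measurable]: "Z \<in> borel_measurable N"
    and r: "0 < r" and int: "integrable N (\<lambda>y. exp (- r * Z y))" and t: "0 < t"
    and \<rho>: "(\<integral>y. exp (- r * Z y) \<partial>N) < 1"
  defines "S \<equiv> PiM UNIV (\<lambda>_::nat. PiM I (\<lambda>_. N))"
  defines "\<rho> \<equiv> \<integral>y. exp (- r * Z y) \<partial>N"
  shows "(\<lambda>x. \<Sum>n. indicator {x. \<exists>i\<in>H. \<forall>k<n. (\<Sum>j\<le>k. Z (x j i)) < t} x :: ennreal) \<in> borel_measurable S"
    and "(\<integral>\<^sup>+x. (\<Sum>n. indicator {x. \<exists>i\<in>H. \<forall>k<n. (\<Sum>j\<le>k. Z (x j i)) < t} x) \<partial>S)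
      \<le> ennreal (r * t / (1 - \<rho>) + (1 + card H / (1 - \<rho>)))"
proof -
  interpret S: prob_space S unfolding S_def by (intro prob_space_PiM N)
  let ?E = "\<lambda>n. {x. \<exists>i\<in>H. \<forall>k<n. (\<Sum>j\<le>k. Z (x j i)) < t}"
  have \<rho>1: "\<rho> < 1" using \<open>(\<integral>y. exp (- r * Z y) \<partial>N) < 1\<close> unfolding \<rho>_def .
  have \<rho>0: "0 \<le> \<rho>" unfolding \<rho>_def by (intro integral_nonneg_AE) auto
  have [measurable]: "(\<lambda>x. Z (x j i)) \<in> borel_measurable S" if "i \<in> H" for i j
    unfolding S_def using that H by (intro measurable_PiM_PiM_component) auto
  have E_sets: "{x \<in> space S. x \<in> ?E n} \<in> sets S" for n
    unfolding mem_Collect_eq using H by measurable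
  have ind: "(\<lambda>x. indicator (?E n) x :: ennreal) \<in> borel_measurable S" for n
    using E_sets[of n] by (intro borel_measurable_indicator') (auto simp: vimage_def Int_def conj_commute)
  then show meas: "(\<lambda>x. \<Sum>n. indicator (?E n) x :: ennreal) \<in> borel_measurable S" by measurable
  \<comment> \<open>From \<open>m\<close> on the union bound over \<open>H\<close> is geometric:
    \<open>\<rho> \<le> exp (- (1 - \<rho>))\<close> yields
    \<open>exp (r * t) * \<rho> ^ m \<le> 1\<close>. Before \<open>m\<close> the trivial bound 1 is
    used. Rounding up costs the summand 1 in the result.\<close>
  define m where "m = nat \<lceil>r * t / (1 - \<rho>)\<rceil>"
  have m: "r * t \<le> (1 - \<rho>) * real m" "real m \<le> r * t / (1 - \<rho>) + 1"
  proof -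
    have pos: "0 \<le> r * t / (1 - \<rho>)" using r t \<rho>1 by simp
    have "r * t / (1 - \<rho>) \<le> real m" unfolding m_def by (simp add: real_nat_ceiling_ge)
    then show "r * t \<le> (1 - \<rho>) * real m" using \<rho>1 by (simp add: field_simps)
    show "real m \<le> r * t / (1 - \<rho>) + 1" unfolding m_def using pos by linarith
  qed
  have \<rho>m: "exp (r * t) * \<rho> ^ m \<le> 1"
  proof -
    have "\<rho> \<le> exp (- (1 - \<rho>))" using exp_ge_add_one_self[of "- (1 - \<rho>)"] by simp
    then have "\<rho> ^ m \<le> exp (- (1 - \<rho>)) ^ m" using \<rho>0 by (rule power_mono)
    also have "\<dots> = exp (- ((1 - \<rho>) * real m))" by (simp add: exp_of_nat_mult[symmetric] algebra_simps)
    also have "\<dots> \<le> exp (- (r * t))" using m(1) by simp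
    finally show ?thesis using mult_left_mono[of "\<rho> ^ m" "exp (- (r * t))" "exp (r * t)"]
      by (simp add: mult_exp_exp)
  qed
  define B where "B n = (if n < m then 1 else card H * \<rho> ^ (n - m))" for n
  have B0: "0 \<le> B n" for n unfolding B_def using \<rho>0 by auto
  have bound: "(\<integral>\<^sup>+x. indicator (?E n) x \<partial>S) \<le> ennreal (B n)" for n
  proof (cases "n < m")
    case True
    have "(\<integral>\<^sup>+x. indicator (?E n) x \<partial>S) \<le> (\<integral>\<^sup>+x. 1 \<partial>S)" by (intro nn_integral_mono) (auto simp: indicator_def)
    then show ?thesis using True by (simp add: B_def S.emeasure_space_1)
  next
    case False
    have "(\<integral>\<^sup>+x. indicator (?E n) x \<partial>S) \<le> (\<integral>\<^sup>+x. (\<Sum>i\<in>H. indicator {x \<in> space S. (\<Sum>j<n. Z (x j i)) < t} x) \<partial>S)"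
    proof (rule nn_integral_mono)
      fix x assume x: "x \<in> space S"
      show "indicator (?E n) x \<le> (\<Sum>i\<in>H. indicator {x \<in> space S. (\<Sum>j<n. Z (x j i)) < t} x :: ennreal)"
      proof (cases "x \<in> ?E n")
        case True
        then obtain i where i: "i \<in> H" "\<forall>k<n. (\<Sum>j\<le>k. Z (x j i)) < t" by auto
        have "(\<Sum>j<n. Z (x j i)) < t"
        proof (cases n)
          case (Suc k)
          then show ?thesis using i(2) by (simp add: lessThan_Suc_atMost)
        qed (use t in simp)
        then have "(indicator (?E n) x :: ennreal) \<le> indicator {x \<in> space S. (\<Sum>j<n. Z (x j i)) < t} x"
          using x by (simp add: indicator_def)
        also have "\<dots> \<le> (\<Sum>i\<in>H. indicator {x \<in> space S. (\<Sum>j<n. Z (x j i)) < t} x)"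
          using i(1) H(2) by (intro member_le_sum) auto
        finally show ?thesis .
      qed simp
    qed
    also have "\<dots> = (\<Sum>i\<in>H. emeasure S {x \<in> space S. (\<Sum>j<n. Z (x j i)) < t})"
      by (subst nn_integral_sum) auto
    also have "\<dots> \<le> (\<Sum>i\<in>H. ennreal (exp (r * t) * \<rho> ^ n))"
      unfolding S_def \<rho>_def using H
      by (intro sum_mono random_walk_lower_tail N r int) auto
    also have "\<dots> \<le> (\<Sum>i\<in>H. ennreal (\<rho> ^ (n - m)))"
    proof (intro sum_mono ennreal_leI)
      have "exp (r * t) * \<rho> ^ n = (exp (r * t) * \<rho> ^ m) * \<rho> ^ (n - m)"
        using False by (simp add: power_add[symmetric])
      also have "\<dots> \<le> 1 * \<rho> ^ (n - m)" using \<rho>m \<rho>0 by (intro mult_right_mono) auto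
      finally show "exp (r * t) * \<rho> ^ n \<le> \<rho> ^ (n - m)" by simp
    qed
    also have "\<dots> = ennreal (B n)" using False \<rho>0 by (simp add: B_def ennreal_mult ennreal_of_nat_eq_real_of_nat)
    finally show ?thesis .
  qed
  have "(\<lambda>n. \<rho> ^ n) sums (1 / (1 - \<rho>))" using \<rho>0 \<rho>1 by (intro geometric_sums) auto
  then have "(\<lambda>n. card H * \<rho> ^ n) sums (card H * (1 / (1 - \<rho>)))" by (rule sums_mult)
  then have "(\<lambda>n. B (n + m)) sums (card H / (1 - \<rho>))" by (simp add: B_def)
  then have "B sums (card H / (1 - \<rho>) + (\<Sum>i<m. B i))" by (simp only: sums_iff_shift)
  also have "(\<Sum>i<m. B i) = real m" by (simp add: B_def)
  finally have B_sums: "B sums (card H / (1 - \<rho>) + real m)" .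
  have "(\<integral>\<^sup>+x. (\<Sum>n. indicator (?E n) x) \<partial>S) = (\<Sum>n. \<integral>\<^sup>+x. indicator (?E n) x \<partial>S)"
    by (rule nn_integral_suminf) (rule ind)
  also have "\<dots> \<le> (\<Sum>n. ennreal (B n))" by (rule suminf_le[OF bound]) auto
  also have "\<dots> = ennreal (card H / (1 - \<rho>) + real m)"
    using B_sums B0 by (simp add: suminf_ennreal2 sums_iff)
  also have "\<dots> \<le> ennreal (r * t / (1 - \<rho>) + (1 + card H / (1 - \<rho>)))"
    using m(2) by (intro ennreal_leI) simp
  finally show "(\<integral>\<^sup>+x. (\<Sum>n. indicator (?E n) x) \<partial>S) \<le> ennreal (r * t / (1 - \<rho>) + (1 + card H / (1 - \<rho>)))" .
qed

section \<open>Log-likelihood ratios\<close>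

locale sensor_pair =
  fixes \<mu> \<nu> :: "real measure"
  assumes prob_mu: "prob_space \<mu>" and prob_nu: "prob_space \<nu>"
    and sets_mu[measurable_cong]: "sets \<mu> = sets borel" and sets_nu[measurable_cong]: "sets \<nu> = sets borel"
    and ac_nu_mu: "absolutely_continuous \<nu> \<mu>" and ac_mu_nu: "absolutely_continuous \<mu> \<nu>"
    and int_mu: "integrable \<mu> (LLR \<mu> \<nu>)" and int_nu: "integrable \<nu> (LLR \<mu> \<nu>)"
    and I0_pos: "0 < I0 \<mu> \<nu>" and I1_pos: "0 < I1 \<mu> \<nu>"
begin

definition law :: "bool \<Rightarrow> real measure" where "law \<theta> = (if \<theta> then \<mu> else \<nu>)"

text \<open>The log-likelihood ratio signed so that it has positive drift under the true state.\<close>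
definition score :: "bool \<Rightarrow> real \<Rightarrow> real" where
  "score \<theta> y = (if \<theta> then LLR \<mu> \<nu> y else - LLR \<mu> \<nu> y)"

definition info :: "bool \<Rightarrow> real" where "info \<theta> = (if \<theta> then I1 \<mu> \<nu> else I0 \<mu> \<nu>)"

lemma prob_law: "prob_space (law \<theta>)" by (simp add: law_def prob_mu prob_nu)

lemma sets_law[measurable_cong]: "sets (law \<theta>) = sets borel" by (simp add: law_def sets_mu sets_nu)

lemma LLR_measurable[measurable]: "LLR \<mu> \<nu> \<in> borel_measurable borel"
proof -
  have "LLR \<mu> \<nu> \<in> borel_measurable \<nu>" unfolding LLR_def[abs_def] by measurable
  then show ?thesis by (simp add: measurable_cong_sets[OF sets_nu refl])
qed

lemma score_measurable[measurable]: "score \<theta> \<in> borel_measurable borel"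
  unfolding score_def[abs_def] by measurable

lemma info_pos: "0 < info \<theta>" by (simp add: info_def I0_pos I1_pos)

lemma score_integrable: "integrable (law \<theta>) (score \<theta>)"
  unfolding law_def score_def[abs_def] using int_mu int_nu by auto

lemma integral_score: "(\<integral>y. score \<theta> y \<partial>law \<theta>) = info \<theta>"
  unfolding law_def score_def[abs_def] info_def I1_def I0_def by auto

lemma score_not: "score (\<not> \<theta>) y = - score \<theta> y" by (simp add: score_def)

text \<open>\<open>LLR\<close> takes arbitrary default values where the Radon-Nikodym derivative is
  0 or infinite; mutual absolute continuity makes both sets null.\<close>

lemma exp_LLR: "AE y in \<nu>. ennreal (exp (LLR \<mu> \<nu> y)) = RN_deriv \<nu> \<mu> y"
proof -
  interpret m: prob_space \<mu> by (rule prob_mu)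
  interpret n: prob_space \<nu> by (rule prob_nu)
  have D: "density \<nu> (RN_deriv \<nu> \<mu>) = \<mu>"
    by (rule n.density_RN_deriv[OF ac_nu_mu]) (simp add: sets_mu sets_nu)
  have fin: "AE y in \<nu>. RN_deriv \<nu> \<mu> y \<noteq> \<infinity>"
    by (rule n.RN_deriv_finite[OF _ ac_nu_mu]) (auto simp: sets_mu sets_nu m.sigma_finite_measure_axioms)
  \<comment> \<open>A density is nonzero almost everywhere for the measure that it generates; the
    absolute continuity of \<open>\<nu>\<close> with respect to \<open>\<mu>\<close> carries this
    back to \<open>\<nu>\<close>.\<close>
  have "AE y in density \<nu> (RN_deriv \<nu> \<mu>). RN_deriv \<nu> \<mu> y \<noteq> 0"
    by (subst AE_density) auto
  then have "AE y in \<mu>. RN_deriv \<nu> \<mu> y \<noteq> 0" unfolding D .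
  then have "AE y in \<nu>. RN_deriv \<nu> \<mu> y \<noteq> 0"
    by (intro absolutely_continuous_AE[OF _ ac_mu_nu]) (simp_all add: sets_mu sets_nu)
  with fin show ?thesis
  proof eventually_elim
    case (elim y)
    then have "0 < enn2real (RN_deriv \<nu> \<mu> y)" by (auto simp: enn2real_positive_iff zero_less_iff_neq_zero less_top)
    then show ?case using elim by (simp add: LLR_def less_top)
  qed
qed

text \<open>The source of every change of measure below. In one state it is the Radon-Nikodym
  theorem; in the other the density is the reciprocal, which is legitimate as \<open>exp\<close>
  never vanishes.\<close>

lemma density_exp_score: "density (law \<theta>) (\<lambda>y. ennreal (exp (- score \<theta> y))) = law (\<not> \<theta>)"
proof -
  interpret n: prob_space \<nu> by (rule prob_nu)
  have [measurable]: "LLR \<mu> \<nu> \<in> borel_measurable \<nu>" by measurable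
  have "density \<nu> (\<lambda>y. ennreal (exp (LLR \<mu> \<nu> y))) = density \<nu> (RN_deriv \<nu> \<mu>)"
    using exp_LLR by (intro density_cong) auto
  also have "\<dots> = \<mu>"
    by (rule n.density_RN_deriv[OF ac_nu_mu]) (simp add: sets_mu sets_nu)
  finally have 1: "density \<nu> (\<lambda>y. ennreal (exp (LLR \<mu> \<nu> y))) = \<mu>" .
  have "density \<mu> (\<lambda>y. ennreal (exp (- LLR \<mu> \<nu> y))) =
      density (density \<nu> (\<lambda>y. ennreal (exp (LLR \<mu> \<nu> y)))) (\<lambda>y. ennreal (exp (- LLR \<mu> \<nu> y)))"
    unfolding 1 ..
  also have "\<dots> = density \<nu> (\<lambda>y. ennreal (exp (LLR \<mu> \<nu> y)) * ennreal (exp (- LLR \<mu> \<nu> y)))"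
    by (rule density_density_eq) auto
  also have "\<dots> = \<nu>" by (simp add: ennreal_mult[symmetric] mult_exp_exp density_1)
  finally show ?thesis using 1 by (simp add: law_def score_def)
qed

text \<open>Total mass of the other law. It is the hypothesis of the crossing bound for the wrong
  direction, and also the integrability that \<open>chernoff_rate\<close> asks for.\<close>

lemma nn_integral_exp_score: "(\<integral>\<^sup>+y. ennreal (exp (- score \<theta> y)) \<partial>law \<theta>) = 1"
proof -
  interpret prob_space "law (\<not> \<theta>)" by (rule prob_law)
  have "emeasure (density (law \<theta>) (\<lambda>y. ennreal (exp (- score \<theta> y)))) (space (law \<theta>)) =
    (\<integral>\<^sup>+y. ennreal (exp (- score \<theta> y)) \<partial>law \<theta>)"
    by (subst emeasure_density) (auto intro!: nn_integral_cong)
  moreover have "space (law \<theta>) = space (law (\<not> \<theta>))"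
    by (rule sets_eq_imp_space_eq) (simp add: sets_law)
  ultimately show ?thesis by (simp add: density_exp_score emeasure_space_1)
qed

lemma exp_score_integrable: "integrable (law \<theta>) (\<lambda>y. exp (- score \<theta> y))"
  by (rule integrableI_nn_integral_finite[where x=1]) (auto simp: nn_integral_exp_score)

end

section \<open>The voting rule\<close>

text \<open>\<open>tau_plus\<close>, \<open>tau_minus\<close> and \<open>order_stat\<close> share
  this shape, so one rule turns their comparison with a finite time into bounded existence.\<close>

lemma first_hit_le_iff:
  "(if \<exists>n. P n then enat (LEAST n. P n) else \<infinity>) \<le> enat k \<longleftrightarrow> (\<exists>n\<le>k. P n)"
  by (auto intro: LeastI dest: Least_le order_trans)

lemma enat_eq_iff_first: "(a :: enat) = enat k \<longleftrightarrow> a \<le> enat k \<and> (\<forall>j<k. \<not> a \<le> enat j)"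
  by (cases a) (auto simp: not_le, metis le_neq_implies_less less_irrefl)

context sensor_pair
begin

text \<open>Hitting times with values in \<open>enat\<close> are replaced by events that are
  monotone in \<open>k\<close>: \<open>crossed\<close> for one sensor and \<open>quorum\<close> for
  the \<open>r\<close>-th order statistic. Taking the direction as a \<open>bool\<close> treats both
  thresholds at once.\<close>

definition crossed :: "bool \<Rightarrow> real \<Rightarrow> obs \<Rightarrow> nat \<Rightarrow> nat \<Rightarrow> bool" where
  "crossed \<theta> t x i k \<longleftrightarrow> (\<exists>n\<le>k. t \<le> (\<Sum>j\<le>n. score \<theta> (x j i)))"

definition quorum :: "nat \<Rightarrow> nat \<Rightarrow> bool \<Rightarrow> real \<Rightarrow> obs \<Rightarrow> nat \<Rightarrow> bool" where
  "quorum s r \<theta> t x k \<longleftrightarrow> r \<le> card {i. i < s \<and> crossed \<theta> t x i k}"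

lemma score_sum:
  "(\<Sum>j\<le>n. score \<theta> (x j i)) = (if \<theta> then cumLLR \<mu> \<nu> x i n else - cumLLR \<mu> \<nu> x i n)"
  by (simp add: score_def cumLLR_def sum_negf)

lemma tau_plus_le_iff: "tau_plus \<mu> \<nu> t x i \<le> enat k \<longleftrightarrow> crossed True t x i k"
  unfolding tau_plus_def crossed_def first_hit_le_iff score_sum by simp

lemma tau_minus_le_iff: "tau_minus \<mu> \<nu> t x i \<le> enat k \<longleftrightarrow> crossed False t x i k"
  unfolding tau_minus_def crossed_def first_hit_le_iff score_sum by (simp add: le_minus_iff)

lemma crossed_mono: "crossed \<theta> t x i k \<Longrightarrow> k \<le> k' \<Longrightarrow> crossed \<theta> t x i k'"
  unfolding crossed_def by (meson order_trans)

lemma quorum_mono: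
  assumes "quorum s r \<theta> t x k" "k \<le> k'"
  shows "quorum s r \<theta> t x k'"
proof -
  have "card {i. i < s \<and> crossed \<theta> t x i k} \<le> card {i. i < s \<and> crossed \<theta> t x i k'}"
    using assms(2) crossed_mono by (intro card_mono) auto
  then show ?thesis using assms(1) unfolding quorum_def by linarith
qed

lemma order_stat_tau_minus:
  "order_stat s r (tau_minus \<mu> \<nu> t x) =
    (if \<exists>k. quorum s r False t x k then enat (LEAST k. quorum s r False t x k) else \<infinity>)"
  unfolding order_stat_def tau_minus_le_iff quorum_def ..

lemma order_stat_tau_plus:
  "order_stat s r (tau_plus \<mu> \<nu> t x) =
    (if \<exists>k. quorum s r True t x k then enat (LEAST k. quorum s r True t x k) else \<infinity>)"
  unfolding order_stat_def tau_plus_le_iff quorum_def ..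

lemma order_stat_le_iff:
  "order_stat s r (tau_minus \<mu> \<nu> t x) \<le> enat k \<longleftrightarrow> quorum s r False t x k"
  "order_stat s r (tau_plus \<mu> \<nu> t x) \<le> enat k \<longleftrightarrow> quorum s r True t x k"
  unfolding order_stat_tau_minus order_stat_tau_plus first_hit_le_iff using quorum_mono by blast+

text \<open>The rule stops when the first quorum of either kind appears. A tie means that both
  quorums are present at that moment, which is possible because one sensor may have crossed both
  thresholds in the past.\<close>

lemma voting_rule_eq:
  "voting_rule s r \<mu> \<nu> t k x v =
    (if (\<exists>\<theta>. quorum s r \<theta> t x k) \<and> (\<forall>j<k. \<forall>\<theta>. \<not> quorum s r \<theta> t x j)
     then (if \<not> quorum s r True t x k then Some False else if \<not> quorum s r False t x k then Some True else Some v)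
     else None)"
proof -
  define m where "m = order_stat s r (tau_minus \<mu> \<nu> t x)"
  define p where "p = order_stat s r (tau_plus \<mu> \<nu> t x)"
  have m: "m \<le> enat j \<longleftrightarrow> quorum s r False t x j" and p: "p \<le> enat j \<longleftrightarrow> quorum s r True t x j" for j
    unfolding m_def p_def by (rule order_stat_le_iff)+
  have min: "min m p \<le> enat j \<longleftrightarrow> (\<exists>\<theta>. quorum s r \<theta> t x j)" for j
    unfolding min_le_iff_disj m p by (auto simp: ex_bool_eq)
  have stop: "min m p = enat k \<longleftrightarrow> (\<exists>\<theta>. quorum s r \<theta> t x k) \<and> (\<forall>j<k. \<forall>\<theta>. \<not> quorum s r \<theta> t x j)"
    unfolding enat_eq_iff_first min by auto
  have less: "m < p \<longleftrightarrow> \<not> quorum s r True t x k" "p < m \<longleftrightarrow> \<not> quorum s r False t x k" if "min m p = enat k"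
    using that unfolding m[symmetric] p[symmetric] by (auto simp: min_def split: if_splits)
  show ?thesis
  proof (cases "min m p = enat k")
    case True
    show ?thesis unfolding voting_rule_def Let_def m_def[symmetric] p_def[symmetric]
      by (simp only: if_P[OF True] if_P[OF True[unfolded stop]] less[OF True])
  next
    case False
    show ?thesis unfolding voting_rule_def Let_def m_def[symmetric] p_def[symmetric]
      by (simp only: if_not_P[OF False] if_not_P[OF False[unfolded stop]])
  qed
qed

lemma voting_rule_not_None:
  "voting_rule s r \<mu> \<nu> t k x v \<noteq> None \<longleftrightarrow>
    (\<exists>\<theta>. quorum s r \<theta> t x k) \<and> (\<forall>j<k. \<forall>\<theta>. \<not> quorum s r \<theta> t x j)"
  unfolding voting_rule_eq by auto

text \<open>Even a coin toss on a tie announces a state that has a quorum, since both quorums are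
  then present.\<close>

lemma decides_voting_rule:
  assumes "decides (voting_rule s r \<mu> \<nu> t) x v \<theta>"
  shows "\<exists>k. quorum s r \<theta> t x k"
proof -
  obtain k where k: "voting_rule s r \<mu> \<nu> t k x v = Some \<theta>" using assms unfolding decides_def by auto
  then have "\<exists>\<theta>'. quorum s r \<theta>' t x k" using voting_rule_not_None[of s r t k x v] by auto
  then have "quorum s r \<theta> t x k"
    using k unfolding voting_rule_eq by (cases \<theta>) (auto split: if_splits, metis (full_types))
  then show ?thesis ..
qed

text \<open>A quorum for the other state could only stop the rule earlier. \<open>Suc k\<close>
  converts the 0-based index into a number of observations.\<close>

lemma run_time_voting_rule:
  assumes "quorum s r \<theta> t x k"
  shows "run_time (voting_rule s r \<mu> \<nu> t) x v \<le> of_nat (Suc k)"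
proof -
  define m where "m = (LEAST k. \<exists>\<theta>. quorum s r \<theta> t x k)"
  have m: "\<exists>\<theta>. quorum s r \<theta> t x m" unfolding m_def by (rule LeastI_ex) (use assms in blast)
  have mk: "m \<le> k" unfolding m_def by (rule Least_le) (use assms in blast)
  have "\<not> quorum s r \<theta> t x j" if "j < m" for j \<theta>
    using not_less_Least[OF that[unfolded m_def]] by blast
  then have stop: "voting_rule s r \<mu> \<nu> t m x v \<noteq> None" unfolding voting_rule_not_None using m by blast
  then have "(LEAST k. voting_rule s r \<mu> \<nu> t k x v \<noteq> None) \<le> k"
    using Least_le[of "\<lambda>k. voting_rule s r \<mu> \<nu> t k x v \<noteq> None", OF stop] mk by linarith
  then show ?thesis unfolding run_time_def using stop by (auto simp del: of_nat_Suc intro!: of_nat_mono)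
qed

lemma quorum_measurable[measurable]: "Measurable.pred (obs_space s) (\<lambda>x. quorum s r \<theta> t x k)"
proof -
  have [measurable]: "Measurable.pred (obs_space s) (\<lambda>x. crossed \<theta> t x i k)" if "i < s" for i
  proof -
    have [measurable]: "(\<lambda>x. score \<theta> (x j i)) \<in> borel_measurable (obs_space s)" for j
      unfolding obs_space_def using that by (intro measurable_PiM_PiM_component score_measurable) simp
    show ?thesis unfolding crossed_def by measurable
  qed
  \<comment> \<open>The size of a random set is rewritten as a finite sum of indicators to make its
    measurability visible.\<close>
  have "card {i. i < s \<and> crossed \<theta> t x i k} = (\<Sum>i<s. if crossed \<theta> t x i k then 1 else 0)" for x
    by (simp add: sum.If_cases Int_def)
  then show ?thesis unfolding quorum_def by simp
qed

lemma crossed_cong: "(\<And>j. j \<le> k \<Longrightarrow> x j i = y j i) \<Longrightarrow> crossed \<theta> t x i k = crossed \<theta> t y i k"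
  unfolding crossed_def by (intro ex_cong1 conj_cong refl arg_cong2[where f="(\<le>)"] sum.cong) auto

lemma quorum_cong: "(\<And>j. j \<le> k \<Longrightarrow> x j = y j) \<Longrightarrow> quorum s r \<theta> t x k = quorum s r \<theta> t y k"
  unfolding quorum_def using crossed_cong[of k x _ y \<theta> t] by simp

lemma admissible_voting_rule: "admissible_test s fair_coin (voting_rule s r \<mu> \<nu> t)"
  unfolding admissible_test_def
proof (intro conjI allI impI)
  show "prob_space fair_coin" unfolding fair_coin_def by (rule measure_pmf.prob_space_axioms)
  have [measurable_cong]: "sets fair_coin = sets (count_space UNIV)" unfolding fair_coin_def by simp
  show "(\<lambda>(x, v). voting_rule s r \<mu> \<nu> t k x v) \<in> measurable (obs_space s \<Otimes>\<^sub>M fair_coin) (count_space UNIV)" for k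
    unfolding voting_rule_eq split_beta' by measurable
  show "voting_rule s r \<mu> \<nu> t k x v = voting_rule s r \<mu> \<nu> t k y v" if "\<forall>j\<le>k. x j = y j" for k x y v
  proof -
    have "quorum s r \<theta> t x j = quorum s r \<theta> t y j" if "j \<le> k" for j \<theta>
      using \<open>\<forall>j\<le>k. x j = y j\<close> that by (intro quorum_cong) auto
    then show ?thesis unfolding voting_rule_eq by simp
  qed
qed

end

section \<open>Error and delay of the voting rule against an arbitrary attack\<close>

lemma nn_integral_pair_fst:
  assumes "prob_space N" and [measurable]: "f \<in> borel_measurable M"
  shows "(\<integral>\<^sup>+p. f (fst p) \<partial>(M \<Otimes>\<^sub>M N)) = (\<integral>\<^sup>+x. f x \<partial>M)"
proof -
  interpret prob_space N by fact
  show ?thesis by (subst nn_integral_fst[symmetric]) (auto simp: emeasure_space_1)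
qed

text \<open>Error and delay of the voting rule are bounded by functions of the true observations
  alone; for these the randomness of attacker and detector integrates out.\<close>

lemma nn_integral_base_measure_fst:
  assumes "prob_space R" "prob_space Rd" and [measurable]: "f \<in> borel_measurable (obs_law s \<mu> \<nu> \<theta>)"
  shows "(\<integral>\<^sup>+p. f (fst (fst p)) \<partial>base_measure s \<mu> \<nu> R Rd \<theta>) = (\<integral>\<^sup>+x. f x \<partial>obs_law s \<mu> \<nu> \<theta>)"
  unfolding base_measure_def
  by (subst nn_integral_pair_fst[OF assms(2), of "\<lambda>q. f (fst q)"]) (simp_all add: nn_integral_pair_fst[OF assms(1)])

context sensor_pair
begin

lemma obs_law_eq: "obs_law s \<mu> \<nu> \<theta> = PiM UNIV (\<lambda>_. PiM {..<s} (\<lambda>_. law \<theta>))"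
  unfolding obs_law_def law_def ..

lemma manip_honest:
  assumes "admissible_attack s c \<mu> \<nu> C R A" "i < s" "i \<notin> C \<theta>"
  shows "manip s A \<theta> x \<omega> j i = x j i"
  using assms by (auto simp: admissible_attack_def manip_def)

lemma crossed_manip_honest:
  assumes "admissible_attack s c \<mu> \<nu> C R A" "i < s" "i \<notin> C \<theta>"
  shows "crossed \<theta>' t (manip s A \<theta> x \<omega>) i k = crossed \<theta>' t x i k"
  using manip_honest[OF assms] by (intro crossed_cong)

text \<open>The wrong decision is enclosed in the union, over the sets \<open>J\<close> of
  \<open>s - 2 * c\<close> honest sensors, of the events that all of \<open>J\<close> cross in the
  wrong direction. These events concern true observations only, so the attack drops out. The factor
  \<open>2 ^ s\<close> bounds the number of sets \<open>J\<close>.\<close>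

lemma attack_error_bound:
  assumes adm: "admissible_attack s c \<mu> \<nu> C R A" and sc: "2 * c < s"
  shows "err_prob s \<mu> \<nu> fair_coin (voting_rule s (s - c) \<mu> \<nu> t) R A \<theta> \<le> 2 ^ s * exp (- t) ^ (s - 2 * c)"
proof -
  define S where "S = obs_law s \<mu> \<nu> \<theta>"
  define H where "H = {..<s} - C \<theta>"
  define K where "K = {J. J \<subseteq> H \<and> card J = s - 2 * c}"
  define V where "V J = {x \<in> space S. \<forall>i\<in>J. \<exists>k. t \<le> (\<Sum>j\<le>k. score (\<not> \<theta>) (x j i))}" for J
  let ?base = "base_measure s \<mu> \<nu> R fair_coin \<theta>"
  let ?d = "voting_rule s (s - c) \<mu> \<nu> t"
  have R: "prob_space R" and C: "C \<theta> \<subseteq> {..<s}" "card (C \<theta>) = c" using adm by (auto simp: admissible_attack_def)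
  have coin: "prob_space fair_coin" unfolding fair_coin_def by (rule measure_pmf.prob_space_axioms)
  have finK: "finite K" unfolding K_def H_def by (rule finite_subset[of _ "Pow {..<s}"]) auto
  have cardK: "card K \<le> 2 ^ s"
  proof -
    have "card K \<le> card (Pow {..<s})" unfolding K_def H_def by (intro card_mono) auto
    then show ?thesis by (simp add: card_Pow)
  qed
  have V_sets: "V J \<in> sets S" and V_le: "emeasure S (V J) \<le> ennreal (exp (- t) ^ (s - 2 * c))" if "J \<in> K" for J
  proof -
    have J: "J \<subseteq> {..<s}" "card J = s - 2 * c" using that unfolding K_def H_def by auto
    have nn: "(\<integral>\<^sup>+y. ennreal (exp (score (\<not> \<theta>) y)) \<partial>law \<theta>) \<le> 1"
      using nn_integral_exp_score[of \<theta>] by (simp add: score_not)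
    have m: "score (\<not> \<theta>) \<in> borel_measurable (law \<theta>)" by measurable
    show "V J \<in> sets S" "emeasure S (V J) \<le> ennreal (exp (- t) ^ (s - 2 * c))"
      unfolding V_def S_def obs_law_eq
      using joint_crossing_bound[OF prob_law finite_lessThan m nn J(1), of t] by (simp_all add: J(2))
  qed
  define U where "U = (\<Union>J\<in>K. V J)"
  have U_sets: "U \<in> sets S" unfolding U_def using finK V_sets by (intro sets.finite_UN) auto
  have U_le: "emeasure S U \<le> ennreal (2 ^ s * exp (- t) ^ (s - 2 * c))"
  proof -
    have "emeasure S U \<le> (\<Sum>J\<in>K. emeasure S (V J))"
      unfolding U_def using finK V_sets by (intro emeasure_subadditive_finite) auto
    also have "\<dots> \<le> (\<Sum>J\<in>K. ennreal (exp (- t) ^ (s - 2 * c)))" by (intro sum_mono V_le)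
    also have "\<dots> = ennreal (real (card K) * exp (- t) ^ (s - 2 * c))"
      by (simp add: ennreal_mult ennreal_of_nat_eq_real_of_nat)
    also have "\<dots> \<le> ennreal (2 ^ s * exp (- t) ^ (s - 2 * c))"
    proof (intro ennreal_leI mult_right_mono)
      show "real (card K) \<le> 2 ^ s" using cardK by (metis of_nat_le_iff of_nat_numeral of_nat_power)
    qed simp
    finally show ?thesis .
  qed
  have mem_U: "x \<in> U" if x: "x \<in> space S" and dec: "decides ?d (manip s A \<theta> x \<omega>) v (\<not> \<theta>)" for x \<omega> v
  proof -
    obtain k where k: "quorum s (s - c) (\<not> \<theta>) t (manip s A \<theta> x \<omega>) k" using decides_voting_rule[OF dec] by auto
    define Q where "Q = {i. i < s \<and> crossed (\<not> \<theta>) t (manip s A \<theta> x \<omega>) i k}"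
    have finC: "finite (C \<theta>)" using C(1) finite_subset by auto
    have "s - 2 * c \<le> card Q - card (C \<theta>)" using k C(2) unfolding quorum_def Q_def by simp
    also have "\<dots> \<le> card (Q - C \<theta>)" by (rule diff_card_le_card_Diff[OF finC])
    finally obtain J where J: "J \<subseteq> Q - C \<theta>" "card J = s - 2 * c" by (rule obtain_subset_with_card_n)
    have "J \<in> K" using J unfolding K_def H_def Q_def by auto
    moreover have "x \<in> V J"
    proof -
      have "\<exists>k. t \<le> (\<Sum>j\<le>k. score (\<not> \<theta>) (x j i))" if i: "i \<in> J" for i
      proof -
        have i': "i < s" "i \<notin> C \<theta>" "crossed (\<not> \<theta>) t (manip s A \<theta> x \<omega>) i k" using i J unfolding Q_def by auto
        then have "crossed (\<not> \<theta>) t x i k" using crossed_manip_honest[OF adm i'(1,2)] by simp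
        then show ?thesis unfolding crossed_def by auto
      qed
      then show ?thesis unfolding V_def using x by auto
    qed
    ultimately show ?thesis unfolding U_def by auto
  qed
  let ?E = "{p \<in> space ?base. decides ?d (manip s A \<theta> (fst (fst p)) (snd (fst p))) (snd p) (\<not> \<theta>)}"
  let ?F = "{p \<in> space ?base. fst (fst p) \<in> U}"
  have [measurable]: "(\<lambda>p. fst (fst p)) \<in> measurable ?base S" unfolding base_measure_def S_def by measurable
  have F_sets: "?F \<in> sets ?base" using U_sets by measurable
  \<comment> \<open>From here on the estimate no longer involves the attack.\<close>
  have "emeasure ?base ?E \<le> emeasure ?base ?F"
    using F_sets mem_U by (intro emeasure_mono) (auto simp: base_measure_def S_def space_pair_measure)
  also have "\<dots> = (\<integral>\<^sup>+p. indicator U (fst (fst p)) \<partial>?base)"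
    by (subst nn_integral_indicator[OF F_sets, symmetric]) (rule nn_integral_cong, simp add: indicator_def)
  also have "\<dots> = emeasure S U"
    using nn_integral_base_measure_fst[OF R coin, of "indicator U"] U_sets by (simp add: S_def)
  also have "\<dots> \<le> ennreal (2 ^ s * exp (- t) ^ (s - 2 * c))" by (rule U_le)
  finally show ?thesis unfolding err_prob_def measure_def by (intro enn2real_leI) auto
qed

text \<open>There are exactly \<open>s - c\<close> honest sensors, so once all of them have crossed
  in the correct direction the quorum is complete, whatever the attacker does. The constant
  \<open>B\<close> depends on \<open>\<kappa>\<close> but not on \<open>t\<close>.\<close>

lemma attack_delay_bound:
  assumes adm: "admissible_attack s c \<mu> \<nu> C R A" and sc: "2 * c < s" and \<kappa>: "0 < \<kappa>" "\<kappa> < info \<theta>"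
  shows "\<exists>B\<ge>0. \<forall>t>0. exp_time s \<mu> \<nu> fair_coin (voting_rule s (s - c) \<mu> \<nu> t) R A \<theta> \<le> ennreal (t / \<kappa> + B)"
proof -
  define H where "H = {..<s} - C \<theta>"
  have R: "prob_space R" and C: "C \<theta> \<subseteq> {..<s}" "card (C \<theta>) = c" using adm by (auto simp: admissible_attack_def)
  have coin: "prob_space fair_coin" unfolding fair_coin_def by (rule measure_pmf.prob_space_axioms)
  have H: "H \<subseteq> {..<s}" "finite H" unfolding H_def by auto
  have cardH: "card H = s - c" unfolding H_def using C by (simp add: card_Diff_subset finite_subset)
  then have Hne: "H \<noteq> {}" using sc by auto
  obtain r where r: "0 < r" "integrable (law \<theta>) (\<lambda>y. exp (- r * score \<theta> y))"
    "r * \<kappa> < 1 - (\<integral>y. exp (- r * score \<theta> y) \<partial>law \<theta>)"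
    using chernoff_rate[OF prob_law score_integrable exp_score_integrable, of \<kappa> \<theta>] \<kappa> by (auto simp: integral_score)
  define \<rho> where "\<rho> = (\<integral>y. exp (- r * score \<theta> y) \<partial>law \<theta>)"
  have r\<kappa>: "r * \<kappa> < 1 - \<rho>" using r(3) unfolding \<rho>_def .
  then have \<rho>1: "0 < 1 - \<rho>" using r(1) \<kappa>(1) by (smt (verit) mult_pos_pos)
  define B where "B = 1 + card H / (1 - \<rho>)"
  have "exp_time s \<mu> \<nu> fair_coin (voting_rule s (s - c) \<mu> \<nu> t) R A \<theta> \<le> ennreal (t / \<kappa> + B)" if t: "t > 0" for t
  proof -
    let ?E = "\<lambda>n. {x. \<exists>i\<in>H. \<forall>k<n. (\<Sum>j\<le>k. score \<theta> (x j i)) < t}"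
    let ?G = "\<lambda>x. \<Sum>n. indicator (?E n) x :: ennreal"
    have run: "run_time (voting_rule s (s - c) \<mu> \<nu> t) (manip s A \<theta> x \<omega>) v \<le> ?G x" for x \<omega> v
    proof (cases "\<exists>n. x \<notin> ?E n")
      case True
      define n where "n = (LEAST n. x \<notin> ?E n)"
      have n: "x \<notin> ?E n" unfolding n_def using True by (rule LeastI_ex)
      have below: "x \<in> ?E m" if "m < n" for m
        using not_less_Least[of m "\<lambda>n. x \<notin> ?E n"] that unfolding n_def by blast
      have "n \<noteq> 0" using n Hne by auto
      then obtain k where k: "n = Suc k" by (cases n) auto
      have "crossed \<theta> t (manip s A \<theta> x \<omega>) i k" if i: "i \<in> H" for i
      proof -
        have "crossed \<theta> t x i k" using n i unfolding k crossed_def by (force simp: less_Suc_eq_le not_less)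
        then show ?thesis using i crossed_manip_honest[OF adm, of i \<theta>] unfolding H_def by auto
      qed
      then have "H \<subseteq> {i. i < s \<and> crossed \<theta> t (manip s A \<theta> x \<omega>) i k}" using H by auto
      then have "card H \<le> card {i. i < s \<and> crossed \<theta> t (manip s A \<theta> x \<omega>) i k}" by (intro card_mono) auto
      then have "quorum s (s - c) \<theta> t (manip s A \<theta> x \<omega>) k" unfolding quorum_def cardH .
      then have "run_time (voting_rule s (s - c) \<mu> \<nu> t) (manip s A \<theta> x \<omega>) v \<le> of_nat n"
        unfolding k by (rule run_time_voting_rule)
      also have "of_nat n = (\<Sum>m<n. indicator (?E m) x :: ennreal)" using below by (simp add: indicator_def)
      also have "\<dots> \<le> ?G x" by (intro sum_le_suminf) auto
      finally show ?thesis .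
    next
      \<comment> \<open>Some honest sensor never crosses; the bound then holds because
        \<open>?G x\<close> is infinite.\<close>
      case False
      have "?G x = \<top>"
      proof (rule ccontr)
        assume "?G x \<noteq> \<top>"
        then obtain m where m: "?G x < of_nat m" using ennreal_Ex_less_of_nat[of "?G x"] by (auto simp: less_top)
        have "of_nat m = (\<Sum>n<m. indicator (?E n) x :: ennreal)" using False by (simp add: indicator_def)
        also have "\<dots> \<le> ?G x" by (intro sum_le_suminf) auto
        finally show False using m by simp
      qed
      then show ?thesis by simp
    qed
    have m: "score \<theta> \<in> borel_measurable (law \<theta>)" by measurable
    note passage = expected_passage_bound[OF prob_law H m r(1,2) t, folded obs_law_eq \<rho>_def]
    have "exp_time s \<mu> \<nu> fair_coin (voting_rule s (s - c) \<mu> \<nu> t) R A \<theta> \<le>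
        (\<integral>\<^sup>+p. ?G (fst (fst p)) \<partial>base_measure s \<mu> \<nu> R fair_coin \<theta>)"
      unfolding exp_time_def by (intro nn_integral_mono run)
    also have "\<dots> = (\<integral>\<^sup>+x. ?G x \<partial>obs_law s \<mu> \<nu> \<theta>)"
      using \<rho>1 by (intro nn_integral_base_measure_fst[OF R coin] passage(1)) simp
    also have "\<dots> \<le> ennreal (r * t / (1 - \<rho>) + B)"
      unfolding B_def using \<rho>1 by (intro passage(2)) simp
    also have "\<dots> \<le> ennreal (t / \<kappa> + B)"
    proof (intro ennreal_leI add_right_mono)
      have "r * \<kappa> * t \<le> (1 - \<rho>) * t" using r\<kappa> t by (intro mult_right_mono) auto
      then show "r * t / (1 - \<rho>) \<le> t / \<kappa>" using \<rho>1 \<kappa>(1) by (simp add: field_simps)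
    qed
    finally show ?thesis .
  qed
  moreover have "0 \<le> B" unfolding B_def using \<rho>1 by simp
  ultimately show ?thesis by auto
qed

end

section \<open>The flip attack\<close>

context sensor_pair
begin

text \<open>The pair holds a draw from \<open>\<mu>\<close> and one from \<open>\<nu>\<close>; the
  selected component follows the law of the opposite state.\<close>

definition fake :: "bool \<Rightarrow> real \<times> real \<Rightarrow> real" where
  "fake \<theta> w = (if \<theta> then snd w else fst w)"

definition flip_law :: "nat \<Rightarrow> nat \<Rightarrow> bool \<Rightarrow> nat \<Rightarrow> real measure" where
  "flip_law s c \<theta> i = (if i \<in> flip_C s c \<theta> then law (\<not> \<theta>) else law \<theta>)"

lemma fake_measurable[measurable]: "fake \<theta> \<in> borel_measurable (\<mu> \<Otimes>\<^sub>M \<nu>)"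
  unfolding fake_def[abs_def] by measurable

lemma prob_pair: "prob_space (\<mu> \<Otimes>\<^sub>M \<nu>)"
  by (rule prob_space_pair[OF prob_mu prob_nu])

lemma distr_fake: "distr (law \<theta> \<Otimes>\<^sub>M (\<mu> \<Otimes>\<^sub>M \<nu>)) borel (\<lambda>p. fake \<theta> (snd p)) = law (\<not> \<theta>)"
proof (rule measure_eqI)
  interpret m: prob_space \<mu> by (rule prob_mu)
  interpret n: prob_space \<nu> by (rule prob_nu)
  interpret l: prob_space "law \<theta>" by (rule prob_law)
  interpret mn: prob_space "\<mu> \<Otimes>\<^sub>M \<nu>" by (rule prob_pair)
  show "sets (distr (law \<theta> \<Otimes>\<^sub>M (\<mu> \<Otimes>\<^sub>M \<nu>)) borel (\<lambda>p. fake \<theta> (snd p))) = sets (law (\<not> \<theta>))"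
    by (simp add: sets_law)
  fix X assume "X \<in> sets (distr (law \<theta> \<Otimes>\<^sub>M (\<mu> \<Otimes>\<^sub>M \<nu>)) borel (\<lambda>p. fake \<theta> (snd p)))"
  then have X: "X \<in> sets \<mu>" "X \<in> sets \<nu>" "X \<in> sets borel" by (auto simp: sets_mu sets_nu)
  let ?Y = "if \<theta> then space \<mu> \<times> X else X \<times> space \<nu>"
  have sp: "space \<mu> = UNIV" "space \<nu> = UNIV" using sets_eq_imp_space_eq[OF sets_mu] sets_eq_imp_space_eq[OF sets_nu] by auto
  have Y: "?Y \<in> sets (\<mu> \<Otimes>\<^sub>M \<nu>)" using X by auto
  have "emeasure (distr (law \<theta> \<Otimes>\<^sub>M (\<mu> \<Otimes>\<^sub>M \<nu>)) borel (\<lambda>p. fake \<theta> (snd p))) X =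
      emeasure (law \<theta> \<Otimes>\<^sub>M (\<mu> \<Otimes>\<^sub>M \<nu>)) ((\<lambda>p. fake \<theta> (snd p)) -` X \<inter> space (law \<theta> \<Otimes>\<^sub>M (\<mu> \<Otimes>\<^sub>M \<nu>)))"
    using X by (intro emeasure_distr) auto
  also have "(\<lambda>p. fake \<theta> (snd p)) -` X \<inter> space (law \<theta> \<Otimes>\<^sub>M (\<mu> \<Otimes>\<^sub>M \<nu>)) = space (law \<theta>) \<times> ?Y"
    by (auto simp: fake_def space_pair_measure sp split: if_splits)
  also have "emeasure (law \<theta> \<Otimes>\<^sub>M (\<mu> \<Otimes>\<^sub>M \<nu>)) (space (law \<theta>) \<times> ?Y) = emeasure (\<mu> \<Otimes>\<^sub>M \<nu>) ?Y"
    by (subst mn.emeasure_pair_measure_Times[OF _ Y]) (auto simp: l.emeasure_space_1)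
  also have "\<dots> = emeasure (law (\<not> \<theta>)) X"
    using X by (auto simp: law_def n.emeasure_pair_measure_Times m.emeasure_space_1 n.emeasure_space_1)
  finally show "emeasure (distr (law \<theta> \<Otimes>\<^sub>M (\<mu> \<Otimes>\<^sub>M \<nu>)) borel (\<lambda>p. fake \<theta> (snd p))) X = emeasure (law (\<not> \<theta>)) X" .
qed

lemma distr_genuine: "distr (law \<theta> \<Otimes>\<^sub>M (\<mu> \<Otimes>\<^sub>M \<nu>)) borel fst = law \<theta>"
proof -
  have "distr (law \<theta> \<Otimes>\<^sub>M (\<mu> \<Otimes>\<^sub>M \<nu>)) borel fst = distr (law \<theta> \<Otimes>\<^sub>M (\<mu> \<Otimes>\<^sub>M \<nu>)) (law \<theta>) fst"
    by (rule distr_cong) (auto simp: sets_law)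
  then show ?thesis using prob_space.distr_pair_fst[OF prob_pair] by simp
qed

lemma flip_step_law:
  "distr (PiM {..<s} (\<lambda>_. law \<theta>) \<Otimes>\<^sub>M PiM {..<s} (\<lambda>_. \<mu> \<Otimes>\<^sub>M \<nu>)) (PiM {..<s} (\<lambda>_. borel))
    (\<lambda>p. \<lambda>i\<in>{..<s}. if i \<in> flip_C s c \<theta> then fake \<theta> (snd p i) else fst p i) = PiM {..<s} (flip_law s c \<theta>)"
proof -
  have meas: "(\<lambda>(x, w). if i \<in> flip_C s c \<theta> then fake \<theta> w else x) \<in> measurable (law \<theta> \<Otimes>\<^sub>M (\<mu> \<Otimes>\<^sub>M \<nu>)) borel" for i
    by (cases "i \<in> flip_C s c \<theta>") (simp_all add: split_beta')
  have "distr (PiM {..<s} (\<lambda>_. law \<theta>) \<Otimes>\<^sub>M PiM {..<s} (\<lambda>_. \<mu> \<Otimes>\<^sub>M \<nu>)) (PiM {..<s} (\<lambda>_. borel))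
    (\<lambda>p. \<lambda>i\<in>{..<s}. if i \<in> flip_C s c \<theta> then fake \<theta> (snd p i) else fst p i) =
    PiM {..<s} (\<lambda>i. distr (law \<theta> \<Otimes>\<^sub>M (\<mu> \<Otimes>\<^sub>M \<nu>)) borel (\<lambda>(x, w). if i \<in> flip_C s c \<theta> then fake \<theta> w else x))"
    by (rule distr_PiM_pair_coordinatewise[where g="\<lambda>i x w. if i \<in> flip_C s c \<theta> then fake \<theta> w else x"])
       (auto simp: prob_law prob_pair meas)
  also have "\<dots> = PiM {..<s} (flip_law s c \<theta>)"
  proof (rule PiM_cong[OF refl])
    fix i
    show "distr (law \<theta> \<Otimes>\<^sub>M (\<mu> \<Otimes>\<^sub>M \<nu>)) borel (\<lambda>(x, w). if i \<in> flip_C s c \<theta> then fake \<theta> w else x) = flip_law s c \<theta> i"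
      using distr_fake[of \<theta>] distr_genuine[of \<theta>]
      by (cases "i \<in> flip_C s c \<theta>") (simp_all add: flip_law_def split_beta' fst_def[symmetric])
  qed
  finally show ?thesis .
qed

lemma manip_flip:
  assumes "c \<le> s"
  shows "manip s (flip_attack s c) \<theta> x \<omega> =
    (\<lambda>k. \<lambda>i\<in>{..<s}. if i \<in> flip_C s c \<theta> then fake \<theta> (\<omega> k i) else x k i)"
  using assms by (auto simp: manip_def flip_attack_def flip_C_def fake_def fun_eq_iff)

text \<open>Forged entries are fresh independent draws, so the received observations remain
  independent over sensors and identically distributed over times. This product form is what allows
  \<open>stopped_information_bound\<close> to be applied to them.\<close>

lemma flip_observation_law:
  assumes "c \<le> s"
  shows "distr (obs_law s \<mu> \<nu> \<theta> \<Otimes>\<^sub>M flip_rand s \<mu> \<nu>) (obs_space s) (\<lambda>q. manip s (flip_attack s c) \<theta> (fst q) (snd q)) =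
    PiM UNIV (\<lambda>_. PiM {..<s} (flip_law s c \<theta>))"
    and "(\<lambda>q. manip s (flip_attack s c) \<theta> (fst q) (snd q)) \<in>
      measurable (obs_law s \<mu> \<nu> \<theta> \<Otimes>\<^sub>M flip_rand s \<mu> \<nu>) (obs_space s)"
proof -
  let ?g = "\<lambda>x w. \<lambda>i\<in>{..<s}. if i \<in> flip_C s c \<theta> then fake \<theta> (w i) else x i"
  let ?A = "PiM {..<s} (\<lambda>_. law \<theta>)" and ?B = "PiM {..<s} (\<lambda>_. \<mu> \<Otimes>\<^sub>M \<nu>)" and ?Q = "PiM {..<s} (\<lambda>_. borel :: real measure)"
  have comp: "(\<lambda>(x, w). if i \<in> flip_C s c \<theta> then fake \<theta> (w i) else x i) \<in> borel_measurable (?A \<Otimes>\<^sub>M ?B)" if "i \<in> {..<s}" for i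
    using that by (cases "i \<in> flip_C s c \<theta>") (simp_all add: split_beta')
  have g: "(\<lambda>(x, w). ?g x w) \<in> measurable (?A \<Otimes>\<^sub>M ?B) ?Q"
    using comp by (auto simp: split_beta' intro!: measurable_restrict)
  have "distr (PiM UNIV (\<lambda>_::nat. ?A) \<Otimes>\<^sub>M PiM UNIV (\<lambda>_::nat. ?B)) (PiM UNIV (\<lambda>_. ?Q)) (\<lambda>p. \<lambda>k\<in>UNIV. ?g (fst p k) (snd p k)) =
      PiM UNIV (\<lambda>_::nat. distr (?A \<Otimes>\<^sub>M ?B) ?Q (\<lambda>(x, w). ?g x w))"
    by (rule distr_PiM_pair_coordinatewise[where g="\<lambda>_ x w. ?g x w", OF _ _ g]) (auto intro!: prob_space_PiM prob_law prob_pair)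
  also have "distr (?A \<Otimes>\<^sub>M ?B) ?Q (\<lambda>(x, w). ?g x w) = PiM {..<s} (flip_law s c \<theta>)"
    using flip_step_law[of s \<theta> c] by (simp add: split_beta')
  finally show "distr (obs_law s \<mu> \<nu> \<theta> \<Otimes>\<^sub>M flip_rand s \<mu> \<nu>) (obs_space s) (\<lambda>q. manip s (flip_attack s c) \<theta> (fst q) (snd q)) =
    PiM UNIV (\<lambda>_. PiM {..<s} (flip_law s c \<theta>))"
    unfolding obs_law_eq flip_rand_def obs_space_def manip_flip[OF assms] restrict_UNIV .
  have pk: "(\<lambda>p. (fst p k, snd p k)) \<in> measurable (PiM UNIV (\<lambda>_::nat. ?A) \<Otimes>\<^sub>M PiM UNIV (\<lambda>_::nat. ?B)) (?A \<Otimes>\<^sub>M ?B)" for k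
    by (intro measurable_Pair measurable_compose[OF measurable_fst] measurable_compose[OF measurable_snd]) auto
  have "(\<lambda>p. \<lambda>k\<in>UNIV. ?g (fst p k) (snd p k)) \<in> measurable (PiM UNIV (\<lambda>_::nat. ?A) \<Otimes>\<^sub>M PiM UNIV (\<lambda>_::nat. ?B)) (PiM UNIV (\<lambda>_. ?Q))"
    by (rule measurable_restrict) (use measurable_compose[OF pk g] in simp)
  then show "(\<lambda>q. manip s (flip_attack s c) \<theta> (fst q) (snd q)) \<in>
      measurable (obs_law s \<mu> \<nu> \<theta> \<Otimes>\<^sub>M flip_rand s \<mu> \<nu>) (obs_space s)"
    unfolding obs_law_eq flip_rand_def obs_space_def manip_flip[OF assms] restrict_UNIV .
qed

text \<open>If the forged and the genuine observation agreed almost surely, the mean of the score would be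
  both positive and negative.\<close>
lemma fake_genuine_differ:
  "emeasure (law \<theta> \<Otimes>\<^sub>M (\<mu> \<Otimes>\<^sub>M \<nu>)) {p \<in> space (law \<theta> \<Otimes>\<^sub>M (\<mu> \<Otimes>\<^sub>M \<nu>)). fake \<theta> (snd p) = fst p} \<noteq> 1"
proof
  let ?P = "law \<theta> \<Otimes>\<^sub>M (\<mu> \<Otimes>\<^sub>M \<nu>)"
  assume 1: "emeasure ?P {p \<in> space ?P. fake \<theta> (snd p) = fst p} = 1"
  interpret l: prob_space "law \<theta>" by (rule prob_law)
  interpret mn: prob_space "\<mu> \<Otimes>\<^sub>M \<nu>" by (rule prob_pair)
  interpret pr: pair_prob_space "law \<theta>" "\<mu> \<Otimes>\<^sub>M \<nu>" ..
  have "AE p in ?P. p \<in> {p \<in> space ?P. fake \<theta> (snd p) = fst p}"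
    by (rule pr.AE_prob_1) (use 1 in \<open>simp add: measure_def\<close>)
  then have ae: "AE p in ?P. score \<theta> (fake \<theta> (snd p)) = score \<theta> (fst p)" by eventually_elim auto
  have "info \<theta> = (\<integral>y. score \<theta> y \<partial>distr ?P borel fst)" by (simp add: distr_genuine integral_score)
  also have "\<dots> = (\<integral>p. score \<theta> (fst p) \<partial>?P)" by (rule integral_distr) measurable
  also have "\<dots> = (\<integral>p. score \<theta> (fake \<theta> (snd p)) \<partial>?P)"
    using ae by (intro integral_cong_AE) (auto elim: eventually_mono)
  also have "\<dots> = (\<integral>y. score \<theta> y \<partial>distr ?P borel (\<lambda>p. fake \<theta> (snd p)))" by (rule integral_distr[symmetric]) measurable
  also have "\<dots> = - info (\<not> \<theta>)"
    using integral_score[of "\<not> \<theta>"] by (simp add: distr_fake score_not)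
  finally show False using info_pos[of \<theta>] info_pos[of "\<not> \<theta>"] by simp
qed

text \<open>The delicate clause is the support: an injection is 0 whenever the forged and the
  genuine values coincide. This has probability below 1 at each time, independently over times, so
  it almost surely does not happen forever.\<close>

lemma admissible_flip_attack:
  assumes "c \<le> s"
  shows "admissible_attack s c \<mu> \<nu> (flip_C s c) (flip_rand s \<mu> \<nu>) (flip_attack s c)"
  unfolding admissible_attack_def
proof (intro conjI allI impI)
  show "prob_space (flip_rand s \<mu> \<nu>)" unfolding flip_rand_def by (intro prob_space_PiM prob_pair)
  fix \<theta>
  show C: "flip_C s c \<theta> \<subseteq> {..<s}" "card (flip_C s c \<theta>) = c" using assms by (auto simp: flip_C_def)
  have att: "flip_attack s c \<theta> x \<omega> k i = (if i \<in> flip_C s c \<theta> then fake \<theta> (\<omega> k i) - x k i else 0)" for x \<omega> k i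
    using assms by (auto simp: flip_attack_def flip_C_def fake_def)
  show "(\<lambda>(x, \<omega>). flip_attack s c \<theta> x \<omega> k i) \<in> borel_measurable (obs_space s \<Otimes>\<^sub>M flip_rand s \<mu> \<nu>)" for k i
  proof (cases "i \<in> flip_C s c \<theta>")
    case True
    then have i: "i \<in> {..<s}" using C by auto
    have [measurable]: "(\<lambda>x. x k i) \<in> borel_measurable (obs_space s)"
      unfolding obs_space_def using i by (intro measurable_PiM_PiM_component[where f="\<lambda>z. z"]) auto
    have [measurable]: "(\<lambda>w. fake \<theta> (w k i)) \<in> borel_measurable (flip_rand s \<mu> \<nu>)"
      unfolding flip_rand_def using i by (intro measurable_PiM_PiM_component) auto
    show ?thesis unfolding att using True by (simp add: split_beta')
  qed (simp add: att)
  show "flip_attack s c \<theta> x \<omega> k = flip_attack s c \<theta> y \<omega> k"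
    if "\<forall>j\<le>k. \<forall>i\<in>flip_C s c \<theta>. x j i = y j i" for k x y \<omega>
    using that by (auto simp: att fun_eq_iff)
  show "flip_attack s c \<theta> x \<omega> k i = 0" if "i \<notin> flip_C s c \<theta>" for k x \<omega> i
    using that by (simp add: att)
  let ?P = "obs_law s \<mu> \<nu> \<theta> \<Otimes>\<^sub>M flip_rand s \<mu> \<nu>"
  have "AE p in ?P. \<exists>k. flip_attack s c \<theta> (fst p) (snd p) k i \<noteq> 0" if iC: "i \<in> flip_C s c \<theta>" for i
  proof -
    have i: "i \<in> {..<s}" using C iC by auto
    let ?A = "PiM {..<s} (\<lambda>_. law \<theta>)" and ?B = "PiM {..<s} (\<lambda>_. \<mu> \<Otimes>\<^sub>M \<nu>)"
    let ?L = "law \<theta> \<Otimes>\<^sub>M (\<mu> \<Otimes>\<^sub>M \<nu>)"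
    define h :: "real \<Rightarrow> real \<times> real \<Rightarrow> ennreal" where "h y w = (if fake \<theta> w = y then 1 else 0)" for y w
    have h_meas: "(\<lambda>(y, w). h y w) \<in> borel_measurable ?L" unfolding h_def by measurable
    define q where "q = (\<integral>\<^sup>+p. h (fst p) (snd p) \<partial>?L)"
    have q: "q = emeasure ?L {p \<in> space ?L. fake \<theta> (snd p) = fst p}"
    proof -
      have "{p \<in> space ?L. fake \<theta> (snd p) = fst p} \<in> sets ?L" by measurable
      from nn_integral_indicator[OF this] show ?thesis
        unfolding q_def h_def by (simp add: indicator_def of_bool_def cong: nn_integral_cong)
    qed
    interpret l: prob_space "law \<theta>" by (rule prob_law)
    interpret mn: prob_space "\<mu> \<Otimes>\<^sub>M \<nu>" by (rule prob_pair)
    interpret pr: pair_prob_space "law \<theta>" "\<mu> \<Otimes>\<^sub>M \<nu>" ..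
    have q1: "q < 1" using fake_genuine_differ[of \<theta>] pr.emeasure_le_1 unfolding q by (simp add: less_le)
    then obtain q' where q': "q = ennreal q'" "0 \<le> q'" "q' < 1" by (cases q) auto
    have one: "(\<integral>\<^sup>+p. h (fst p i) (snd p i) \<partial>(?A \<Otimes>\<^sub>M ?B)) = q"
      using nn_integral_PiM_pair_prod[of "{..<s}" "\<lambda>_. law \<theta>" "\<lambda>_. \<mu> \<Otimes>\<^sub>M \<nu>" "{i}" "\<lambda>_. h"] h_meas i prob_law prob_pair
      by (simp add: q_def)
    have hi: "(\<lambda>(y, w). h (y i) (w i)) \<in> borel_measurable (?A \<Otimes>\<^sub>M ?B)"
    proof -
      have "(\<lambda>p. (fst p i, snd p i)) \<in> measurable (?A \<Otimes>\<^sub>M ?B) ?L"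
        using i by (intro measurable_Pair measurable_compose[OF measurable_fst] measurable_compose[OF measurable_snd]) auto
      from measurable_compose[OF this h_meas] show ?thesis by (simp add: split_beta')
    qed
    have prods: "(\<integral>\<^sup>+p. (\<Prod>k<n. h (fst p k i) (snd p k i)) \<partial>?P) = q ^ n" for n
      unfolding obs_law_eq flip_rand_def
      by (subst nn_integral_PiM_pair_prod[where h="\<lambda>_ y w. h (y i) (w i)"])
         (auto intro!: prob_space_PiM prob_law prob_pair hi simp: one)
    let ?N = "{p \<in> space ?P. \<forall>k. fake \<theta> (snd p k i) = fst p k i}"
    have [measurable]: "(\<lambda>x. x k i) \<in> borel_measurable (obs_law s \<mu> \<nu> \<theta>)" for k
      unfolding obs_law_eq using i by (intro measurable_PiM_PiM_component[where f="\<lambda>z. z"]) auto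
    have [measurable]: "(\<lambda>w. fake \<theta> (w k i)) \<in> borel_measurable (flip_rand s \<mu> \<nu>)" for k
      unfolding flip_rand_def using i by (intro measurable_PiM_PiM_component) auto
    have N: "?N \<in> sets ?P" by measurable
    \<comment> \<open>Permanent agreement implies agreement at the first \<open>n\<close> times,
      whose probability is the \<open>n\<close>-th power of the one-step probability.\<close>
    have le: "emeasure ?P ?N \<le> ennreal (q' ^ n)" for n
    proof -
      have "emeasure ?P ?N = (\<integral>\<^sup>+p. indicator ?N p \<partial>?P)" using N by simp
      also have "\<dots> \<le> (\<integral>\<^sup>+p. (\<Prod>k<n. h (fst p k i) (snd p k i)) \<partial>?P)"
        by (intro nn_integral_mono) (auto simp: indicator_def h_def)
      also have "\<dots> = ennreal (q' ^ n)" by (simp add: prods q' ennreal_power)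
      finally show ?thesis .
    qed
    have "(\<lambda>n. q' ^ n) \<longlonglongrightarrow> 0" using q' by (intro LIMSEQ_power_zero) auto
    then have "(\<lambda>n. ennreal (q' ^ n)) \<longlonglongrightarrow> ennreal 0" by (rule tendsto_ennrealI)
    then have "emeasure ?P ?N \<le> ennreal 0" using le by (intro LIMSEQ_le_const) auto
    then have "?N \<in> null_sets ?P" using N by auto
    then have "AE p in ?P. p \<notin> ?N" by (rule AE_not_in)
    then show ?thesis using AE_space by eventually_elim (use iC in \<open>auto simp: att\<close>)
  qed
  then show "AE p in ?P. \<forall>i\<in>flip_C s c \<theta>. \<exists>k. flip_attack s c \<theta> (fst p) (snd p) k i \<noteq> 0"
    using C(1) by (intro AE_finite_allI) (auto intro: finite_subset)
qed


section \<open>Likelihood ratio between the two states under the flip attack\<close>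

definition flip_obs :: "nat \<Rightarrow> nat \<Rightarrow> bool \<Rightarrow> obs measure" where
  "flip_obs s c \<theta> = PiM UNIV (\<lambda>_. PiM {..<s} (flip_law s c \<theta>))"

text \<open>Only the sensors \<open>c \<le> i < s - c\<close> have different laws in the two states after the flip.\<close>
definition flip_score :: "nat \<Rightarrow> nat \<Rightarrow> bool \<Rightarrow> (nat \<Rightarrow> real) \<Rightarrow> real" where
  "flip_score s c \<theta> y = (\<Sum>i\<in>{c..<s - c}. score \<theta> (y i))"

lemma prob_flip_law: "prob_space (flip_law s c \<theta> i)" by (simp add: flip_law_def prob_law)

lemma sets_flip_law[measurable_cong]: "sets (flip_law s c \<theta> i) = sets borel"
  by (simp add: flip_law_def sets_law)

text \<open>Sensors below \<open>c\<close> follow \<open>\<mu>\<close> in both states, and those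
  from \<open>s - c\<close> on follow \<open>\<nu>\<close> in both. As \<open>2 * c < s\<close>
  these blocks are disjoint, and only the middle block contributes factors other than 1.\<close>

lemma flip_density:
  assumes sc: "2 * c < s"
  shows "PiM {..<s} (flip_law s c (\<not> \<theta>)) =
    density (PiM {..<s} (flip_law s c \<theta>)) (\<lambda>y. ennreal (exp (- flip_score s c \<theta> y)))"
proof -
  let ?f = "\<lambda>i y. if i \<in> {c..<s - c} then ennreal (exp (- score \<theta> y)) else 1"
  have "flip_law s c (\<not> \<theta>) i = density (flip_law s c \<theta> i) (?f i)" if "i < s" for i
    using that sc density_exp_score[of \<theta>] by (cases \<theta>) (auto simp: flip_law_def flip_C_def density_1)
  then have "PiM {..<s} (flip_law s c (\<not> \<theta>)) = density (PiM {..<s} (flip_law s c \<theta>)) (\<lambda>y. \<Prod>i<s. ?f i (y i))"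
    by (intro PiM_density[symmetric] prob_flip_law) (auto simp: measurable_cong_sets[OF sets_flip_law refl])
  also have "(\<lambda>y. \<Prod>i<s. ?f i (y i)) = (\<lambda>y. ennreal (exp (- flip_score s c \<theta> y)))"
  proof
    fix y :: "nat \<Rightarrow> real"
    have "(\<Prod>i<s. ?f i (y i)) = (\<Prod>i\<in>{c..<s - c}. ?f i (y i))"
      by (rule prod.mono_neutral_right) auto
    also have "\<dots> = ennreal (exp (- flip_score s c \<theta> y))"
      by (simp add: flip_score_def prod_ennreal exp_sum[symmetric] sum_negf)
    finally show "(\<Prod>i<s. ?f i (y i)) = ennreal (exp (- flip_score s c \<theta> y))" .
  qed
  finally show ?thesis .
qed

lemma flip_score_integral:
  assumes sc: "2 * c < s"
  shows "integrable (PiM {..<s} (flip_law s c \<theta>)) (flip_score s c \<theta>)"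
    and "(\<integral>y. flip_score s c \<theta> y \<partial>PiM {..<s} (flip_law s c \<theta>)) = (real s - 2 * real c) * info \<theta>"
proof -
  let ?M = "PiM {..<s} (flip_law s c \<theta>)"
  have D: "distr ?M (law \<theta>) (\<lambda>y. y i) = law \<theta>" and C: "(\<lambda>y. y i) \<in> measurable ?M (law \<theta>)" if i: "i \<in> {c..<s - c}" for i
  proof -
    have l: "flip_law s c \<theta> i = law \<theta>" using i sc by (auto simp: flip_law_def flip_C_def)
    have "i \<in> {..<s}" using i by auto
    then show "distr ?M (law \<theta>) (\<lambda>y. y i) = law \<theta>" "(\<lambda>y. y i) \<in> measurable ?M (law \<theta>)"
      using distr_PiM_component[of "{..<s}" "flip_law s c \<theta>" i] measurable_component_singleton[of i "{..<s}" "flip_law s c \<theta>"]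
      by (auto simp: l prob_flip_law)
  qed
  have int: "integrable ?M (\<lambda>y. score \<theta> (y i))" if "i \<in> {c..<s - c}" for i
    by (rule integrable_distr[OF C[OF that]]) (simp add: D[OF that] score_integrable)
  have val: "(\<integral>y. score \<theta> (y i) \<partial>?M) = info \<theta>" if "i \<in> {c..<s - c}" for i
    using integral_distr[OF C[OF that], of "score \<theta>"] by (simp add: D[OF that] integral_score)
  show "integrable ?M (flip_score s c \<theta>)" unfolding flip_score_def[abs_def] by (intro Bochner_Integration.integrable_sum int)
  have "(\<integral>y. flip_score s c \<theta> y \<partial>?M) = (\<Sum>i\<in>{c..<s - c}. info \<theta>)"
    unfolding flip_score_def by (subst Bochner_Integration.integral_sum) (auto simp: int val)
  also have "\<dots> = (real s - 2 * real c) * info \<theta>" using sc by (simp add: of_nat_diff)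
  finally show "(\<integral>y. flip_score s c \<theta> y \<partial>?M) = (real s - 2 * real c) * info \<theta>" .
qed

lemma prob_flip_obs: "prob_space (flip_obs s c \<theta>)"
  unfolding flip_obs_def by (intro prob_space_PiM prob_flip_law)

lemma sets_flip_obs[measurable_cong]: "sets (flip_obs s c \<theta>) = sets (obs_space s)"
  unfolding flip_obs_def obs_space_def by (intro sets_PiM_cong refl sets_flip_law)

text \<open>A test sees only the received observations and its own randomness, so its error and
  running time can be computed on the product of \<open>flip_obs s c \<theta>\<close> and
  \<open>Rd\<close>.\<close>

lemma flip_base_law:
  assumes "c \<le> s" and Rd: "prob_space Rd"
  shows "distr (base_measure s \<mu> \<nu> (flip_rand s \<mu> \<nu>) Rd \<theta>) (obs_space s \<Otimes>\<^sub>M Rd)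
      (\<lambda>p. (manip s (flip_attack s c) \<theta> (fst (fst p)) (snd (fst p)), snd p)) = flip_obs s c \<theta> \<Otimes>\<^sub>M Rd"
    and "(\<lambda>p. (manip s (flip_attack s c) \<theta> (fst (fst p)) (snd (fst p)), snd p)) \<in>
      measurable (base_measure s \<mu> \<nu> (flip_rand s \<mu> \<nu>) Rd \<theta>) (obs_space s \<Otimes>\<^sub>M Rd)"
proof -
  interpret Rd: prob_space Rd by (rule Rd)
  note m = flip_observation_law(2)[OF assms(1), of \<theta>]
  have "distr (obs_law s \<mu> \<nu> \<theta> \<Otimes>\<^sub>M flip_rand s \<mu> \<nu>) (obs_space s) (\<lambda>q. manip s (flip_attack s c) \<theta> (fst q) (snd q)) \<Otimes>\<^sub>M distr Rd Rd (\<lambda>v. v) =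
    distr ((obs_law s \<mu> \<nu> \<theta> \<Otimes>\<^sub>M flip_rand s \<mu> \<nu>) \<Otimes>\<^sub>M Rd) (obs_space s \<Otimes>\<^sub>M Rd)
      (\<lambda>(q, v). (manip s (flip_attack s c) \<theta> (fst q) (snd q), v))"
    by (rule pair_measure_distr[OF m]) (auto simp: distr_id Rd.sigma_finite_measure_axioms)
  then show "distr (base_measure s \<mu> \<nu> (flip_rand s \<mu> \<nu>) Rd \<theta>) (obs_space s \<Otimes>\<^sub>M Rd)
      (\<lambda>p. (manip s (flip_attack s c) \<theta> (fst (fst p)) (snd (fst p)), snd p)) = flip_obs s c \<theta> \<Otimes>\<^sub>M Rd"
    unfolding flip_observation_law(1)[OF assms(1)] base_measure_def flip_obs_def by (simp add: distr_id split_beta')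
  show "(\<lambda>p. (manip s (flip_attack s c) \<theta> (fst (fst p)) (snd (fst p)), snd p)) \<in>
      measurable (base_measure s \<mu> \<nu> (flip_rand s \<mu> \<nu>) Rd \<theta>) (obs_space s \<Otimes>\<^sub>M Rd)"
    unfolding base_measure_def by (intro measurable_Pair measurable_compose[OF measurable_fst m] measurable_snd)
qed

end

section \<open>Converse bound\<close>

definition decides_within :: "nat \<Rightarrow> (nat \<Rightarrow> obs \<Rightarrow> 'd \<Rightarrow> bool option) \<Rightarrow> obs \<Rightarrow> 'd \<Rightarrow> bool \<Rightarrow> bool" where
  "decides_within n d x v b \<longleftrightarrow> (\<exists>k<n. (\<forall>j<k. d j x v = None) \<and> d k x v = Some b)"

text \<open>\<open>min T n\<close>, written as the number of \<open>k < n\<close> with \<open>T > k\<close>.\<close>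
definition truncated_time :: "nat \<Rightarrow> (nat \<Rightarrow> obs \<Rightarrow> 'd \<Rightarrow> bool option) \<Rightarrow> obs \<Rightarrow> 'd \<Rightarrow> real" where
  "truncated_time n d x v = (\<Sum>k<n. of_bool (\<forall>j<k. d j x v = None))"

lemma decides_within_imp_decides: "decides_within n d x v b \<Longrightarrow> decides d x v b"
  by (auto simp: decides_within_def decides_def)

lemma truncated_time_bounds: "0 \<le> truncated_time n d x v" "truncated_time n d x v \<le> real n"
proof -
  show "0 \<le> truncated_time n d x v" unfolding truncated_time_def by (rule sum_nonneg) simp
  have "truncated_time n d x v \<le> (\<Sum>k<n. 1)" unfolding truncated_time_def by (rule sum_mono) simp
  then show "truncated_time n d x v \<le> real n" by simp
qed

lemma truncated_time_eq:
  assumes "\<And>b. \<not> decides_within n d x v b"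
  shows "truncated_time n d x v = real n"
proof -
  have none: "\<forall>j<k. d j x v = None" if "k \<le> n" for k
    using that
  proof (induction k)
    case (Suc k)
    then have *: "\<forall>j<k. d j x v = None" by simp
    have "d k x v \<noteq> Some b" for b using assms[of b] * Suc_le_lessD[OF Suc.prems] unfolding decides_within_def by blast
    then have "d k x v = None" by (cases "d k x v") auto
    with * show ?case by (auto simp: less_Suc_eq)
  qed simp
  have "truncated_time n d x v = (\<Sum>k<n. 1)" unfolding truncated_time_def
  proof (intro sum.cong refl)
    fix k assume "k \<in> {..<n}"
    then show "of_bool (\<forall>j<k. d j x v = None) = (1::real)" using none[of k] by simp
  qed
  then show ?thesis by simp
qed

lemma truncated_time_le_run_time: "ennreal (truncated_time n d x v) \<le> run_time d x v"
proof (cases "\<exists>k. d k x v \<noteq> None")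
  case True
  define m where "m = (LEAST k. d k x v \<noteq> None)"
  have m: "d m x v \<noteq> None" unfolding m_def using True by (rule LeastI_ex)
  have "truncated_time n d x v \<le> (\<Sum>k<n. of_bool (k \<in> {..m}))"
  proof -
    have "k \<le> m" if "\<forall>j<k. d j x v = None" for k using that m by (meson not_le)
    then show ?thesis unfolding truncated_time_def by (intro sum_mono) auto
  qed
  also have "\<dots> = real (card ({..<n} \<inter> {..m}))" by (simp add: of_bool_def sum.If_cases atMost_def)
  also have "\<dots> \<le> real (Suc m)"
  proof -
    have "card ({..<n} \<inter> {..m}) \<le> card {..m}" by (intro card_mono) auto
    then show ?thesis by simp
  qed
  finally have "ennreal (truncated_time n d x v) \<le> ennreal (real (Suc m))" by (rule ennreal_leI)
  then show ?thesis using True unfolding run_time_def m_def by (simp add: ennreal_of_nat_eq_real_of_nat)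
qed (simp add: run_time_def)

context sensor_pair
begin

text \<open>For a frozen \<open>v\<close> the test is deterministic and
  \<open>stopped_information_bound\<close> applies. With \<open>l\<close> fixed the inequality is
  affine in the two probabilities and the mean time, so it survives averaging over
  \<open>v\<close>.\<close>

lemma flip_converse_horizon:
  fixes d :: "nat \<Rightarrow> obs \<Rightarrow> 'd \<Rightarrow> bool option" and l :: real
  assumes sc: "2 * c < s" and adm: "admissible_test s Rd d"
  defines "Q \<equiv> \<lambda>\<theta>. flip_obs s c \<theta> \<Otimes>\<^sub>M Rd"
  shows "l * (\<integral>p. of_bool (decides_within n d (fst p) (snd p) \<theta>) \<partial>Q \<theta>) + 1 - ln 2
      - (1 + (\<integral>p. of_bool (decides_within n d (fst p) (snd p) \<theta>) \<partial>Q (\<not> \<theta>)) * (exp l - 1)) / 2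
    \<le> (real s - 2 * real c) * info \<theta> * (\<integral>p. truncated_time n d (fst p) (snd p) \<partial>Q \<theta>)"
proof -
  have Rd: "prob_space Rd" and d: "\<And>k. (\<lambda>(x, v). d k x v) \<in> measurable (obs_space s \<Otimes>\<^sub>M Rd) (count_space UNIV)"
    and dep: "\<And>k x y v. (\<forall>j\<le>k. x j = y j) \<Longrightarrow> d k x v = d k y v"
    using adm by (auto simp: admissible_test_def)
  interpret Rd: prob_space Rd by (rule Rd)
  let ?A = "\<lambda>p. of_bool (decides_within n d (fst p) (snd p) \<theta>) :: real"
  let ?T = "\<lambda>p. truncated_time n d (fst p) (snd p)"
  have d'[measurable]: "(\<lambda>p. d k (fst p) (snd p)) \<in> measurable (obs_space s \<Otimes>\<^sub>M Rd) (count_space UNIV)" for k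
    using d[of k] by (simp add: split_beta')
  have A_meas: "?A \<in> borel_measurable (flip_obs s c \<theta>' \<Otimes>\<^sub>M Rd)" for \<theta>'
    unfolding decides_within_def by measurable
  have T_meas: "?T \<in> borel_measurable (flip_obs s c \<theta>' \<Otimes>\<^sub>M Rd)" for \<theta>'
    unfolding truncated_time_def by measurable
  have Fub: "integrable Rd (\<lambda>v. \<integral>x. f (x, v) \<partial>flip_obs s c \<theta>')"
    "(\<integral>v. \<integral>x. f (x, v) \<partial>flip_obs s c \<theta>' \<partial>Rd) = (\<integral>p. f p \<partial>Q \<theta>')"
    if f: "f \<in> borel_measurable (flip_obs s c \<theta>' \<Otimes>\<^sub>M Rd)" and b: "\<And>p. \<bar>f p\<bar> \<le> B" for \<theta>' B and f :: "obs \<times> 'd \<Rightarrow> real"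
  proof -
    interpret F: prob_space "flip_obs s c \<theta>'" by (rule prob_flip_obs)
    interpret FR: pair_prob_space "flip_obs s c \<theta>'" Rd ..
    have int: "integrable (flip_obs s c \<theta>' \<Otimes>\<^sub>M Rd) (\<lambda>(x, v). f (x, v))"
      by (rule FR.P.integrable_const_bound[of _ B]) (use f b in auto)
    show "integrable Rd (\<lambda>v. \<integral>x. f (x, v) \<partial>flip_obs s c \<theta>')" by (rule FR.integrable_snd[OF int])
    show "(\<integral>v. \<integral>x. f (x, v) \<partial>flip_obs s c \<theta>' \<partial>Rd) = (\<integral>p. f p \<partial>Q \<theta>')"
      unfolding Q_def using FR.integral_snd[OF int] by simp
  qed
  note FubA = Fub[OF A_meas, of 1, simplified] and FubT = Fub[OF T_meas, of "real n", simplified]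
  have T_bound: "\<bar>truncated_time n d x v\<bar> \<le> real n" for x v
    using truncated_time_bounds[of n d x v] by simp
  let ?I = "(real s - 2 * real c) * info \<theta>"
  have pointwise: "l * (\<integral>x. ?A (x, v) \<partial>flip_obs s c \<theta>) + 1 - ln 2 - (1 + (\<integral>x. ?A (x, v) \<partial>flip_obs s c (\<not> \<theta>)) * (exp l - 1)) / 2
    \<le> ?I * (\<integral>x. ?T (x, v) \<partial>flip_obs s c \<theta>)" if v: "v \<in> space Rd" for v
  proof -
    have dv: "(\<lambda>x. d k x v) \<in> measurable (flip_obs s c \<theta>) (count_space UNIV)" for k
      using measurable_compose[OF measurable_Pair2'[OF v] d[of k]]
      by (simp add: measurable_cong_sets[OF sets_flip_obs refl])
    let ?W = "{x \<in> space (flip_obs s c \<theta>). decides_within n d x v \<theta>}"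
    have W: "?W \<in> sets (flip_obs s c \<theta>)" unfolding decides_within_def using dv by measurable
    have sp: "space (flip_obs s c \<theta>') = space (obs_space s)" for \<theta>' by (rule sets_eq_imp_space_eq[OF sets_flip_obs])
    have W_eq: "measure (flip_obs s c \<theta>') ?W = (\<integral>x. ?A (x, v) \<partial>flip_obs s c \<theta>')" for \<theta>'
    proof -
      interpret F: prob_space "flip_obs s c \<theta>'" by (rule prob_flip_obs)
      have W': "?W \<in> sets (flip_obs s c \<theta>')" using W by (simp add: sets_flip_obs)
      then have "measure (flip_obs s c \<theta>') ?W = (\<integral>x. indicator ?W x \<partial>flip_obs s c \<theta>')" by simp
      also have "\<dots> = (\<integral>x. ?A (x, v) \<partial>flip_obs s c \<theta>')"
        by (intro Bochner_Integration.integral_cong refl) (simp add: indicator_def sp)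
      finally show ?thesis .
    qed
    have dv': "(\<lambda>x. d k x v) \<in> measurable (PiM UNIV (\<lambda>_. PiM {..<s} (flip_law s c \<theta>))) (count_space UNIV)" for k
      using dv unfolding flip_obs_def .
    have "l * measure (flip_obs s c \<theta>) ?W + 1 - ln 2 - (1 + measure (flip_obs s c (\<not> \<theta>)) ?W * (exp l - 1)) / 2 \<le>
      (\<integral>y. flip_score s c \<theta> y \<partial>PiM {..<s} (flip_law s c \<theta>)) * (\<integral>x. (\<Sum>k<n. of_bool (\<forall>j<k. d j x v = None)) \<partial>flip_obs s c \<theta>)"
      unfolding flip_obs_def decides_within_def
      by (rule stopped_information_bound[OF _ _ flip_density[OF sc] flip_score_integral(1)[OF sc]])
         (auto intro!: prob_space_PiM prob_flip_law dv' dep)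
    then show ?thesis unfolding W_eq flip_score_integral(2)[OF sc] truncated_time_def by simp
  qed
  have "(\<integral>v. l * (\<integral>x. ?A (x, v) \<partial>flip_obs s c \<theta>) + 1 - ln 2 - (1 + (\<integral>x. ?A (x, v) \<partial>flip_obs s c (\<not> \<theta>)) * (exp l - 1)) / 2 \<partial>Rd)
    \<le> (\<integral>v. ?I * (\<integral>x. ?T (x, v) \<partial>flip_obs s c \<theta>) \<partial>Rd)"
    using FubA(1) FubT(1) T_bound pointwise by (intro integral_mono) auto
  then show ?thesis using FubA FubT T_bound by (simp add: Rd.prob_space)
qed

text \<open>Letting the horizon grow: undecided runs have probability at most \<open>D / n\<close>,
  so the correct decision within \<open>n\<close> steps has probability at least
  \<open>1 - e - D / n\<close>.\<close>

lemma flip_converse: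
  fixes d :: "nat \<Rightarrow> obs \<Rightarrow> 'd \<Rightarrow> bool option" and l :: real
  assumes sc: "2 * c < s" and adm: "admissible_test s Rd d" and l: "0 \<le> l"
  defines "e \<equiv> max_err s \<mu> \<nu> Rd d (flip_rand s \<mu> \<nu>) (flip_attack s c)"
    and "D \<equiv> delay s \<mu> \<nu> Rd d (flip_rand s \<mu> \<nu>) (flip_attack s c)"
  assumes D: "D < \<infinity>"
  shows "l * (1 - e) + 1 / 2 - ln 2 - e * exp l / 2 \<le> (real s - 2 * real c) * min (I0 \<mu> \<nu>) (I1 \<mu> \<nu>) * enn2real D"
proof -
  have Rd: "prob_space Rd" and d: "\<And>k. (\<lambda>(x, v). d k x v) \<in> measurable (obs_space s \<Otimes>\<^sub>M Rd) (count_space UNIV)"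
    using adm by (auto simp: admissible_test_def)
  have cs: "c \<le> s" using sc by simp
  define Q where "Q \<theta> = flip_obs s c \<theta> \<Otimes>\<^sub>M Rd" for \<theta>
  have d'[measurable]: "(\<lambda>p. d k (fst p) (snd p)) \<in> measurable (obs_space s \<Otimes>\<^sub>M Rd) (count_space UNIV)" for k
    using d[of k] by (simp add: split_beta')
  have Q_prob: "prob_space (Q \<theta>)" for \<theta> unfolding Q_def by (rule prob_space_pair[OF prob_flip_obs Rd])
  have Q_sets[measurable_cong]: "sets (Q \<theta>) = sets (obs_space s \<Otimes>\<^sub>M Rd)" for \<theta>
    unfolding Q_def by (rule sets_pair_measure_cong[OF sets_flip_obs refl])
  let ?A = "\<lambda>n \<theta> p. of_bool (decides_within n d (fst p) (snd p) \<theta>) :: real"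
  let ?E = "\<lambda>\<theta> p. of_bool (decides d (fst p) (snd p) \<theta>) :: real"
  let ?T = "\<lambda>n p. truncated_time n d (fst p) (snd p)"
  have [measurable]: "Measurable.pred (obs_space s \<Otimes>\<^sub>M Rd) (\<lambda>p. decides d (fst p) (snd p) \<theta>)" for \<theta>
    unfolding decides_def by measurable
  have [measurable]: "Measurable.pred (obs_space s \<Otimes>\<^sub>M Rd) (\<lambda>p. decides_within n d (fst p) (snd p) \<theta>)" for n \<theta>
    unfolding decides_within_def by measurable
  have [measurable]: "?T n \<in> borel_measurable (obs_space s \<Otimes>\<^sub>M Rd)" for n
    unfolding truncated_time_def by measurable
  have int: "integrable (Q \<theta>') (?A n \<theta>)" "integrable (Q \<theta>') (?E \<theta>)" "integrable (Q \<theta>') (?T n)" for n \<theta> \<theta>'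
  proof -
    interpret Q: prob_space "Q \<theta>'" by (rule Q_prob)
    show "integrable (Q \<theta>') (?A n \<theta>)" by (rule Q.integrable_const_bound[of _ 1]) auto
    show "integrable (Q \<theta>') (?E \<theta>)" by (rule Q.integrable_const_bound[of _ 1]) auto
    show "integrable (Q \<theta>') (?T n)"
      by (rule Q.integrable_const_bound[of _ "real n"]) (auto simp: truncated_time_bounds)
  qed
  let ?base = "base_measure s \<mu> \<nu> (flip_rand s \<mu> \<nu>) Rd"
  let ?m = "\<lambda>\<theta> p. (manip s (flip_attack s c) \<theta> (fst (fst p)) (snd (fst p)), snd p)"
  have dist: "Q \<theta> = distr (?base \<theta>) (obs_space s \<Otimes>\<^sub>M Rd) (?m \<theta>)" for \<theta>
    unfolding Q_def by (rule flip_base_law(1)[OF cs Rd, symmetric])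
  note mm = flip_base_law(2)[OF cs Rd]
  have err: "(\<integral>p. ?E (\<not> \<theta>) p \<partial>Q \<theta>) \<le> e" for \<theta>
  proof -
    interpret Q: prob_space "Q \<theta>" by (rule Q_prob)
    let ?W = "{p \<in> space (obs_space s \<Otimes>\<^sub>M Rd). decides d (fst p) (snd p) (\<not> \<theta>)}"
    have W: "?W \<in> sets (obs_space s \<Otimes>\<^sub>M Rd)" by measurable
    have sp: "space (Q \<theta>) = space (obs_space s \<Otimes>\<^sub>M Rd)" by (rule sets_eq_imp_space_eq[OF Q_sets])
    have "(\<integral>p. ?E (\<not> \<theta>) p \<partial>Q \<theta>) = (\<integral>p. indicator ?W p \<partial>Q \<theta>)"
      by (intro Bochner_Integration.integral_cong refl) (simp add: indicator_def sp)
    also have "\<dots> = measure (Q \<theta>) ?W" using W by (simp add: Q_sets)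
    also have "\<dots> = measure (?base \<theta>) (?m \<theta> -` ?W \<inter> space (?base \<theta>))"
      unfolding dist by (rule measure_distr[OF mm W])
    also have "?m \<theta> -` ?W \<inter> space (?base \<theta>) =
        {p \<in> space (?base \<theta>). decides d (manip s (flip_attack s c) \<theta> (fst (fst p)) (snd (fst p))) (snd p) (\<not> \<theta>)}"
      using measurable_space[OF mm[of \<theta>]] by auto
    also have "measure (?base \<theta>) \<dots> \<le> e" unfolding e_def max_err_def err_prob_def by (cases \<theta>) auto
    finally show ?thesis .
  qed
  have time: "(\<integral>p. ?T n p \<partial>Q \<theta>) \<le> enn2real D" for n \<theta>
  proof -
    have "ennreal (\<integral>p. ?T n p \<partial>Q \<theta>) = (\<integral>\<^sup>+p. ennreal (?T n p) \<partial>Q \<theta>)"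
      by (rule nn_integral_eq_integral[symmetric, OF int(3)]) (simp add: truncated_time_bounds)
    also have "\<dots> = (\<integral>\<^sup>+p. ennreal (?T n (?m \<theta> p)) \<partial>?base \<theta>)"
      unfolding dist by (rule nn_integral_distr[OF mm]) measurable
    also have "\<dots> \<le> exp_time s \<mu> \<nu> Rd d (flip_rand s \<mu> \<nu>) (flip_attack s c) \<theta>"
      unfolding exp_time_def by (intro nn_integral_mono) (simp add: truncated_time_le_run_time)
    also have "\<dots> \<le> D" unfolding D_def delay_def by (cases \<theta>) auto
    finally have "enn2real (ennreal (\<integral>p. ?T n p \<partial>Q \<theta>)) \<le> enn2real D" using D by (intro enn2real_mono) auto
    then show ?thesis by (simp add: integral_nonneg_AE truncated_time_bounds)
  qed
  have main: "l * (1 - e) + 1 / 2 - ln 2 - e * exp l / 2 \<le> (real s - 2 * real c) * info \<theta> * enn2real D" for \<theta>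
  proof -
    let ?I = "(real s - 2 * real c) * info \<theta>"
    have I0: "0 \<le> ?I" using sc info_pos[of \<theta>] by (intro mult_nonneg_nonneg) auto
    have step: "l * (1 - e - enn2real D / real (Suc n)) + 1 / 2 - ln 2 - e * exp l / 2 \<le> ?I * enn2real D" for n
    proof -
      interpret Q: prob_space "Q \<theta>" by (rule Q_prob)
      let ?n = "Suc n"
      \<comment> \<open>Within the horizon the decision is correct, or it is wrong, or
        \<open>min T n\<close> equals \<open>n\<close>. Integrating this contains Markov's
        inequality for the last case.\<close>
      have "1 \<le> ?A ?n \<theta> p + ?E (\<not> \<theta>) p + ?T ?n p / real ?n" for p
      proof (cases "\<exists>b. decides_within ?n d (fst p) (snd p) b")
        case True
        then obtain b where b: "decides_within ?n d (fst p) (snd p) b" by auto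
        have "0 \<le> ?T ?n p / real ?n" by (simp add: truncated_time_bounds)
        moreover have "1 \<le> ?A ?n \<theta> p + ?E (\<not> \<theta>) p"
          using b decides_within_imp_decides[OF b] by (cases "b = \<theta>") auto
        ultimately show ?thesis by linarith
      next
        case False
        then have "?T ?n p / real ?n = 1" by (simp add: truncated_time_eq)
        then show ?thesis by simp
      qed
      then have "(\<integral>p. 1 \<partial>Q \<theta>) \<le> (\<integral>p. ?A ?n \<theta> p + ?E (\<not> \<theta>) p + ?T ?n p / real ?n \<partial>Q \<theta>)"
        using int by (intro integral_mono) auto
      then have "1 \<le> (\<integral>p. ?A ?n \<theta> p \<partial>Q \<theta>) + (\<integral>p. ?E (\<not> \<theta>) p \<partial>Q \<theta>) + (\<integral>p. ?T ?n p \<partial>Q \<theta>) / real ?n"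
        using int by (simp add: Q.prob_space del: of_nat_Suc)
      moreover have "(\<integral>p. ?T ?n p \<partial>Q \<theta>) / real ?n \<le> enn2real D / real ?n" by (intro divide_right_mono time) simp
      ultimately have correct: "1 - e - enn2real D / real ?n \<le> (\<integral>p. ?A ?n \<theta> p \<partial>Q \<theta>)" using err[of \<theta>] by linarith
      have "(\<integral>p. ?A ?n \<theta> p \<partial>Q (\<not> \<theta>)) \<le> (\<integral>p. ?E \<theta> p \<partial>Q (\<not> \<theta>))"
        using int decides_within_imp_decides by (intro integral_mono) auto
      then have wrong: "(\<integral>p. ?A ?n \<theta> p \<partial>Q (\<not> \<theta>)) \<le> e" using err[of "\<not> \<theta>"] by simp
      have "l * (1 - e - enn2real D / real ?n) \<le> l * (\<integral>p. ?A ?n \<theta> p \<partial>Q \<theta>)" by (rule mult_left_mono[OF correct l])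
      moreover have "(\<integral>p. ?A ?n \<theta> p \<partial>Q (\<not> \<theta>)) * (exp l - 1) \<le> e * (exp l - 1)"
        using wrong l by (intro mult_right_mono) auto
      moreover have "?I * (\<integral>p. ?T ?n p \<partial>Q \<theta>) \<le> ?I * enn2real D" by (rule mult_left_mono[OF time I0])
      moreover have "l * (\<integral>p. ?A ?n \<theta> p \<partial>Q \<theta>) + 1 - ln 2 - (1 + (\<integral>p. ?A ?n \<theta> p \<partial>Q (\<not> \<theta>)) * (exp l - 1)) / 2
          \<le> ?I * (\<integral>p. ?T ?n p \<partial>Q \<theta>)"
        using flip_converse_horizon[OF sc adm, where l=l and n="?n" and \<theta>=\<theta>] unfolding Q_def .
      moreover have "0 \<le> e"
      proof -
        have "0 \<le> (\<integral>p. ?E (\<not> True) p \<partial>Q True)" by (rule integral_nonneg_AE) simp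
        then show ?thesis using err[of True] by linarith
      qed
      moreover have "e * (exp l - 1) = e * exp l - e" by (simp add: right_diff_distrib)
      \<comment> \<open>Pure arithmetic with the integrals abstracted; it discards the nonnegative
        term \<open>e / 2\<close>.\<close>
      moreover have "a + 1 / 2 - k - z / 2 \<le> r"
        if "a \<le> b" "u \<le> w" "q \<le> r" "b + 1 - k - (1 + u) / 2 \<le> q" "0 \<le> e" "w = z - e" for a b u w q r k z :: real
        using that by (simp add: field_simps)
      ultimately show ?thesis by blast
    qed
    have lim: "(\<lambda>n. l * (1 - e - enn2real D / real (Suc n)) + 1 / 2 - ln 2 - e * exp l / 2) \<longlonglongrightarrow>
        l * (1 - e - 0) + 1 / 2 - ln 2 - e * exp l / 2"
      by (intro tendsto_intros LIMSEQ_Suc[OF lim_const_over_n])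
    have "l * (1 - e - 0) + 1 / 2 - ln 2 - e * exp l / 2 \<le> ?I * enn2real D"
      by (rule LIMSEQ_le_const2[OF lim]) (use step in blast)
    then show ?thesis by simp
  qed
  \<comment> \<open>\<open>D\<close> dominates the mean time in either state, so the state with the
    smaller information gives the stronger inequality.\<close>
  show ?thesis using main[of True] main[of False] by (auto simp: info_def min_def)
qed

end

section \<open>Equilibrium\<close>

lemma max_err_nonneg: "0 \<le> max_err s \<mu> \<nu> Rd d R A"
  by (simp add: max_err_def err_prob_def le_max_iff_disj)

lemma run_time_ge_1: "1 \<le> run_time d x v"
  unfolding run_time_def using of_nat_mono[of 1 "Suc n" for n, where 'a=ennreal] by auto

context sensor_pair
begin

text \<open>Keeps the denominator of \<open>perf_ratio\<close> away from 0 in the lower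
  bound.\<close>

lemma delay_ge_1:
  assumes "prob_space R" "prob_space Rd"
  shows "1 \<le> delay s \<mu> \<nu> Rd d R A"
proof -
  have "prob_space (base_measure s \<mu> \<nu> R Rd True)"
    unfolding base_measure_def obs_law_eq by (intro prob_space_pair prob_space_PiM prob_law assms)
  then interpret prob_space "base_measure s \<mu> \<nu> R Rd True" .
  have "(\<integral>\<^sup>+p. 1 \<partial>base_measure s \<mu> \<nu> R Rd True) \<le> exp_time s \<mu> \<nu> Rd d R A True"
    unfolding exp_time_def by (intro nn_integral_mono run_time_ge_1)
  then show ?thesis by (simp add: emeasure_space_1 delay_def le_max_iff_disj)
qed

text \<open>The filter stays general because the bound is used both along arbitrary sequences of
  tests and along the threshold of the voting rule.\<close>

lemma flip_Limsup:
  fixes d :: "'x \<Rightarrow> nat \<Rightarrow> obs \<Rightarrow> 'd \<Rightarrow> bool option" and Rd :: "'x \<Rightarrow> 'd measure"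
  assumes sc: "2 * c < s" and adm: "eventually (\<lambda>n. admissible_test s (Rd n) (d n)) F"
    and lim: "((\<lambda>n. max_err s \<mu> \<nu> (Rd n) (d n) (flip_rand s \<mu> \<nu>) (flip_attack s c)) \<longlongrightarrow> 0) F"
  shows "Limsup F (\<lambda>n. perf_ratio s \<mu> \<nu> (Rd n) (d n) (flip_rand s \<mu> \<nu>) (flip_attack s c))
    \<le> ereal ((real s - 2 * real c) * min (I0 \<mu> \<nu>) (I1 \<mu> \<nu>))"
  unfolding Limsup_le_iff
proof (intro allI impI)
  define K where "K = (real s - 2 * real c) * min (I0 \<mu> \<nu>) (I1 \<mu> \<nu>)"
  fix y :: ereal assume "ereal ((real s - 2 * real c) * min (I0 \<mu> \<nu>) (I1 \<mu> \<nu>)) < y"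
  then have y: "ereal K < y" by (simp add: K_def)
  have K: "0 < K" unfolding K_def using sc I0_pos I1_pos by (intro mult_pos_pos) auto
  obtain r where r: "K < r" "ereal r \<le> y"
    using y by (cases y) (auto intro: that[of "K + 1"])
  define q where "q = K / r"
  have q: "0 < q" "q < 1" unfolding q_def using K r by auto
  \<comment> \<open>The first bound gives \<open>1 - e \<ge> (1 + q) / 2\<close>, the second makes
    \<open>- ln e\<close> so large that \<open>ln 2\<close> is less than its
    \<open>(1 - q) / 2\<close> fold. Together they leave more than the fraction \<open>q\<close> of
    \<open>- ln e\<close>.\<close>
  define \<delta> where "\<delta> = min ((1 - q) / 2) (exp (- (2 * ln 2 / (1 - q))))"
  have \<delta>: "0 < \<delta>" unfolding \<delta>_def using q by simp
  have "eventually (\<lambda>n. max_err s \<mu> \<nu> (Rd n) (d n) (flip_rand s \<mu> \<nu>) (flip_attack s c) < \<delta>) F"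
    using lim \<delta> by (rule order_tendstoD)
  with adm show "eventually (\<lambda>n. perf_ratio s \<mu> \<nu> (Rd n) (d n) (flip_rand s \<mu> \<nu>) (flip_attack s c) < y) F"
  proof eventually_elim
    case (elim n)
    define e where "e = max_err s \<mu> \<nu> (Rd n) (d n) (flip_rand s \<mu> \<nu>) (flip_attack s c)"
    define D where "D = delay s \<mu> \<nu> (Rd n) (d n) (flip_rand s \<mu> \<nu>) (flip_attack s c)"
    have e0: "0 \<le> e" unfolding e_def by (rule max_err_nonneg)
    have e\<delta>: "e < \<delta>" using elim unfolding e_def by simp
    have perf: "perf_ratio s \<mu> \<nu> (Rd n) (d n) (flip_rand s \<mu> \<nu>) (flip_attack s c) =
        (if e = 0 then \<infinity> else ereal (- ln e)) / enn2ereal D"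
      unfolding perf_ratio_def e_def D_def Let_def ..
    have r0: "0 < r" using K r by simp
    have "perf_ratio s \<mu> \<nu> (Rd n) (d n) (flip_rand s \<mu> \<nu>) (flip_attack s c) < ereal r"
    proof (cases "D = \<infinity>")
      case True
      \<comment> \<open>Division by infinity yields 0 in \<open>ereal\<close>, even for an infinite
        numerator.\<close>
      then have "enn2ereal D = \<infinity>" by simp
      then show ?thesis unfolding perf using r0 by simp
    next
      case False
      then have Dfin: "D < \<infinity>" by (simp add: less_top)
      define D' where "D' = enn2real D"
      have D'0: "0 \<le> D'" unfolding D'_def by simp
      have D_eq: "enn2ereal D = ereal D'" unfolding D'_def using Dfin
        by (cases D) (auto simp: enn2ereal_ennreal)
      have conv: "l * (1 - e) + 1 / 2 - ln 2 - e * exp l / 2 \<le> K * D'" if "0 \<le> l" for l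
        using flip_converse[OF sc elim(1) that] Dfin unfolding e_def D_def D'_def K_def by simp
      have ln2: "ln 2 < (1::real)" using ln_2_less_1 .
      \<comment> \<open>Without errors \<open>l\<close> could grow without limit while the delay
        stays finite; \<open>K * D' + 1\<close> already exceeds what the converse permits.\<close>
      have "e \<noteq> 0"
      proof
        assume "e = 0"
        then have "K * D' + 1 + 1 / 2 - ln 2 \<le> K * D'" using conv[of "K * D' + 1"] K D'0 by simp
        then show False using ln2 by simp
      qed
      then have epos: "0 < e" using e0 by simp
      define L where "L = - ln e"
      have L_big: "2 * ln 2 / (1 - q) < L"
      proof -
        have "ln e < ln (exp (- (2 * ln 2 / (1 - q))))"
          using epos e\<delta> unfolding \<delta>_def by (subst ln_less_cancel_iff) auto
        then show ?thesis unfolding L_def by simp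
      qed
      have L0: "0 < L"
      proof -
        have "0 < 2 * ln 2 / (1 - q)" using q by simp
        then show ?thesis using L_big by linarith
      qed
      \<comment> \<open>At \<open>l = L\<close> the term \<open>e * exp l / 2\<close> equals 1/2 and
        cancels, so that \<open>ln 2\<close> is the only additive loss.\<close>
      have "exp L = 1 / e" unfolding L_def using epos by (simp add: exp_minus inverse_eq_divide)
      then have cv: "L * (1 - e) - ln 2 \<le> K * D'" using conv[of L] L0 epos by simp
      have "ln 2 < L * ((1 - q) / 2)" using L_big q by (simp add: field_simps)
      moreover have "L * ((1 + q) / 2) \<le> L * (1 - e)"
        using e\<delta> L0 unfolding \<delta>_def by (intro mult_left_mono) (auto simp: field_simps)
      moreover have "L * ((1 + q) / 2) - L * ((1 - q) / 2) = q * L" by (simp add: field_simps)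
      ultimately have "q * L < K * D'" using cv by linarith
      then have "K * L < K * (r * D')" using r0 unfolding q_def by (simp add: field_simps)
      then have Lr: "L < r * D'" using K by simp
      then have D'pos: "0 < D'" using L0 r0 by (smt (verit) zero_less_mult_pos)
      have "L / D' < r" using Lr D'pos by (simp add: field_simps)
      then show ?thesis unfolding perf D_eq using \<open>e \<noteq> 0\<close> D'pos by (simp add: L_def)
    qed
    then show ?case using r(2) by (rule less_le_trans)
  qed
qed

lemma attack_error_tendsto_0:
  assumes sc: "2 * c < s" and adm: "admissible_attack s c \<mu> \<nu> C R A"
  shows "((\<lambda>t. max_err s \<mu> \<nu> fair_coin (voting_rule s (s - c) \<mu> \<nu> t) R A) \<longlongrightarrow> 0) at_top"
proof (rule tendsto_sandwich)
  show "eventually (\<lambda>t. 0 \<le> max_err s \<mu> \<nu> fair_coin (voting_rule s (s - c) \<mu> \<nu> t) R A) at_top"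
    by (simp add: max_err_nonneg)
  show "eventually (\<lambda>t. max_err s \<mu> \<nu> fair_coin (voting_rule s (s - c) \<mu> \<nu> t) R A \<le> 2 ^ s * exp (- t) ^ (s - 2 * c)) at_top"
    using attack_error_bound[OF adm sc] by (simp add: max_err_def)
  have "((\<lambda>t::real. exp (- t)) \<longlongrightarrow> 0) at_top"
    by (rule filterlim_compose[OF exp_at_bot filterlim_uminus_at_bot_at_top])
  then have "((\<lambda>t::real. 2 ^ s * exp (- t) ^ (s - 2 * c)) \<longlongrightarrow> 2 ^ s * 0 ^ (s - 2 * c)) at_top"
    by (intro tendsto_intros)
  moreover have "2 ^ s * 0 ^ (s - 2 * c) = (0::real)" using sc by simp
  ultimately show "((\<lambda>t::real. 2 ^ s * exp (- t) ^ (s - 2 * c)) \<longlongrightarrow> 0) at_top" by (simp only:)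
qed simp

text \<open>The numerator is at least \<open>(s - 2c) t - s ln 2\<close> and the delay at most
  \<open>t / J + b\<close>, so the ratio is asymptotically at least \<open>(s - 2c) J\<close> for
  every \<open>J < I\<close>.\<close>

lemma attack_Liminf:
  assumes sc: "2 * c < s" and adm: "admissible_attack s c \<mu> \<nu> C R A"
  shows "ereal ((real s - 2 * real c) * min (I0 \<mu> \<nu>) (I1 \<mu> \<nu>))
    \<le> Liminf at_top (\<lambda>t. perf_ratio s \<mu> \<nu> fair_coin (voting_rule s (s - c) \<mu> \<nu> t) R A)"
  unfolding le_Liminf_iff
proof (intro allI impI)
  define m where "m = real s - 2 * real c"
  define I where "I = min (I0 \<mu> \<nu>) (I1 \<mu> \<nu>)"
  have m: "0 < m" "m = real (s - 2 * c)" unfolding m_def using sc by (auto simp: of_nat_diff)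
  have I: "0 < I" unfolding I_def using I0_pos I1_pos by simp
  fix y assume "y < ereal ((real s - 2 * real c) * min (I0 \<mu> \<nu>) (I1 \<mu> \<nu>))"
  then have "y < ereal (m * I)" by (simp add: m_def I_def)
  then obtain r where r: "y \<le> ereal r" "r < m * I" "0 < r"
  proof (cases y)
    case (real y0)
    then show ?thesis using that[of "max y0 (m * I / 2)"] \<open>y < ereal (m * I)\<close> m(1) I by (auto simp: less_max_iff_disj)
  next
    case MInf
    then show ?thesis using that[of "m * I / 2"] m(1) I by auto
  qed simp
  \<comment> \<open>The midpoint leaves room on both sides: \<open>J < I\<close> for the delay bound
    and \<open>r < m * J\<close> for the conclusion.\<close>
  define J where "J = (r / m + I) / 2"
  have J: "0 < J" "J < I" "r < m * J" using r m(1) I unfolding J_def by (auto simp: field_simps)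
  have R: "prob_space R" using adm by (auto simp: admissible_attack_def)
  have coin: "prob_space fair_coin" unfolding fair_coin_def by (rule measure_pmf.prob_space_axioms)
  have "J < info \<theta>" for \<theta> using J(2) by (cases \<theta>) (auto simp: I_def info_def)
  then obtain B where B: "\<And>\<theta>. 0 \<le> B \<theta>"
    "\<And>\<theta> t. 0 < t \<Longrightarrow> exp_time s \<mu> \<nu> fair_coin (voting_rule s (s - c) \<mu> \<nu> t) R A \<theta> \<le> ennreal (t / J + B \<theta>)"
    using attack_delay_bound[OF adm sc J(1)] by metis
  define b where "b = max (B False) (B True)"
  have delay: "delay s \<mu> \<nu> fair_coin (voting_rule s (s - c) \<mu> \<nu> t) R A \<le> ennreal (t / J + b)" if "0 < t" for t
  proof -
    have "exp_time s \<mu> \<nu> fair_coin (voting_rule s (s - c) \<mu> \<nu> t) R A \<theta> \<le> ennreal (t / J + b)" for \<theta>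
    proof -
      have "B \<theta> \<le> b" unfolding b_def by (cases \<theta>) auto
      then show ?thesis using B(2)[OF that, of \<theta>] by (meson add_left_mono ennreal_leI order_trans)
    qed
    then show ?thesis unfolding delay_def by simp
  qed
  \<comment> \<open>The solution of \<open>r * (t / J + b) = m * t - s * ln 2\<close>; beyond it the
    ratio exceeds \<open>r\<close>.\<close>
  define t0 where "t0 = (real s * ln 2 + r * b) / (m - r / J)"
  have gap: "0 < m - r / J" using J by (simp add: field_simps)
  have "eventually (\<lambda>t::real. 0 < t \<and> t0 < t) at_top"
    by (intro eventually_conj eventually_gt_at_top)
  then show "eventually (\<lambda>t. y < perf_ratio s \<mu> \<nu> fair_coin (voting_rule s (s - c) \<mu> \<nu> t) R A) at_top"
  proof eventually_elim
    case (elim t)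
    define e where "e = max_err s \<mu> \<nu> fair_coin (voting_rule s (s - c) \<mu> \<nu> t) R A"
    define D where "D = delay s \<mu> \<nu> fair_coin (voting_rule s (s - c) \<mu> \<nu> t) R A"
    have e0: "0 \<le> e" unfolding e_def by (rule max_err_nonneg)
    have e_le: "e \<le> 2 ^ s * exp (- t) ^ (s - 2 * c)"
      unfolding e_def max_err_def using attack_error_bound[OF adm sc] by simp
    have D1: "1 \<le> D" unfolding D_def by (rule delay_ge_1[OF R coin])
    have D_le: "D \<le> ennreal (t / J + b)" unfolding D_def using delay elim by simp
    obtain D' where D': "D = ennreal D'" "1 \<le> D'"
      using D1 D_le by (cases D) (auto simp: top_unique)
    have tb: "0 \<le> t / J + b" using elim J(1) B(1) unfolding b_def by (simp add: le_max_iff_disj)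
    have D'_le: "D' \<le> t / J + b" using D_le tb unfolding D'(1) by (simp add: ennreal_le_iff)
    have D_eq: "enn2ereal D = ereal D'" unfolding D'(1) using D'(2) by (simp add: enn2ereal_ennreal)
    have perf: "perf_ratio s \<mu> \<nu> fair_coin (voting_rule s (s - c) \<mu> \<nu> t) R A =
        (if e = 0 then \<infinity> else ereal (- ln e)) / enn2ereal D"
      unfolding perf_ratio_def e_def D_def Let_def ..
    have "ereal r < perf_ratio s \<mu> \<nu> fair_coin (voting_rule s (s - c) \<mu> \<nu> t) R A"
    proof (cases "e = 0")
      case True
      then show ?thesis unfolding perf D_eq using D'(2) by (simp add: ereal_divide_eq)
    next
      case False
      then have epos: "0 < e" using e0 by simp
      have "ln e \<le> ln (2 ^ s * exp (- t) ^ (s - 2 * c))" using e_le epos by (subst ln_le_cancel_iff) auto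
      also have "\<dots> = real s * ln 2 - m * t"
        by (simp add: ln_mult ln_realpow m(2))
      finally have L: "m * t - real s * ln 2 \<le> - ln e" by simp
      have "real s * ln 2 + r * b < t * (m - r / J)"
        using elim gap unfolding t0_def by (simp add: pos_divide_less_eq)
      then have "r * (t / J + b) < m * t - real s * ln 2" by (simp add: algebra_simps)
      moreover have "r * D' \<le> r * (t / J + b)" using D'_le r(3) by (intro mult_left_mono) auto
      ultimately have "r * D' < - ln e" using L by linarith
      then have "r < - ln e / D'" using D'(2) by (simp add: field_simps)
      then show ?thesis unfolding perf D_eq using False D'(2) by simp
    qed
    then show ?case using r(1) by (rule le_less_trans[rotated])
  qed
qed

text \<open>The flip is itself an admissible attack and the voting rules are admissible tests with
  vanishing error, so the two general bounds meet.\<close>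

lemma equilibrium_value:
  assumes sc: "2 * c < s"
  shows "((\<lambda>t. perf_ratio s \<mu> \<nu> fair_coin (voting_rule s (s - c) \<mu> \<nu> t) (flip_rand s \<mu> \<nu>) (flip_attack s c))
    \<longlongrightarrow> ereal ((real s - 2 * real c) * min (I0 \<mu> \<nu>) (I1 \<mu> \<nu>))) at_top"
proof -
  have adm: "admissible_attack s c \<mu> \<nu> (flip_C s c) (flip_rand s \<mu> \<nu>) (flip_attack s c)"
    using sc by (intro admissible_flip_attack) simp
  let ?f = "\<lambda>t. perf_ratio s \<mu> \<nu> fair_coin (voting_rule s (s - c) \<mu> \<nu> t) (flip_rand s \<mu> \<nu>) (flip_attack s c)"
  let ?K = "ereal ((real s - 2 * real c) * min (I0 \<mu> \<nu>) (I1 \<mu> \<nu>))"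
  have "?K \<le> Liminf at_top ?f" by (rule attack_Liminf[OF sc adm])
  moreover have "Limsup at_top ?f \<le> ?K"
    by (rule flip_Limsup[OF sc _ attack_error_tendsto_0[OF sc adm]]) (simp add: admissible_voting_rule)
  moreover have "Liminf at_top ?f \<le> Limsup at_top ?f" by (rule Liminf_le_Limsup) simp
  ultimately show ?thesis by (subst tendsto_iff_Liminf_eq_Limsup) auto
qed

end

text \<open>An arbitrary opponent need not produce a convergent ratio. Hence the upper bound is put
  on the limit superior and the lower bound on the limit inferior, while the equilibrium pair has a
  genuine limit.\<close>

theorem theorem4:
  fixes \<mu> \<nu> :: "real measure" and s c :: nat
  assumes "prob_space \<mu>" and "prob_space \<nu>"
    and "sets \<mu> = sets borel" and "sets \<nu> = sets borel"
    and "absolutely_continuous \<nu> \<mu>" and "absolutely_continuous \<mu> \<nu>"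
    and "integrable \<mu> (LLR \<mu> \<nu>)" and "integrable \<nu> (LLR \<mu> \<nu>)"
    and "0 < I0 \<mu> \<nu>" and "0 < I1 \<mu> \<nu>"
    and "2 * c < s"
  shows
    "admissible_attack s c \<mu> \<nu> (flip_C s c) (flip_rand s \<mu> \<nu>) (flip_attack s c)
     \<and> (\<forall>t>0. admissible_test s fair_coin (voting_rule s (s - c) \<mu> \<nu> t))
     \<and> (\<forall>(Rd :: nat \<Rightarrow> 'd measure) (d :: nat \<Rightarrow> nat \<Rightarrow> obs \<Rightarrow> 'd \<Rightarrow> bool option).
          (\<forall>n. admissible_test s (Rd n) (d n))
          \<and> (\<lambda>n. max_err s \<mu> \<nu> (Rd n) (d n) (flip_rand s \<mu> \<nu>) (flip_attack s c)) \<longlonglongrightarrow> 0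
          \<longrightarrow> limsup (\<lambda>n. perf_ratio s \<mu> \<nu> (Rd n) (d n) (flip_rand s \<mu> \<nu>) (flip_attack s c))
              \<le> ereal ((real s - 2 * real c) * min (I0 \<mu> \<nu>) (I1 \<mu> \<nu>)))
     \<and> ((\<lambda>t. perf_ratio s \<mu> \<nu> fair_coin (voting_rule s (s - c) \<mu> \<nu> t) (flip_rand s \<mu> \<nu>) (flip_attack s c))
          \<longlongrightarrow> ereal ((real s - 2 * real c) * min (I0 \<mu> \<nu>) (I1 \<mu> \<nu>))) at_top
     \<and> (\<forall>C (R :: 'r measure) A. admissible_attack s c \<mu> \<nu> C R A \<longrightarrow>
          ereal ((real s - 2 * real c) * min (I0 \<mu> \<nu>) (I1 \<mu> \<nu>))
          \<le> Liminf at_top (\<lambda>t. perf_ratio s \<mu> \<nu> fair_coin (voting_rule s (s - c) \<mu> \<nu> t) R A))"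
proof -
  interpret sensor_pair \<mu> \<nu> by (rule sensor_pair.intro) (fact assms)+
  note sc = assms(11)
  show ?thesis
    using sc by (intro conjI allI impI admissible_flip_attack admissible_voting_rule flip_Limsup[OF sc]
        equilibrium_value[OF sc] attack_Liminf[OF sc]) auto
qed

end
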